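(* Let $c_L,h\in\mathbb{C}$, $c_{L,I}\in\mathbb{C}\setminus\{0\}$, and let $h_I\in\mathbb{C}$ be such that $p=\frac{h_I}{c_{L,I}}-1\in\mathbb{Z}_{>0}$. Let $\alpha,\beta,F\in\mathbb{C}$ be such that the intermediate series module $V'_{\alpha,\beta,F}$ is irreducible. Then the $\mathcal H$-module $V'_{\alpha,\beta,F}\otimes L^{\mathcal H}(c_L,0,c_{L,I},h,h_I)$ is irreducible if and only if $F\neq(i-p)c_{L,I}$ for $i=1,\dots,p$.
   Context: The twisted Heisenberg-Virasoro algebra $\mathcal H$ is the complex Lie algebra with basis $\{L(n),I(n):n\in\mathbb{Z}\}\cup\{C_L,C_{LI},C_I\}$ and brackets $[L(n),L(m)]=(n-m)L(n+m)+\delta_{n,-m}\frac{n^3-n}{12}C_L$, $[L(n),I(m)]=-mI(n+m)-\delta_{n,-m}(n^2+n)C_{LI}$, $[I(n),I(m)]=n\delta_{n,-m}C_I$, with $C_L,C_{LI},C_I$ central. $L^{\mathcal H}(c_L,0,c_{L,I},h,h_I)$ is the irreducible highest weight $\mathcal H$-module on which $C_L,C_I,C_{LI}$ act as $c_L,0,c_{L,I}$ and whose highest weight vector (annihilated by $L(n),I(n)$, $n>0$) has $L(0),I(0)$-eigenvalues $h,h_I$. $V'_{\alpha,\beta,F}=\bigoplus_{n\in\mathbb{Z}}\mathbb{C}v_n$ denotes an irreducible $\mathcal H$-module from the intermediate series, with action $L(k)v_n=-(n+\alpha+\beta+k\beta)v_{n+k}$, $I(k)v_n=Fv_{n+k}$,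 and $C_L,C_{LI},C_I$ acting as $0$. The tensor product is the usual tensor product of Lie algebra modules. *)

theory Defs
  imports Complex_Main "HOL-Library.Poly_Mapping"
begin

section \<open>Complex vector spaces\<close>

class scaleC =
  fixes scaleC :: "complex \<Rightarrow> 'a \<Rightarrow> 'a"  (infixr "*\<^sub>C" 75)

class complex_vector = scaleC + ab_group_add +
  assumes scaleC_add_right: "a *\<^sub>C (x + y) = a *\<^sub>C x + a *\<^sub>C y"
    and scaleC_add_left: "(a + b) *\<^sub>C x = a *\<^sub>C x + b *\<^sub>C x"
    and scaleC_scaleC: "a *\<^sub>C b *\<^sub>C x = (a * b) *\<^sub>C x"
    and scaleC_one: "1 *\<^sub>C x = x"

global_interpretation complex_vector: vector_space "scaleC :: complex \<Rightarrow> 'a \<Rightarrow> 'a::complex_vector"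
  by unfold_locales (simp_all add: scaleC_add_right scaleC_add_left scaleC_scaleC scaleC_one)

abbreviation clinear :: "('a::complex_vector \<Rightarrow> 'b::complex_vector) \<Rightarrow> bool"
  where "clinear \<equiv> Vector_Spaces.linear scaleC scaleC"

definition cbilinear :: "('a::complex_vector \<Rightarrow> 'b::complex_vector \<Rightarrow> 'c::complex_vector) \<Rightarrow> bool"
  where "cbilinear f \<longleftrightarrow> (\<forall>x. clinear (f x)) \<and> (\<forall>y. clinear (\<lambda>x. f x y))"

lemma clinearI:
  assumes "\<And>x y. f (x + y) = f x + f y" "\<And>c x. f (c *\<^sub>C x) = c *\<^sub>C f x"
  shows "clinear f"
  using assms by unfold_locales auto

lemma clinear_add: "clinear f \<Longrightarrow> f (x + y) = f x + f y"
  using module_hom.add Vector_Spaces.linear_iff_module_hom by blast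

lemma clinear_scale: "clinear f \<Longrightarrow> f (c *\<^sub>C x) = c *\<^sub>C f x"
  using module_hom.scale Vector_Spaces.linear_iff_module_hom by blast

lemma clinear_0: "clinear f \<Longrightarrow> f 0 = 0"
  using clinear_scale[of f 0 0] by simp

lemma clinear_minus: "clinear f \<Longrightarrow> f (- x) = - f x"
  using clinear_scale[of f "-1" x] by simp

lemma clinear_diff: "clinear f \<Longrightarrow> f (x - y) = f x - f y"
  using clinear_add[of f x "- y"] clinear_minus[of f y] by simp

lemma clinear_sum: "clinear f \<Longrightarrow> f (sum g A) = (\<Sum>a\<in>A. f (g a))"
  by (induction A rule: infinite_finite_induct) (auto simp: clinear_0 clinear_add)

lemma cbilinearI:
  assumes "\<And>x x' y. f (x + x') y = f x y + f x' y" "\<And>c x y. f (c *\<^sub>C x) y = c *\<^sub>C f x y"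
    and "\<And>x y y'. f x (y + y') = f x y + f x y'" "\<And>c x y. f x (c *\<^sub>C y) = c *\<^sub>C f x y"
  shows "cbilinear f"
  unfolding cbilinear_def using assms by (auto intro!: clinearI)

lemma cbilinearD:
  assumes "cbilinear f"
  shows "f (x + x') y = f x y + f x' y" "f (c *\<^sub>C x) y = c *\<^sub>C f x y"
    and "f x (y + y') = f x y + f x y'" "f x (c *\<^sub>C y) = c *\<^sub>C f x y"
  using assms clinear_add[of "f x"] clinear_scale[of "f x"]
    clinear_add[of "\<lambda>x. f x y"] clinear_scale[of "\<lambda>x. f x y"]
  by (auto simp: cbilinear_def)

section \<open>Free vector spaces\<close>

text \<open>The free complex vector space on \<open>'k\<close> is \<open>'k \<Rightarrow>\<^sub>0 complex\<close>, with basis vectors \<open>fbasis k\<close>.\<close>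

instantiation complex :: complex_vector
begin

definition scaleC_complex :: "complex \<Rightarrow> complex \<Rightarrow> complex"
  where "scaleC_complex c x = c * x"

instance
  by standard (simp_all add: scaleC_complex_def algebra_simps)

end

instantiation poly_mapping :: (type, complex_vector) complex_vector
begin

definition scaleC_poly_mapping :: "complex \<Rightarrow> ('a \<Rightarrow>\<^sub>0 'b) \<Rightarrow> ('a \<Rightarrow>\<^sub>0 'b)"
  where "scaleC_poly_mapping c p = Poly_Mapping.map (\<lambda>x. c *\<^sub>C x) p"

lemma lookup_scaleC: "Poly_Mapping.lookup (c *\<^sub>C p) k = c *\<^sub>C Poly_Mapping.lookup (p :: 'a \<Rightarrow>\<^sub>0 'b) k"
  unfolding scaleC_poly_mapping_def by (simp add: Poly_Mapping.map.rep_eq when_def)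

instance
  by standard
    (auto intro!: poly_mapping_eqI
      simp: lookup_scaleC lookup_add scaleC_add_right scaleC_add_left scaleC_scaleC scaleC_one)

end

definition fbasis :: "'k \<Rightarrow> ('k \<Rightarrow>\<^sub>0 complex)"
  where "fbasis k = Poly_Mapping.single k 1"

definition lin_ext :: "('k \<Rightarrow> 'v::complex_vector) \<Rightarrow> ('k \<Rightarrow>\<^sub>0 complex) \<Rightarrow> 'v"
  where "lin_ext f p = (\<Sum>k\<in>Poly_Mapping.keys p. Poly_Mapping.lookup p k *\<^sub>C f k)"

definition bilin_ext ::
    "('k \<Rightarrow> 'm \<Rightarrow> 'v::complex_vector) \<Rightarrow> ('k \<Rightarrow>\<^sub>0 complex) \<Rightarrow> ('m \<Rightarrow>\<^sub>0 complex) \<Rightarrow> 'v"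
  where "bilin_ext f p q = lin_ext (\<lambda>k. lin_ext (f k) q) p"

lemma lin_ext_superset:
  assumes "finite S" "Poly_Mapping.keys p \<subseteq> S"
  shows "lin_ext f p = (\<Sum>k\<in>S. Poly_Mapping.lookup p k *\<^sub>C f k)"
  unfolding lin_ext_def
  by (rule sum.mono_neutral_left) (use assms in \<open>auto simp: in_keys_iff\<close>)

lemma clinear_lin_ext: "clinear (lin_ext f)"
proof (rule clinearI)
  fix p q :: "'a \<Rightarrow>\<^sub>0 complex"
  let ?S = "Poly_Mapping.keys p \<union> Poly_Mapping.keys q"
  have "Poly_Mapping.keys (p + q) \<subseteq> ?S"
    by (rule Poly_Mapping.keys_add)
  then show "lin_ext f (p + q) = lin_ext f p + lin_ext f q"
    by (simp add: lin_ext_superset[where S = ?S] lookup_add scaleC_add_left sum.distrib)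
next
  fix c and p :: "'a \<Rightarrow>\<^sub>0 complex"
  have "Poly_Mapping.keys (c *\<^sub>C p) \<subseteq> Poly_Mapping.keys p"
    by (auto simp: in_keys_iff lookup_scaleC scaleC_complex_def)
  then show "lin_ext f (c *\<^sub>C p) = c *\<^sub>C lin_ext f p"
    by (simp add: lin_ext_superset[where S = "Poly_Mapping.keys p"] lookup_scaleC
        scaleC_complex_def complex_vector.scale_sum_right scaleC_scaleC)
qed

lemma lin_ext_fbasis [simp]: "lin_ext f (fbasis k) = f k"
  by (simp add: lin_ext_def fbasis_def scaleC_one)

lemma lin_ext_fbasis_self: "lin_ext fbasis p = p"
  by (rule poly_mapping_eqI)
    (auto simp: lin_ext_def lookup_sum lookup_scaleC fbasis_def lookup_single when_def
      scaleC_complex_def in_keys_iff if_distrib cong: if_cong)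

lemma clinear_eq_on_fbasis:
  assumes "clinear f" "clinear g" "\<And>k. f (fbasis k) = g (fbasis k)"
  shows "f p = g p"
proof -
  have "f (lin_ext fbasis p) = g (lin_ext fbasis p)"
    unfolding lin_ext_def using assms by (simp add: clinear_sum clinear_scale)
  then show ?thesis
    by (simp add: lin_ext_fbasis_self)
qed

lemma lin_ext_fun_add: "lin_ext (\<lambda>k. f k + g k) p = lin_ext f p + lin_ext g p"
  by (simp add: lin_ext_def scaleC_add_right sum.distrib)

lemma lin_ext_fun_scale: "lin_ext (\<lambda>k. c *\<^sub>C f k) p = c *\<^sub>C lin_ext f p"
  by (simp add: lin_ext_def complex_vector.scale_sum_right scaleC_scaleC mult.commute)

lemma cbilinear_bilin_ext: "cbilinear (bilin_ext f)"
  by (rule cbilinearI)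
    (simp_all add: bilin_ext_def clinear_add[OF clinear_lin_ext] clinear_scale[OF clinear_lin_ext]
      lin_ext_fun_add lin_ext_fun_scale)

lemma bilin_ext_fbasis [simp]: "bilin_ext f (fbasis k) (fbasis m) = f k m"
  by (simp add: bilin_ext_def)

section \<open>Tensor products of vector spaces\<close>

text \<open>\<open>V \<otimes> W\<close> is the free vector space on \<open>V \<times> W\<close> modulo the span of the bilinearity relations.\<close>

definition tensor_relations :: "('v::complex_vector \<times> 'w::complex_vector \<Rightarrow>\<^sub>0 complex) set"
  where "tensor_relations =
      {fbasis (v + v', w) - fbasis (v, w) - fbasis (v', w) | v v' w. True}
    \<union> {fbasis (v, w + w') - fbasis (v, w) - fbasis (v, w') | v w w'. True}
    \<union> {fbasis (c *\<^sub>C v, w) - c *\<^sub>C fbasis (v, w) | c v w. True}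
    \<union> {fbasis (v, c *\<^sub>C w) - c *\<^sub>C fbasis (v, w) | c v w. True}"

definition tensor_equiv ::
    "('v::complex_vector \<times> 'w::complex_vector \<Rightarrow>\<^sub>0 complex) \<Rightarrow> ('v \<times> 'w \<Rightarrow>\<^sub>0 complex) \<Rightarrow> bool"
  where "tensor_equiv p q \<longleftrightarrow> p - q \<in> complex_vector.span tensor_relations"

quotient_type (overloaded) ('v, 'w) tensor =
    "'v::complex_vector \<times> 'w::complex_vector \<Rightarrow>\<^sub>0 complex" / tensor_equiv
proof (rule equivpI)
  show "reflp tensor_equiv"
    by (auto simp: reflp_def tensor_equiv_def complex_vector.span_zero)
  show "symp tensor_equiv"
    unfolding symp_def tensor_equiv_def by (metis complex_vector.span_neg minus_diff_eq)
  show "transp tensor_equiv"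
    unfolding transp_def tensor_equiv_def
    using complex_vector.span_add by fastforce
qed

instantiation tensor :: (complex_vector, complex_vector) complex_vector
begin

lift_definition zero_tensor :: "('a, 'b) tensor" is 0 .

lift_definition plus_tensor :: "('a, 'b) tensor \<Rightarrow> ('a, 'b) tensor \<Rightarrow> ('a, 'b) tensor" is "(+)"
  unfolding tensor_equiv_def add_diff_add by (rule complex_vector.span_add)

lift_definition minus_tensor :: "('a, 'b) tensor \<Rightarrow> ('a, 'b) tensor \<Rightarrow> ('a, 'b) tensor" is "(-)"
proof -
  fix p p' q q' :: "'a \<times> 'b \<Rightarrow>\<^sub>0 complex"
  assume "tensor_equiv p p'" "tensor_equiv q q'"
  then have "(p - p') - (q - q') \<in> complex_vector.span tensor_relations"
    unfolding tensor_equiv_def by (rule complex_vector.span_diff)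
  then show "tensor_equiv (p - q) (p' - q')"
    by (simp add: tensor_equiv_def algebra_simps)
qed

lift_definition uminus_tensor :: "('a, 'b) tensor \<Rightarrow> ('a, 'b) tensor" is uminus
  unfolding tensor_equiv_def unfolding minus_diff_minus by (rule complex_vector.span_neg)

lift_definition scaleC_tensor :: "complex \<Rightarrow> ('a, 'b) tensor \<Rightarrow> ('a, 'b) tensor" is scaleC
  unfolding tensor_equiv_def complex_vector.scale_right_diff_distrib[symmetric]
  by (rule complex_vector.span_scale)

lemma tensor_equiv_refl: "tensor_equiv p p"
  by (simp add: tensor_equiv_def complex_vector.span_zero)

instance
  by standard
    (transfer, simp add: algebra_simps tensor_equiv_refl scaleC_add_right scaleC_add_left
        scaleC_scaleC scaleC_one)+

end

lift_definition pure_tensor :: "'v::complex_vector \<Rightarrow> 'w::complex_vector \<Rightarrow> ('v, 'w) tensor"  (infixr "\<otimes>\<^sub>C" 70)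
  is "\<lambda>v w. fbasis (v, w)" .

text \<open>The linear map \<open>V \<otimes> W \<rightarrow> U\<close> induced by a bilinear map \<open>f\<close>; for bilinear \<open>f\<close> the value does not
  depend on the representative (see \<open>tensor_lift_abs\<close> below).\<close>

definition tensor_lift ::
    "('v::complex_vector \<Rightarrow> 'w::complex_vector \<Rightarrow> 'u::complex_vector) \<Rightarrow> ('v, 'w) tensor \<Rightarrow> 'u"
  where "tensor_lift f t = lin_ext (\<lambda>(v, w). f v w) (rep_tensor t)"

lemma tensor_lift_abs:
  assumes "cbilinear f"
  shows "tensor_lift f (abs_tensor p) = lin_ext (\<lambda>(v, w). f v w) p"
proof -
  let ?g = "lin_ext (\<lambda>(v, w). f v w)"
  have *: "?g x = 0" if "x \<in> complex_vector.span tensor_relations" for x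
    using that
  proof (induction rule: complex_vector.span_induct_alt)
    case base
    show ?case by (rule clinear_0[OF clinear_lin_ext])
  next
    case (step c x y)
    have "?g x = 0"
      using step(1)
      by (auto simp: tensor_relations_def clinear_diff[OF clinear_lin_ext]
          clinear_scale[OF clinear_lin_ext] cbilinearD[OF assms])
    then show ?case
      using step by (simp add: clinear_add[OF clinear_lin_ext] clinear_scale[OF clinear_lin_ext])
  qed
  have "tensor_equiv (rep_tensor (abs_tensor p)) p"
    by (simp add: Quotient3_tensor rep_abs_rsp_left tensor_equiv_refl)
  then show ?thesis
    using * clinear_diff[OF clinear_lin_ext, of "\<lambda>(v, w). f v w" "rep_tensor (abs_tensor p)" p]
    by (simp add: tensor_lift_def tensor_equiv_def)
qed

lemma tensor_lift_pure [simp]: "cbilinear f \<Longrightarrow> tensor_lift f (v \<otimes>\<^sub>C w) = f v w"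
  by (simp add: pure_tensor.abs_eq tensor_lift_abs)

lemma clinear_abs_tensor: "clinear abs_tensor"
  by (rule clinearI) (simp_all add: plus_tensor.abs_eq scaleC_tensor.abs_eq)

lemma clinear_tensor_lift:
  assumes "cbilinear f"
  shows "clinear (tensor_lift f)"
proof (rule clinearI)
  fix s t :: "('a, 'b) tensor" and c
  obtain p q where pq: "s = abs_tensor p" "t = abs_tensor q"
    by (metis Quotient3_tensor Quotient3_abs_rep)
  show "tensor_lift f (s + t) = tensor_lift f s + tensor_lift f t"
    unfolding pq clinear_add[OF clinear_abs_tensor, symmetric] tensor_lift_abs[OF assms]
    by (rule clinear_add[OF clinear_lin_ext])
  show "tensor_lift f (c *\<^sub>C s) = c *\<^sub>C tensor_lift f s"
    unfolding pq clinear_scale[OF clinear_abs_tensor, symmetric] tensor_lift_abs[OF assms]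
    by (rule clinear_scale[OF clinear_lin_ext])
qed

lemma clinear_eq_on_pure:
  assumes "clinear f" "clinear g" "\<And>v w. f (v \<otimes>\<^sub>C w) = g (v \<otimes>\<^sub>C w)"
  shows "f t = g t"
proof -
  obtain p where p: "t = abs_tensor p"
    by (metis Quotient3_tensor Quotient3_abs_rep)
  have "(f \<circ> abs_tensor) p = (g \<circ> abs_tensor) p"
  proof (rule clinear_eq_on_fbasis)
    show "clinear (f \<circ> abs_tensor)" "clinear (g \<circ> abs_tensor)"
      using assms clinear_abs_tensor by (auto intro: Vector_Spaces.linear_compose)
    show "(f \<circ> abs_tensor) (fbasis k) = (g \<circ> abs_tensor) (fbasis k)" for k
      using assms(3)[of "fst k" "snd k"] by (simp add: pure_tensor.abs_eq)
  qed
  then show ?thesis by (simp add: p)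
qed

lemma cbilinear_pure_tensor: "cbilinear (\<otimes>\<^sub>C)"
proof (rule cbilinearI)
  show "(x + x') \<otimes>\<^sub>C y = x \<otimes>\<^sub>C y + x' \<otimes>\<^sub>C y" for x x' :: 'a and y :: 'b
    by transfer (unfold tensor_equiv_def tensor_relations_def diff_diff_eq[symmetric],
        rule complex_vector.span_base, blast)
  show "x \<otimes>\<^sub>C (y + y') = x \<otimes>\<^sub>C y + x \<otimes>\<^sub>C y'" for x :: 'a and y y' :: 'b
    by transfer (unfold tensor_equiv_def tensor_relations_def diff_diff_eq[symmetric],
        rule complex_vector.span_base, blast)
  show "(c *\<^sub>C x) \<otimes>\<^sub>C y = c *\<^sub>C (x \<otimes>\<^sub>C y)" "x \<otimes>\<^sub>C (c *\<^sub>C y) = c *\<^sub>C (x \<otimes>\<^sub>C y)" for c and x :: 'a and y :: 'b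
    by (transfer, unfold tensor_equiv_def tensor_relations_def, rule complex_vector.span_base, blast)+
qed

section \<open>Lie algebras and their modules\<close>

locale lie_algebra =
  fixes br :: "'g::complex_vector \<Rightarrow> 'g \<Rightarrow> 'g"
  assumes br_bilinear: "cbilinear br"
    and br_self: "br x x = 0"
    and jacobi: "br x (br y z) + br y (br z x) + br z (br x y) = 0"

locale lie_module = lie_algebra br for br :: "'g::complex_vector \<Rightarrow> 'g \<Rightarrow> 'g" +
  fixes act :: "'g \<Rightarrow> 'v::complex_vector \<Rightarrow> 'v"
  assumes act_bilinear: "cbilinear act"
    and act_br: "act (br x y) v = act x (act y v) - act y (act x v)"

definition lie_submodule :: "('g \<Rightarrow> 'v::complex_vector \<Rightarrow> 'v) \<Rightarrow> 'v set \<Rightarrow> bool"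
  where "lie_submodule act N \<longleftrightarrow>
    complex_vector.subspace N \<and> (\<forall>x. \<forall>v\<in>N. act x v \<in> N)"

definition irreducible_lie_module ::
    "('g::complex_vector \<Rightarrow> 'g \<Rightarrow> 'g) \<Rightarrow> ('g \<Rightarrow> 'v::complex_vector \<Rightarrow> 'v) \<Rightarrow> bool"
  where "irreducible_lie_module br act \<longleftrightarrow>
    lie_module br act \<and> (\<exists>v::'v. v \<noteq> 0) \<and>
    (\<forall>N. lie_submodule act N \<longrightarrow> N = {0} \<or> N = UNIV)"

definition tensor_act ::
    "('g \<Rightarrow> 'v::complex_vector \<Rightarrow> 'v) \<Rightarrow> ('g \<Rightarrow> 'w::complex_vector \<Rightarrow> 'w) \<Rightarrow>
      'g \<Rightarrow> ('v, 'w) tensor \<Rightarrow> ('v, 'w) tensor"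
  where "tensor_act actV actW x = tensor_lift (\<lambda>v w. actV x v \<otimes>\<^sub>C w + v \<otimes>\<^sub>C actW x w)"

lemma tensor_act_aux:
  assumes "cbilinear actV" "cbilinear actW"
  shows "cbilinear (\<lambda>v w. actV x v \<otimes>\<^sub>C w + v \<otimes>\<^sub>C actW x w)"
  by (rule cbilinearI)
    (simp_all add: cbilinearD[OF assms(1)] cbilinearD[OF assms(2)] algebra_simps
      cbilinearD[OF cbilinear_pure_tensor] scaleC_add_right)

lemma lie_module_tensor:
  assumes "lie_module br actV" "lie_module br actW"
  shows "lie_module br (tensor_act actV actW)"
proof -
  interpret V: lie_module br actV by fact
  interpret W: lie_module br actW by fact
  let ?T = "tensor_act actV actW"
  note aux = tensor_act_aux[OF V.act_bilinear W.act_bilinear]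
  have lin: "clinear (?T x)" for x
    unfolding tensor_act_def by (rule clinear_tensor_lift[OF aux])
  have pure: "?T x (v \<otimes>\<^sub>C w) = actV x v \<otimes>\<^sub>C w + v \<otimes>\<^sub>C actW x w" for x v w
    unfolding tensor_act_def by (rule tensor_lift_pure[OF aux])
  note pt = cbilinearD[OF cbilinear_pure_tensor]
  note VD = cbilinearD[OF V.act_bilinear] and WD = cbilinearD[OF W.act_bilinear]
  note L = clinear_add[OF lin] clinear_scale[OF lin] clinear_diff[OF lin]
  have pdl: "(a - b) \<otimes>\<^sub>C c = a \<otimes>\<^sub>C c - b \<otimes>\<^sub>C c" for a b :: 'b and c :: 'c
    using pt(1)[of "a - b" b c] by (simp add: algebra_simps)
  have pdr: "c \<otimes>\<^sub>C (a - b) = c \<otimes>\<^sub>C a - c \<otimes>\<^sub>C b" for a b :: 'c and c :: 'b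
    using pt(3)[of c "a - b" b] by (simp add: algebra_simps)
  show ?thesis
  proof
    show "cbilinear ?T"
    proof (rule cbilinearI)
      fix x x' :: 'a and c and t :: "('b, 'c) tensor"
      show "?T (x + x') t = ?T x t + ?T x' t"
        by (rule clinear_eq_on_pure[OF lin, where g = "\<lambda>t. ?T x t + ?T x' t"])
          (auto intro!: clinearI simp: L pure pt VD WD algebra_simps scaleC_add_right)
      show "?T (c *\<^sub>C x) t = c *\<^sub>C ?T x t"
        by (rule clinear_eq_on_pure[OF lin, where g = "\<lambda>t. c *\<^sub>C ?T x t"])
          (auto intro!: clinearI simp: L pure pt VD WD algebra_simps scaleC_add_right scaleC_scaleC)
    qed (simp_all add: L)
    show "?T (br x y) t = ?T x (?T y t) - ?T y (?T x t)" for x y t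
      by (rule clinear_eq_on_pure[OF lin, where g = "\<lambda>t. ?T x (?T y t) - ?T y (?T x t)"])
        (auto intro!: clinearI simp: L pure pt pdl pdr V.act_br W.act_br algebra_simps
          complex_vector.scale_right_diff_distrib)
  qed
qed

section \<open>The twisted Heisenberg-Virasoro algebra\<close>

datatype hv_gen = L int | I int | C_L | C_LI | C_I

type_synonym hv = "hv_gen \<Rightarrow>\<^sub>0 complex"

fun hv_gen_bracket :: "hv_gen \<Rightarrow> hv_gen \<Rightarrow> hv" where
  "hv_gen_bracket (L n) (L m) =
    of_int (n - m) *\<^sub>C fbasis (L (n + m))
    + (if n = - m then (of_int (n ^ 3 - n) / 12) *\<^sub>C fbasis C_L else 0)"
| "hv_gen_bracket (L n) (I m) =
    - (of_int m *\<^sub>C fbasis (I (n + m)))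
    - (if n = - m then of_int (n ^ 2 + n) *\<^sub>C fbasis C_LI else 0)"
| "hv_gen_bracket (I m) (L n) =
    of_int m *\<^sub>C fbasis (I (n + m))
    + (if n = - m then of_int (n ^ 2 + n) *\<^sub>C fbasis C_LI else 0)"
| "hv_gen_bracket (I n) (I m) = (if n = - m then of_int n *\<^sub>C fbasis C_I else 0)"
| "hv_gen_bracket _ _ = 0"

definition hv_bracket :: "hv \<Rightarrow> hv \<Rightarrow> hv"
  where "hv_bracket = bilin_ext hv_gen_bracket"

section \<open>Intermediate series and highest weight modules\<close>

text \<open>The intermediate series module has underlying space \<open>int \<Rightarrow>\<^sub>0 complex\<close>, with \<open>v\<^sub>n = fbasis n\<close>.\<close>

fun intermediate_gen_act ::
    "complex \<Rightarrow> complex \<Rightarrow> complex \<Rightarrow> hv_gen \<Rightarrow> int \<Rightarrow> (int \<Rightarrow>\<^sub>0 complex)" where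
  "intermediate_gen_act \<alpha> \<beta> F (L k) n =
    - ((of_int n + \<alpha> + \<beta> + of_int k * \<beta>) *\<^sub>C fbasis (n + k))"
| "intermediate_gen_act \<alpha> \<beta> F (I k) n = F *\<^sub>C fbasis (n + k)"
| "intermediate_gen_act \<alpha> \<beta> F _ n = 0"

definition intermediate_act ::
    "complex \<Rightarrow> complex \<Rightarrow> complex \<Rightarrow> hv \<Rightarrow> (int \<Rightarrow>\<^sub>0 complex) \<Rightarrow> (int \<Rightarrow>\<^sub>0 complex)"
  where "intermediate_act \<alpha> \<beta> F = bilin_ext (intermediate_gen_act \<alpha> \<beta> F)"

definition highest_weight_vector ::
    "(hv \<Rightarrow> 'v::complex_vector \<Rightarrow> 'v) \<Rightarrow> complex \<Rightarrow> complex \<Rightarrow> 'v \<Rightarrow> bool"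
  where "highest_weight_vector act h h\<^sub>I v \<longleftrightarrow>
    v \<noteq> 0 \<and>
    (\<forall>n>0. act (fbasis (L n)) v = 0 \<and> act (fbasis (I n)) v = 0) \<and>
    act (fbasis (L 0)) v = h *\<^sub>C v \<and> act (fbasis (I 0)) v = h\<^sub>I *\<^sub>C v"

text \<open>\<open>irreducible_highest_weight_module c\<^sub>L c\<^sub>I c\<^sub>L\<^sub>I h h\<^sub>I act\<close>: the module given by \<open>act\<close> is (a model of)
  the irreducible highest weight module, which these data determine up to isomorphism.\<close>

definition irreducible_highest_weight_module ::
    "complex \<Rightarrow> complex \<Rightarrow> complex \<Rightarrow> complex \<Rightarrow> complex \<Rightarrow>
      (hv \<Rightarrow> 'v::complex_vector \<Rightarrow> 'v) \<Rightarrow> bool"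
  where "irreducible_highest_weight_module c\<^sub>L c\<^sub>I c\<^sub>L\<^sub>I h h\<^sub>I act \<longleftrightarrow>
    irreducible_lie_module hv_bracket act \<and>
    (\<forall>v. act (fbasis C_L) v = c\<^sub>L *\<^sub>C v \<and> act (fbasis C_I) v = c\<^sub>I *\<^sub>C v \<and>
         act (fbasis C_LI) v = c\<^sub>L\<^sub>I *\<^sub>C v) \<and>
    (\<exists>v. highest_weight_vector act h h\<^sub>I v \<and>
         (\<forall>N. lie_submodule act N \<and> v \<in> N \<longrightarrow> N = UNIV))"

section \<open>The Lie algebra and module axioms hold\<close>

lemma hv_bracket_fbasis [simp]: "hv_bracket (fbasis a) (fbasis b) = hv_gen_bracket a b"
  by (simp add: hv_bracket_def)

lemma hv_bracket_bilinear: "cbilinear hv_bracket"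
  unfolding hv_bracket_def by (rule cbilinear_bilin_ext)

lemma cbilinear_minus_diff:
  assumes "cbilinear f"
  shows "f (- x) y = - f x y" "f x (- y) = - f x y" "f (x - x') y = f x y - f x' y"
    "f x (y - y') = f x y - f x y'" "f 0 y = 0" "f x 0 = 0"
proof -
  have *: "clinear (f x)" "clinear (\<lambda>x. f x y)" for x y
    using assms by (auto simp: cbilinear_def)
  show "f (- x) y = - f x y" "f x (- y) = - f x y" "f (x - x') y = f x y - f x' y"
    "f x (y - y') = f x y - f x y'" "f 0 y = 0" "f x 0 = 0"
    using clinear_minus[OF *(1)] clinear_minus[OF *(2)] clinear_diff[OF *(1)] clinear_diff[OF *(2)]
      clinear_0[OF *(1)] clinear_0[OF *(2)] by auto
qed

lemma lookup_fbasis: "Poly_Mapping.lookup (fbasis a) b = (if a = b then 1 else 0)"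
  by (simp add: fbasis_def lookup_single when_def)

lemma hv_gen_bracket_antisym: "hv_gen_bracket a b = - hv_gen_bracket b a"
proof (cases a; cases b)
  fix n m assume *: "a = L n" "b = L m"
  show ?thesis unfolding *
    by (rule poly_mapping_eqI)
      (auto simp: lookup_add lookup_minus lookup_scaleC lookup_fbasis scaleC_complex_def field_simps power3_eq_cube)
next
  fix n m assume *: "a = I n" "b = I m"
  then show ?thesis
    by (auto simp flip: complex_vector.scale_minus_left)
qed auto

lemma hv_bracket_antisym: "hv_bracket x y = - hv_bracket y x"
proof -
  note B = cbilinearD[OF hv_bracket_bilinear]
  have l: "clinear (hv_bracket x)" "clinear (\<lambda>y. - hv_bracket y x)"
    "clinear (\<lambda>x. hv_bracket x y)" "clinear (\<lambda>x. - hv_bracket y x)" for x y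
    by (rule clinearI; simp add: B)+
  have 0: "hv_bracket (fbasis a) (fbasis b) = - hv_bracket (fbasis b) (fbasis a)" for a b
    unfolding hv_bracket_fbasis by (rule hv_gen_bracket_antisym)
  have 1: "hv_bracket (fbasis a) y = - hv_bracket y (fbasis a)" for a
    by (rule clinear_eq_on_fbasis[OF l(1,2)]) (rule 0)
  show ?thesis
    by (rule clinear_eq_on_fbasis[OF l(3,4)]) (rule 1)
qed

lemmas hv_bracket_rules = cbilinearD[OF hv_bracket_bilinear] cbilinear_minus_diff[OF hv_bracket_bilinear]

definition hv_jac :: "hv_gen \<Rightarrow> hv_gen \<Rightarrow> hv_gen \<Rightarrow> hv"
  where "hv_jac a b c =
    hv_bracket (fbasis a) (hv_gen_bracket b c) + hv_bracket (fbasis b) (hv_gen_bracket c a)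
    + hv_bracket (fbasis c) (hv_gen_bracket a b)"

lemma scaleC_cancel3:
  assumes "a + b + c = 0"
  shows "a *\<^sub>C x + b *\<^sub>C x + c *\<^sub>C (x :: 'v::complex_vector) = 0"
  unfolding scaleC_add_left[symmetric] assms by simp

definition hv_delta :: "int \<Rightarrow> complex \<Rightarrow> hv_gen \<Rightarrow> hv" where
  "hv_delta n c g = (if n = 0 then c *\<^sub>C fbasis g else 0)"

lemma sum3_regroup: "(a + b) + (c + d) + (e + f) = (a + c + e) + (b + d + (f::'a::ab_group_add))"
  by (simp add: algebra_simps)

lemma hv_jac_LLL: "hv_jac (L l) (L m) (L n) = 0"
proof -
  have 1: "hv_bracket (fbasis (L l)) (hv_gen_bracket (L m) (L n)) =
     of_int ((m - n) * (l - (m + n))) *\<^sub>C fbasis (L (l + m + n)) +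
     hv_delta (l + m + n) (of_int ((m - n) * (l ^ 3 - l)) / 12) C_L" for l m n
    by (simp add: hv_bracket_rules hv_delta_def scaleC_scaleC scaleC_add_right add.assoc eq_neg_iff_add_eq_0)
  have r: "m + n + l = l + m + n" "n + l + m = l + m + n" by auto
  have "hv_delta (l + m + n) (of_int ((m - n) * (l ^ 3 - l)) / 12) C_L +
      hv_delta (l + m + n) (of_int ((n - l) * (m ^ 3 - m)) / 12) C_L +
      hv_delta (l + m + n) (of_int ((l - m) * (n ^ 3 - n)) / 12) C_L = 0"
  proof (cases "l + m + n = 0")
    case True
    then have "n = - l - m" by simp
    then have "(m - n) * (l ^ 3 - l) + (n - l) * (m ^ 3 - m) + (l - m) * (n ^ 3 - n) = 0"
      by algebra
    then have "of_int ((m - n) * (l ^ 3 - l)) / 12 + of_int ((n - l) * (m ^ 3 - m)) / 12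
       + of_int ((l - m) * (n ^ 3 - n)) / (12::complex) = 0"
      by (metis add_divide_distrib div_0 of_int_0 of_int_add)
    then show ?thesis unfolding hv_delta_def True by (simp only: scaleC_cancel3 simp_thms if_True)
  qed (simp add: hv_delta_def)
  moreover have "of_int ((m - n) * (l - (m + n))) + of_int ((n - l) * (m - (n + l))) + of_int ((l - m) * (n - (l + m))) = (0::complex)"
    by (simp add: algebra_simps)
  ultimately show ?thesis
    unfolding hv_jac_def 1 r sum3_regroup by (simp only: scaleC_cancel3 add_0)
qed

lemma hv_jac_LLI: "hv_jac (L l) (L m) (I n) = 0"
proof -
  have 1: "hv_bracket (fbasis (L l)) (hv_gen_bracket (L m) (I n)) =
     of_int (n * (m + n)) *\<^sub>C fbasis (I (l + m + n)) +
     hv_delta (l + m + n) (of_int (n * (l ^ 2 + l))) C_LI" for l m n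
    by (simp add: hv_bracket_rules hv_delta_def scaleC_scaleC scaleC_add_right add.assoc eq_neg_iff_add_eq_0
        complex_vector.scale_right_diff_distrib)
  have 2: "hv_bracket (fbasis (L l)) (hv_gen_bracket (I n) (L m)) =
     of_int (- (n * (m + n))) *\<^sub>C fbasis (I (l + m + n)) +
     hv_delta (l + m + n) (of_int (- (n * (l ^ 2 + l)))) C_LI" for l m n
    by (simp add: hv_bracket_rules hv_delta_def scaleC_scaleC scaleC_add_right add.assoc eq_neg_iff_add_eq_0
        complex_vector.scale_right_diff_distrib)
  have 3: "hv_bracket (fbasis (I n)) (hv_gen_bracket (L l) (L m)) =
     of_int ((l - m) * n) *\<^sub>C fbasis (I (l + m + n)) +
     hv_delta (l + m + n) (of_int ((l - m) * ((l + m)^2 + (l + m)))) C_LI" for l m n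
    by (simp add: hv_bracket_rules hv_delta_def scaleC_scaleC scaleC_add_right add.assoc eq_neg_iff_add_eq_0
        complex_vector.scale_right_diff_distrib)
  have r: "m + l + n = l + m + n" by auto
  have "hv_delta (l + m + n) (of_int (n * (l ^ 2 + l))) C_LI +
      hv_delta (l + m + n) (of_int (- (n * (m ^ 2 + m)))) C_LI +
      hv_delta (l + m + n) (of_int ((l - m) * ((l + m)^2 + (l + m)))) C_LI = 0"
  proof (cases "l + m + n = 0")
    case True
    then have "n = - l - m" by simp
    then have "n * (l ^ 2 + l) + - (n * (m ^ 2 + m)) + (l - m) * ((l + m)^2 + (l + m)) = 0"
      by algebra
    then have "of_int (n * (l ^ 2 + l)) + of_int (- (n * (m ^ 2 + m))) + of_int ((l - m) * ((l + m)^2 + (l + m))) = (0::complex)"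
      by (metis of_int_0 of_int_add)
    then show ?thesis unfolding hv_delta_def True by (simp only: scaleC_cancel3 simp_thms if_True)
  qed (simp add: hv_delta_def)
  moreover have "of_int (n * (m + n)) + of_int (- (n * (l + n))) + of_int ((l - m) * n) = (0::complex)"
    by (simp add: algebra_simps)
  ultimately show ?thesis
    unfolding hv_jac_def 1 2 3 r sum3_regroup by (simp only: scaleC_cancel3 add_0)
qed

lemma hv_jac_LII: "hv_jac (L l) (I m) (I n) = 0"
proof -
  have 1: "hv_bracket (fbasis (L l)) (hv_gen_bracket (I m) (I n)) = 0"
    by (simp add: hv_bracket_rules)
  have 2: "hv_bracket (fbasis (I m)) (hv_gen_bracket (I n) (L l)) =
     hv_delta (l + m + n) (of_int (n * m)) C_I"
    by (auto simp: hv_bracket_rules hv_delta_def scaleC_scaleC eq_neg_iff_add_eq_0 add.commute add.left_commute)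
  have 3: "hv_bracket (fbasis (I n)) (hv_gen_bracket (L l) (I m)) =
     hv_delta (l + m + n) (of_int (- (n * m))) C_I"
    by (auto simp: hv_bracket_rules hv_delta_def scaleC_scaleC eq_neg_iff_add_eq_0 add.commute add.left_commute mult.commute)
  show ?thesis
    unfolding hv_jac_def 1 2 3 by (simp add: hv_delta_def)
qed

lemma hv_jac_rot: "hv_jac a b c = hv_jac b c a"
  by (simp add: hv_jac_def algebra_simps)

lemma hv_jac_III: "hv_jac (I l) (I m) (I n) = 0"
  by (auto simp: hv_jac_def hv_bracket_rules)

lemma hv_jac_central: "c \<in> {C_L, C_LI, C_I} \<Longrightarrow> hv_jac a b c = 0"
  by (cases a; cases b) (auto simp: hv_jac_def hv_bracket_rules)

lemma hv_jac_zero: "hv_jac a b c = 0"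
proof -
  have "hv_jac a b c = 0 \<or> hv_jac b c a = 0 \<or> hv_jac c a b = 0"
    by (cases a; cases b; cases c; simp add: hv_jac_central hv_jac_LLL hv_jac_LLI hv_jac_LII hv_jac_III)
  then show ?thesis
    using hv_jac_rot[of a b c] hv_jac_rot[of b c a] by (elim disjE) simp_all
qed

lemma lie_algebra_hv: "lie_algebra hv_bracket"
proof
  note R = hv_bracket_rules
  show "cbilinear hv_bracket" by (rule hv_bracket_bilinear)
  show "hv_bracket x x = 0" for x
  proof -
    have "2 *\<^sub>C hv_bracket x x = 0"
      using hv_bracket_antisym[of x x] scaleC_add_left[of 1 1 "hv_bracket x x"] by (simp add: scaleC_one add_eq_0_iff)
    then show ?thesis by simp
  qed
  let ?J = "\<lambda>x y z. hv_bracket x (hv_bracket y z) + hv_bracket y (hv_bracket z x) + hv_bracket z (hv_bracket x y)"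
  have l: "clinear (\<lambda>x. ?J x y z)" "clinear (\<lambda>y. ?J x y z)" "clinear (\<lambda>z. ?J x y z)" for x y z
    by (rule clinearI; simp add: R scaleC_add_right algebra_simps)+
  have z: "clinear (\<lambda>z::hv. 0::hv)" by (rule clinearI) auto
  have 1: "?J (fbasis a) (fbasis b) (fbasis c) = 0" for a b c
    using hv_jac_zero[of a b c] by (simp add: hv_jac_def)
  have 2: "?J (fbasis a) (fbasis b) z = 0" for a b z
    by (rule clinear_eq_on_fbasis[OF l(3) z]) (rule 1)
  have 3: "?J (fbasis a) y z = 0" for a y z
    by (rule clinear_eq_on_fbasis[OF l(2) z]) (rule 2)
  show "?J x y z = 0" for x y z
    by (rule clinear_eq_on_fbasis[OF l(1) z]) (rule 3)
qed

lemma intermediate_gen: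
  "intermediate_act \<alpha> \<beta> F (hv_gen_bracket a b) (fbasis n) =
    intermediate_act \<alpha> \<beta> F (fbasis a) (intermediate_act \<alpha> \<beta> F (fbasis b) (fbasis n))
    - intermediate_act \<alpha> \<beta> F (fbasis b) (intermediate_act \<alpha> \<beta> F (fbasis a) (fbasis n))"
proof -
  have B: "cbilinear (intermediate_act \<alpha> \<beta> F)" unfolding intermediate_act_def by (rule cbilinear_bilin_ext)
  note R = cbilinearD[OF B] cbilinear_minus_diff[OF B]
  have [simp]: "intermediate_act \<alpha> \<beta> F (fbasis a) (fbasis n) = intermediate_gen_act \<alpha> \<beta> F a n" for a n
    by (simp add: intermediate_act_def)
  note S = R scaleC_scaleC
  have LL: "?thesis" if "a = L k" "b = L m" for k m
  proof -
    let ?x = "fbasis (n + k + m) :: int \<Rightarrow>\<^sub>0 complex"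
    let ?c = "of_int n + \<alpha> + \<beta> :: complex"
    have 1: "intermediate_act \<alpha> \<beta> F (hv_gen_bracket a b) (fbasis n) =
        - ((of_int (k - m) * (?c + of_int (k + m) * \<beta>)) *\<^sub>C ?x)"
      using that by (simp add: S add.assoc)
    have 2: "intermediate_act \<alpha> \<beta> F (fbasis (L k)) (intermediate_act \<alpha> \<beta> F (fbasis (L m)) (fbasis n)) =
        ((?c + of_int m * \<beta>) * (?c + of_int m + of_int k * \<beta>)) *\<^sub>C fbasis (n + m + k)" for k m
      by (simp add: S add_ac)
    have r: "n + m + k = n + k + m" by simp
    show ?thesis
      unfolding 1 unfolding that 2 r
      by (simp flip: complex_vector.scale_left_diff_distrib complex_vector.scale_minus_left)
        (rule disjI1, simp add: algebra_simps)
  qed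
  have LI: "intermediate_act \<alpha> \<beta> F (- (of_int m *\<^sub>C fbasis (I (k + m)))) (fbasis n) =
    intermediate_act \<alpha> \<beta> F (fbasis (L k)) (intermediate_act \<alpha> \<beta> F (fbasis (I m)) (fbasis n))
    - intermediate_act \<alpha> \<beta> F (fbasis (I m)) (intermediate_act \<alpha> \<beta> F (fbasis (L k)) (fbasis n))" for k m
  proof -
    let ?x = "fbasis (n + k + m) :: int \<Rightarrow>\<^sub>0 complex"
    let ?c = "of_int n + \<alpha> + \<beta> :: complex"
    have 2: "intermediate_act \<alpha> \<beta> F (fbasis (L k)) (intermediate_act \<alpha> \<beta> F (fbasis (I m)) (fbasis n)) =
        - ((F * (?c + of_int m + of_int k * \<beta>)) *\<^sub>C ?x)"
      by (simp add: S add_ac)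
    have 3: "intermediate_act \<alpha> \<beta> F (fbasis (I m)) (intermediate_act \<alpha> \<beta> F (fbasis (L k)) (fbasis n)) =
        - ((F * (?c + of_int k * \<beta>)) *\<^sub>C ?x)"
      by (simp add: S add_ac mult.commute)
    have 1: "intermediate_act \<alpha> \<beta> F (- (of_int m *\<^sub>C fbasis (I (k + m)))) (fbasis n) =
        - ((F * of_int m) *\<^sub>C ?x)"
      by (simp add: S add_ac mult.commute)
    show ?thesis
      unfolding 1 2 3
      by (simp flip: complex_vector.scale_left_diff_distrib complex_vector.scale_minus_left)
        (rule disjI1, simp add: algebra_simps)
  qed
  have LI': "intermediate_act \<alpha> \<beta> F (hv_gen_bracket (L k) (I m)) (fbasis n) =
    intermediate_act \<alpha> \<beta> F (fbasis (L k)) (intermediate_act \<alpha> \<beta> F (fbasis (I m)) (fbasis n))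
    - intermediate_act \<alpha> \<beta> F (fbasis (I m)) (intermediate_act \<alpha> \<beta> F (fbasis (L k)) (fbasis n))" for k m
    unfolding LI[symmetric] by (simp add: S)
  show ?thesis
  proof (cases a; cases b)
    fix k m assume "a = L k" "b = L m"
    then show ?thesis by (rule LL)
  next
    fix k m assume *: "a = L k" "b = I m"
    show ?thesis unfolding * by (rule LI')
  next
    fix k m assume *: "a = I m" "b = L k"
    show ?thesis
      unfolding * hv_gen_bracket_antisym[of "I m" "L k"] R(5) LI' by (rule minus_diff_eq)
  next
    fix k m assume *: "a = I k" "b = I m"
    show ?thesis unfolding * by (simp add: S add_ac)
  qed (simp_all add: S)
qed

lemma lie_module_intermediate: "lie_module hv_bracket (intermediate_act \<alpha> \<beta> F)"
proof -
  interpret lie_algebra hv_bracket by (rule lie_algebra_hv)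
  let ?A = "intermediate_act \<alpha> \<beta> F"
  have B: "cbilinear ?A" unfolding intermediate_act_def by (rule cbilinear_bilin_ext)
  note R = cbilinearD[OF B] cbilinear_minus_diff[OF B] hv_bracket_rules
  let ?J = "\<lambda>x y v. ?A (hv_bracket x y) v - (?A x (?A y v) - ?A y (?A x v))"
  have l: "clinear (\<lambda>x. ?J x y z)" "clinear (\<lambda>y. ?J x y z)" "clinear (\<lambda>z. ?J x y z)" for x y z
    by (rule clinearI; simp add: R scaleC_add_right complex_vector.scale_right_diff_distrib algebra_simps)+
  have z: "clinear (\<lambda>z::hv. 0::int \<Rightarrow>\<^sub>0 complex)" "clinear (\<lambda>z::int \<Rightarrow>\<^sub>0 complex. 0::int \<Rightarrow>\<^sub>0 complex)"
    by (rule clinearI; simp)+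
  have 1: "?J (fbasis a) (fbasis b) (fbasis c) = 0" for a b c
    using intermediate_gen by simp
  have 2: "?J (fbasis a) (fbasis b) z = 0" for a b z
    by (rule clinear_eq_on_fbasis[OF l(3) z(2)]) (rule 1)
  have 3: "?J (fbasis a) y z = 0" for a y z
    by (rule clinear_eq_on_fbasis[OF l(2) z(1)]) (rule 2)
  have 4: "?J x y z = 0" for x y z
    by (rule clinear_eq_on_fbasis[OF l(1) z(1)]) (rule 3)
  show ?thesis
    by unfold_locales (use B 4 in auto)
qed

end

(*
Put q = - F / c, where c = c_LI, and let v be the highest weight vector of L.  Inside L the Schur
polynomials y_k in the operators - I(-j) / c, given by k y_k = - (1/c) sum_j I(-j) y_(k-j) and
y_0 = v, satisfy L(n) y_k = (k - p) y_(k-n).  Hence y_p is singular and vanishes in L.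

Irreducibility.  Every nonzero submodule N of V' (x) L contains v_m (x) v for all large m.  If N contains
v_m (x) v for all m > n, then x_k = v_(n+k) (x) y_k satisfies k x_k = (k - 1 - q) x_(k-1) modulo N;
since x_p = 0, this yields v_n (x) v in N unless q is one of 0, ..., p - 1.

Reducibility for 0 <= q < p.  Let Y be the intermediate series module dual to V'.  There is a linear map
from L to Y with v |-> e_0 that commutes with all negative generators, because any combination of words in
negative generators that annihilates v also annihilates e_0.  This is shown by induction on the number of
letters L(-l): the operators I(k), k > 0, remove such letters with an invertible symbol (their diagonal
entries are k (p + k) c), and for words in the I(-j) alone the Euler field agrees at the point (1 - z)^q
with a combination of the operators L(n), n > 0.  Pairing with V' gives a functional on V' (x) L that
vanishes on the image of the negative generators, so the v_m (x) v with m > 0 generate a proper submodule.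
*)
theory Submission
  imports Defs "HOL-Library.Product_Plus"
begin

text \<open>The exceptional values come from one binomial identity: under I(-j) -> q c the
  generating series of the y_k becomes exp(-q sum_j z^j / j) = (1 - z)^q, so y_p becomes (-1)^p
  binom(q, p), which vanishes for q = 0, ..., p - 1. The recursion of the x_k is the recursion of
  the same coefficients. The obstacle is that a map from L to Y must respect every relation among
  words in L. Relations are never classified; a relation is tested by applying a positive generator,
  which turns it into a relation with fewer letters L(-l) or of smaller degree. Positive generators
  treat e_0 differently from v, for instance I(k) e_0 = q c e_k, so their action is computed
  formally on words, with the eigenvalues of v, and only negative letters are ever evaluated in Y.
  Evaluating at the pair (v, e_0) in L x Y makes each reordering of negative letters valid in both
  modules at once; this takes the place of a normal form for words.\<close>

lemma eigen_components_mem: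
  fixes T :: "'a::complex_vector \<Rightarrow> 'a"
  assumes T: "clinear T" and S: "complex_vector.subspace S" and inv: "\<And>x. x \<in> S \<Longrightarrow> T x \<in> S"
    and "finite A" "\<And>i. i \<in> A \<Longrightarrow> T (f i) = e i *\<^sub>C f i" "inj_on e A" "(\<Sum>i\<in>A. f i) \<in> S" "i \<in> A"
  shows "f i \<in> S"
  using assms(4-)
proof (induction A arbitrary: f i rule: finite_induct)
  case (insert a A)
  \<comment> \<open>\<open>T\<close> minus the scalar \<open>e a\<close> deletes the component at
    \<open>a\<close> and multiplies the others by the nonzero numbers \<open>e i - e a\<close>, so
    the induction hypothesis applies to the rescaled components.\<close>
  let ?g = "\<lambda>i. (e i - e a) *\<^sub>C f i"
  have "T (\<Sum>i\<in>insert a A. f i) - e a *\<^sub>C (\<Sum>i\<in>insert a A. f i) = (\<Sum>i\<in>insert a A. ?g i)"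
    using insert.prems(1)
    by (simp add: clinear_sum[OF T] complex_vector.scale_sum_right
        complex_vector.scale_left_diff_distrib sum_subtractf del: sum.insert)
  also have "\<dots> = (\<Sum>i\<in>A. ?g i)"
    using insert.hyps by simp
  finally have sum_g: "(\<Sum>i\<in>A. ?g i) \<in> S"
    using complex_vector.subspace_diff[OF S inv complex_vector.subspace_scale[OF S]] insert.prems(3)
    by metis
  have mem: "f j \<in> S" if "j \<in> A" for j
  proof -
    have "?g j \<in> S"
      by (rule insert.IH)
        (use insert.prems sum_g that in \<open>auto simp: clinear_scale[OF T] scaleC_scaleC mult.commute
            inj_on_def\<close>)
    moreover have "e j \<noteq> e a"
      using insert.prems(2) insert.hyps that by (auto simp: inj_on_def)
    ultimately have "(1 / (e j - e a)) *\<^sub>C ?g j \<in> S" "(1 / (e j - e a)) *\<^sub>C ?g j = f j"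
      using complex_vector.subspace_scale[OF S] by (blast, simp add: scaleC_scaleC scaleC_one)
    then show ?thesis by simp
  qed
  have "(\<Sum>i\<in>insert a A. f i) - (\<Sum>i\<in>A. f i) \<in> S"
    using mem by (intro complex_vector.subspace_diff[OF S insert.prems(3)] complex_vector.subspace_sum[OF S])
  then have "f a \<in> S"
    using insert.hyps by simp
  then show ?case
    using mem insert.prems(4) by auto
qed simp

section \<open>Direct products, finite supports and submodules generated by negative
  generators\<close>

instantiation prod :: (complex_vector, complex_vector) complex_vector
begin

definition scaleC_prod :: "complex \<Rightarrow> 'a \<times> 'b \<Rightarrow> 'a \<times> 'b"
  where "scaleC_prod c x = (c *\<^sub>C fst x, c *\<^sub>C snd x)"

instance
  by standard (simp_all add: scaleC_prod_def prod_eq_iff scaleC_add_right scaleC_add_left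
      scaleC_scaleC scaleC_one)

end

definition prod_act :: "('g \<Rightarrow> 'v \<Rightarrow> 'v) \<Rightarrow> ('g \<Rightarrow> 'w \<Rightarrow> 'w) \<Rightarrow> 'g \<Rightarrow> 'v \<times> 'w \<Rightarrow> 'v \<times> 'w"
  where "prod_act actV actW x z = (actV x (fst z), actW x (snd z))"

lemma lie_module_prod:
  assumes "lie_module br actV" "lie_module br actW"
  shows "lie_module br (prod_act actV actW)"
proof -
  interpret V: lie_module br actV by fact
  interpret W: lie_module br actW by fact
  show ?thesis
    by unfold_locales
      (auto intro!: cbilinearI simp: prod_act_def scaleC_prod_def prod_eq_iff V.act_br W.act_br
        cbilinearD[OF V.act_bilinear] cbilinearD[OF W.act_bilinear])
qed

lemma keys_scaleC_subset: "Poly_Mapping.keys (c *\<^sub>C p) \<subseteq> Poly_Mapping.keys (p :: 'k \<Rightarrow>\<^sub>0 complex)"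
  by (auto simp: in_keys_iff lookup_scaleC scaleC_complex_def)

lemma keys_fbasis [simp]: "Poly_Mapping.keys (fbasis k) = {k}"
  by (simp add: fbasis_def)

definition supported :: "'k set \<Rightarrow> ('k \<Rightarrow>\<^sub>0 complex) set"
  where "supported K = {f. Poly_Mapping.keys f \<subseteq> K}"

lemma subspace_supported: "complex_vector.subspace (supported K)"
  unfolding complex_vector.subspace_def supported_def
proof (intro conjI ballI allI)
  show "f + g \<in> {f. Poly_Mapping.keys f \<subseteq> K}"
    if "f \<in> {f. Poly_Mapping.keys f \<subseteq> K}" "g \<in> {f. Poly_Mapping.keys f \<subseteq> K}" for f g :: "'a \<Rightarrow>\<^sub>0 complex"
    using that Poly_Mapping.keys_add[of f g] by auto
  show "c *\<^sub>C f \<in> {f. Poly_Mapping.keys f \<subseteq> K}" if "f \<in> {f. Poly_Mapping.keys f \<subseteq> K}"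
    for c and f :: "'a \<Rightarrow>\<^sub>0 complex"
    using that keys_scaleC_subset[of c f] by auto
qed simp

lemma fbasis_supported [simp]: "fbasis k \<in> supported K \<longleftrightarrow> k \<in> K"
  by (simp add: supported_def)

lemma supported_mono: "f \<in> supported K \<Longrightarrow> K \<subseteq> K' \<Longrightarrow> f \<in> supported K'"
  by (auto simp: supported_def)

lemma lin_ext_mem:
  assumes "complex_vector.subspace S" "f \<in> supported K" "\<And>k. k \<in> K \<Longrightarrow> g k \<in> S"
  shows "lin_ext g f \<in> S"
  unfolding lin_ext_def
  by (intro complex_vector.subspace_sum[OF assms(1)] complex_vector.subspace_scale[OF assms(1)] assms(3))
    (use assms(2) in \<open>auto simp: supported_def\<close>)

lemma lin_ext_cong:
  assumes "f \<in> supported K" "\<And>k. k \<in> K \<Longrightarrow> g k = g' k"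
  shows "lin_ext g f = lin_ext g' f"
  unfolding lin_ext_def by (rule sum.cong) (use assms in \<open>auto simp: supported_def\<close>)

lemma lin_ext_clinear:
  assumes "clinear T"
  shows "T (lin_ext g f) = lin_ext (\<lambda>k. T (g k)) f"
  by (simp add: lin_ext_def clinear_sum[OF assms] clinear_scale[OF assms])

lemma lin_ext_fun_diff: "lin_ext (\<lambda>k. f k - g k) p = lin_ext f p - lin_ext g p"
  by (simp add: lin_ext_def complex_vector.scale_right_diff_distrib sum_subtractf)

lemma lin_ext_fun_sum: "lin_ext (\<lambda>k. \<Sum>i\<in>A. f i k) p = (\<Sum>i\<in>A. lin_ext (f i) p)"
  unfolding lin_ext_def complex_vector.scale_sum_right by (rule sum.swap)

lemmas lin_ext_rules = clinear_add[OF clinear_lin_ext] clinear_scale[OF clinear_lin_ext]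
  clinear_0[OF clinear_lin_ext] clinear_minus[OF clinear_lin_ext] clinear_diff[OF clinear_lin_ext]

locale hv_module = lie_module hv_bracket act for act :: "hv \<Rightarrow> 'v::complex_vector \<Rightarrow> 'v"
begin

abbreviation gen :: "hv_gen \<Rightarrow> 'v \<Rightarrow> 'v"
  where "gen g \<equiv> act (fbasis g)"

lemmas act_rules = cbilinearD[OF act_bilinear] cbilinear_minus_diff[OF act_bilinear]

lemma clinear_act: "clinear (act x)"
  using act_bilinear by (simp add: cbilinear_def)

lemma gen_commute: "gen a (gen b x) = gen b (gen a x) + act (hv_gen_bracket a b) x"
  using act_br[of "fbasis a" "fbasis b" x] by simp

lemma act_lin_ext: "act x v = lin_ext (\<lambda>g. gen g v) x"
proof -
  have "act (lin_ext fbasis x) v = lin_ext (\<lambda>g. gen g v) x"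
    using lin_ext_clinear[of "\<lambda>x. act x v"] act_bilinear by (simp add: cbilinear_def)
  then show ?thesis by (simp add: lin_ext_fbasis_self)
qed

lemma lie_submodule_genI:
  assumes "complex_vector.subspace N" "\<And>g w. w \<in> N \<Longrightarrow> gen g w \<in> N"
  shows "lie_submodule act N"
  unfolding lie_submodule_def
proof (intro conjI allI ballI)
  show "act x w \<in> N" if "w \<in> N" for x w
    by (subst act_lin_ext, rule lin_ext_mem[of N x UNIV]) (use assms that in \<open>auto simp: supported_def\<close>)
qed fact

end

fun neg_gen :: "hv_gen \<Rightarrow> bool" where
  "neg_gen (L n) \<longleftrightarrow> n < 0"
| "neg_gen (I n) \<longleftrightarrow> n < 0"
| "neg_gen _ \<longleftrightarrow> False"

inductive_set neg_span :: "(hv \<Rightarrow> 'v \<Rightarrow> 'v) \<Rightarrow> 'v set \<Rightarrow> 'v::complex_vector set"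
  for act Z where
  base: "z \<in> complex_vector.span Z \<Longrightarrow> z \<in> neg_span act Z"
| add: "x \<in> neg_span act Z \<Longrightarrow> y \<in> neg_span act Z \<Longrightarrow> x + y \<in> neg_span act Z"
| scale: "x \<in> neg_span act Z \<Longrightarrow> c *\<^sub>C x \<in> neg_span act Z"
| gen: "x \<in> neg_span act Z \<Longrightarrow> neg_gen g \<Longrightarrow> act (fbasis g) x \<in> neg_span act Z"

lemma subspace_neg_span: "complex_vector.subspace (neg_span act Z)"
  unfolding complex_vector.subspace_def
  using neg_span.base[OF complex_vector.span_zero] neg_span.add neg_span.scale by metis

text \<open>Moving \<open>g\<close> past the outermost negative letter leaves \<open>g\<close> and a
  bracket acting on a shorter expression. The bracket is a combination of arbitrary generators, so
  the induction claim is made for all generators at once.\<close>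

lemma (in hv_module) lie_submodule_neg_span:
  assumes Z: "\<And>g z. z \<in> Z \<Longrightarrow> \<not> neg_gen g \<Longrightarrow> gen g z \<in> complex_vector.span Z"
  shows "lie_submodule act (neg_span act Z)"
proof (rule lie_submodule_genI[OF subspace_neg_span])
  fix g w
  assume "w \<in> neg_span act Z"
  then have "\<forall>g. gen g w \<in> neg_span act Z"
  proof induction
    case (base z)
    show ?case
    proof
      fix g
      show "gen g z \<in> neg_span act Z"
      proof (cases "neg_gen g")
        case True
        then show ?thesis using neg_span.gen[OF neg_span.base[OF base]] by simp
      next
        case False
        from base have "gen g z \<in> complex_vector.span Z"
        proof (induction rule: complex_vector.span_induct_alt)
          case (step c x y)
          then show ?case
            by (simp add: act_rules Z False complex_vector.span_add complex_vector.span_scale)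
        qed (simp add: act_rules complex_vector.span_zero)
        then show ?thesis by (rule neg_span.base)
      qed
    qed
  next
    case (gen x a)
    show ?case
    proof
      fix g
      have "act y x \<in> neg_span act Z" for y
        by (subst act_lin_ext, rule lin_ext_mem[OF subspace_neg_span, of _ UNIV]) (use gen.IH in \<open>auto simp: supported_def\<close>)
      then show "gen g (gen a x) \<in> neg_span act Z"
        using gen.IH gen.hyps by (subst gen_commute[of g a], intro neg_span.add neg_span.gen[of _ _ _ a]) simp_all
    qed
  qed (simp_all add: act_rules neg_span.add neg_span.scale)
  then show "gen g w \<in> neg_span act Z" ..
qed

section \<open>Formal words in the negative generators\<close>

fun is_L :: "hv_gen \<Rightarrow> bool" where
  "is_L (L n) \<longleftrightarrow> True"
| "is_L _ \<longleftrightarrow> False"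

fun gen_degree :: "hv_gen \<Rightarrow> int" where
  "gen_degree (L n) = - n"
| "gen_degree (I n) = - n"
| "gen_degree _ = 0"

abbreviation L_count :: "hv_gen list \<Rightarrow> nat"
  where "L_count w \<equiv> length (filter is_L w)"

abbreviation word_degree :: "hv_gen list \<Rightarrow> int"
  where "word_degree w \<equiv> sum_list (map gen_degree w)"

text \<open>The bound is strict, so that index 0 admits only the zero combination and can start the
  induction on the number of letters \<open>L\<close>.\<close>

definition neg_words :: "nat \<Rightarrow> hv_gen list set"
  where "neg_words s = {w. list_all neg_gen w \<and> L_count w < s}"

definition cons_gen :: "hv_gen \<Rightarrow> (hv_gen list \<Rightarrow>\<^sub>0 complex) \<Rightarrow> (hv_gen list \<Rightarrow>\<^sub>0 complex)"
  where "cons_gen a = lin_ext (\<lambda>w. fbasis (a # w))"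

text \<open>The result of letting the generator \<open>g\<close> act on the vector \<open>a\<^sub>1 \<dots> a\<^sub>r v\<close>, computed formally by commuting \<open>g\<close>
  to the right; \<open>\<chi>\<close> holds the eigenvalues of \<open>v\<close> under the generators that are not negative.\<close>

primrec word_op :: "(hv_gen \<Rightarrow> complex) \<Rightarrow> hv_gen list \<Rightarrow> hv_gen \<Rightarrow> (hv_gen list \<Rightarrow>\<^sub>0 complex)" where
  "word_op \<chi> [] g = (if neg_gen g then fbasis [g] else \<chi> g *\<^sub>C fbasis [])"
| "word_op \<chi> (a # w) g =
    (if neg_gen g then fbasis (g # a # w)
     else cons_gen a (word_op \<chi> w g) + lin_ext (word_op \<chi> w) (hv_gen_bracket g a))"

text \<open>The formal partial derivative with respect to the letter \<open>L (- l)\<close>.\<close>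

primrec remove_L :: "int \<Rightarrow> hv_gen list \<Rightarrow> (hv_gen list \<Rightarrow>\<^sub>0 complex)" where
  "remove_L l [] = 0"
| "remove_L l (a # w) = (if a = L (- l) then fbasis w else 0) + cons_gen a (remove_L l w)"

lemma clinear_cons_gen: "clinear (cons_gen a)"
  unfolding cons_gen_def by (rule clinear_lin_ext)

lemmas cons_gen_rules = clinear_add[OF clinear_cons_gen] clinear_scale[OF clinear_cons_gen]
  clinear_0[OF clinear_cons_gen] clinear_diff[OF clinear_cons_gen]

lemma cons_gen_fbasis [simp]: "cons_gen a (fbasis w) = fbasis (a # w)"
  by (simp add: cons_gen_def)

lemma cons_gen_supported:
  assumes "f \<in> supported K" "\<And>w. w \<in> K \<Longrightarrow> a # w \<in> K'"
  shows "cons_gen a f \<in> supported K'"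
  unfolding cons_gen_def using assms(1) by (rule lin_ext_mem[OF subspace_supported]) (simp add: assms(2))

lemma neg_words_mono: "s \<le> t \<Longrightarrow> neg_words s \<subseteq> neg_words t"
  by (auto simp: neg_words_def)

lemma neg_words_0 [simp]: "neg_words 0 = {}"
  by (simp add: neg_words_def)

lemma supported_empty [simp]: "f \<in> supported {} \<longleftrightarrow> f = 0"
  by (simp add: supported_def)

lemma remove_L_supported: "list_all neg_gen w \<Longrightarrow> remove_L l w \<in> supported (neg_words (L_count w))"
proof (induction w)
  case Nil
  then show ?case by (simp add: complex_vector.subspace_0[OF subspace_supported])
next
  case (Cons a w)
  have "cons_gen a (remove_L l w) \<in> supported (neg_words (L_count (a # w)))"
    by (rule cons_gen_supported[OF Cons.IH]) (use Cons.prems in \<open>auto simp: neg_words_def\<close>)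
  then show ?case
    using Cons.prems by (auto simp: neg_words_def intro!: complex_vector.subspace_add[OF subspace_supported])
qed

lemma remove_L_eq_0: "L (- l) \<notin> set w \<Longrightarrow> remove_L l w = 0"
  by (induction w) (auto simp: cons_gen_rules)

lemma neg_genE:
  assumes "neg_gen a"
  obtains m where "a = L (- m)" "m > 0" | m where "a = I (- m)" "m > 0"
proof (cases a)
  case (L n)
  then show ?thesis using assms that(1)[of "- n"] by simp
next
  case (I n)
  then show ?thesis using assms that(2)[of "- n"] by simp
qed (use assms in auto)

locale hv_vacuum =
  fixes \<chi> :: "hv_gen \<Rightarrow> complex" and c :: complex and p :: int
  assumes \<chi>_pos: "n > 0 \<Longrightarrow> \<chi> (L n) = 0" "n > 0 \<Longrightarrow> \<chi> (I n) = 0"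
    and \<chi>_central: "\<chi> C_I = 0" "\<chi> C_LI = c"
    and \<chi>_I0: "\<chi> (I 0) = of_int (p + 1) * c"
    and p_pos: "p > 0" and c_nz: "c \<noteq> 0"
begin

abbreviation wop :: "hv_gen list \<Rightarrow> hv_gen \<Rightarrow> (hv_gen list \<Rightarrow>\<^sub>0 complex)"
  where "wop \<equiv> word_op \<chi>"

lemma bracket_central: "hv_gen_bracket C_L a = 0" "hv_gen_bracket C_LI a = 0" "hv_gen_bracket C_I a = 0"
  by (cases a; simp)+

lemma wop_central:
  "wop w C_I = 0" "wop w C_LI = c *\<^sub>C fbasis w" "wop w C_L = \<chi> C_L *\<^sub>C fbasis w"
  by (induction w) (auto simp: \<chi>_central bracket_central lin_ext_rules cons_gen_rules)

lemma wop_I0: "wop w (I 0) = \<chi> (I 0) *\<^sub>C fbasis w"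
proof (induction w)
  case (Cons a w)
  have "lin_ext (wop w) (hv_gen_bracket (I 0) a) = 0"
    by (cases a) (auto simp: lin_ext_rules wop_central)
  then show ?case using Cons by (simp add: cons_gen_rules)
qed simp

lemma wop_neg: "neg_gen g \<Longrightarrow> wop w g = fbasis (g # w)"
  by (cases w) auto

lemma wop_supported_neg: "list_all neg_gen w \<Longrightarrow> wop w g \<in> supported {w. list_all neg_gen w}"
proof (induction w arbitrary: g)
  case Nil
  then show ?case by (auto intro: complex_vector.subspace_scale[OF subspace_supported])
next
  case (Cons a w)
  have "lin_ext (wop w) x \<in> supported {w. list_all neg_gen w}" for x
    by (rule lin_ext_mem[OF subspace_supported, of _ UNIV]) (use Cons in \<open>auto simp: supported_def\<close>)
  moreover have "cons_gen a (wop w g) \<in> supported {w. list_all neg_gen w}"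
    by (rule cons_gen_supported[OF Cons.IH]) (use Cons.prems in auto)
  ultimately show ?case
    using Cons.prems by (auto intro: complex_vector.subspace_add[OF subspace_supported])
qed

text \<open>For k = m the bracket contributes m (p + 1) c through I(0) and (m^2 - m) c through the
  central term. Their sum m (p + m) c is nonzero for all m > 0, which is what makes the symbol of
  I(k) invertible.\<close>

lemma wop_I_L:
  assumes "k > 0" "m > 0"
  shows "wop (L (- m) # w) (I k) = cons_gen (L (- m)) (wop w (I k)) +
    (if k = m then (of_int (m * (p + m)) * c) *\<^sub>C fbasis w else of_int k *\<^sub>C wop w (I (k - m)))"
proof -
  have "of_int m * (of_int (p + 1) * c) + of_int (m ^ 2 - m) * c = of_int (m * (p + m)) * c"
    by (simp add: algebra_simps power2_eq_square)
  then show ?thesis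
    using assms by (auto simp: lin_ext_rules wop_central wop_I0 \<chi>_I0 scaleC_scaleC
        simp flip: scaleC_add_left)
qed

lemma wop_I_I:
  assumes "k > 0" "m > 0"
  shows "wop (I (- m) # w) (I k) = cons_gen (I (- m)) (wop w (I k))"
  using assms by (simp add: lin_ext_rules wop_central)

text \<open>I(k) commutes with the letters I(-m), as C_I acts by 0, and kills the vacuum; every
  surviving term has therefore consumed a letter \<open>L\<close>. Since the bound in
  \<open>neg_words\<close> is strict, words without \<open>L\<close> are sent to 0.\<close>

lemma wop_I_supported:
  "list_all neg_gen w \<Longrightarrow> k > 0 \<Longrightarrow> wop w (I k) \<in> supported (neg_words (L_count w))"
proof (induction w arbitrary: k)
  case Nil
  then show ?case by (simp add: \<chi>_pos)
next
  case (Cons a w)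
  then have w: "list_all neg_gen w" "neg_gen a" by auto
  note add = complex_vector.subspace_add[OF subspace_supported]
    and scale = complex_vector.subspace_scale[OF subspace_supported]
  have cons: "cons_gen a (wop w (I k)) \<in> supported (neg_words (L_count (a # w)))"
    by (rule cons_gen_supported[OF Cons.IH]) (use Cons.prems in \<open>auto simp: neg_words_def\<close>)
  from w(2) show ?case
  proof (cases rule: neg_genE)
    case (1 m)
    have "fbasis w \<in> supported (neg_words (L_count (a # w)))"
      using w 1 by (simp add: neg_words_def)
    moreover have "wop w (I (k - m)) \<in> supported (neg_words (L_count (a # w)))" if "k \<noteq> m"
    proof (cases "k > m")
      case True
      then show ?thesis
        using Cons.IH[OF w(1), of "k - m"] 1 neg_words_mono[of "L_count w" "L_count (a # w)"]
        by (auto intro: supported_mono)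
    next
      case False
      then show ?thesis
        using w(1) that 1 by (simp add: wop_neg neg_words_def)
    qed
    ultimately show ?thesis
      using cons Cons.prems 1 by (auto simp only: wop_I_L intro!: add scale split: if_split)
  next
    case (2 m)
    then show ?thesis
      using cons Cons.prems by (simp only: wop_I_I)
  qed
qed

end

section \<open>Evaluation of words and the filtration by the number of letters
  \<open>L\<close>\<close>

context hv_module
begin

definition word_eval :: "'v \<Rightarrow> (hv_gen list \<Rightarrow>\<^sub>0 complex) \<Rightarrow> 'v"
  where "word_eval z = lin_ext (\<lambda>w. foldr gen w z)"

lemma clinear_eval: "clinear (word_eval z)"
  unfolding word_eval_def by (rule clinear_lin_ext)

lemmas word_eval_rules = clinear_add[OF clinear_eval] clinear_scale[OF clinear_eval]
  clinear_0[OF clinear_eval] clinear_diff[OF clinear_eval]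

lemma word_eval_fbasis [simp]: "word_eval z (fbasis w) = foldr gen w z"
  by (simp add: word_eval_def)

lemma word_eval_cons_gen [simp]: "word_eval z (cons_gen a f) = gen a (word_eval z f)"
  unfolding cons_gen_def
  by (subst lin_ext_clinear[OF clinear_eval]) (simp add: word_eval_def lin_ext_clinear[OF clinear_act])

lemma word_eval_word_op:
  assumes "\<And>g. \<not> neg_gen g \<Longrightarrow> gen g z = \<chi> g *\<^sub>C z"
  shows "word_eval z (word_op \<chi> w g) = gen g (foldr gen w z)"
proof (induction w arbitrary: g)
  case Nil
  then show ?case by (simp add: word_eval_rules assms)
next
  case (Cons a w)
  show ?case
    using Cons gen_commute[of g a "foldr gen w z"]
    by (simp add: word_eval_rules lin_ext_clinear[OF clinear_eval] act_lin_ext[symmetric])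
qed

text \<open>The filtration is one of vectors rather than of words: a vector belongs as soon as some
  combination with few letters \<open>L\<close> evaluates to it, so reordering needs no normal
  form.\<close>

definition word_eval_space :: "'v \<Rightarrow> nat \<Rightarrow> 'v set"
  where "word_eval_space z s = word_eval z ` supported (neg_words s)"

lemma subspace_eval_space: "complex_vector.subspace (word_eval_space z s)"
  unfolding word_eval_space_def
  using module_hom.subspace_image[OF _ subspace_supported] clinear_eval
    Vector_Spaces.linear_iff_module_hom by blast

lemmas word_eval_space_add = complex_vector.subspace_add[OF subspace_eval_space]
  and word_eval_space_diff = complex_vector.subspace_diff[OF subspace_eval_space]
  and word_eval_space_scale = complex_vector.subspace_scale[OF subspace_eval_space]
  and word_eval_space_neg = complex_vector.subspace_neg[OF subspace_eval_space]
  and word_eval_space_sum = complex_vector.subspace_sum[OF subspace_eval_space]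
  and word_eval_space_zero = complex_vector.subspace_0[OF subspace_eval_space]

lemma word_eval_spaceI: "f \<in> supported (neg_words s) \<Longrightarrow> word_eval z f \<in> word_eval_space z s"
  by (simp add: word_eval_space_def)

lemma word_eval_space_mono: "x \<in> word_eval_space z s \<Longrightarrow> s \<le> t \<Longrightarrow> x \<in> word_eval_space z t"
  unfolding word_eval_space_def using neg_words_mono supported_mono by blast

lemma word_eval_space_0 [simp]: "x \<in> word_eval_space z 0 \<longleftrightarrow> x = 0"
  by (auto simp: word_eval_space_def word_eval_rules image_iff)

lemma word_eval_space_gen:
  assumes "neg_gen a" "x \<in> word_eval_space z s"
  shows "gen a x \<in> word_eval_space z (if is_L a then Suc s else s)"
proof -
  obtain f where f: "f \<in> supported (neg_words s)" "x = word_eval z f"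
    using assms by (auto simp: word_eval_space_def)
  have "cons_gen a f \<in> supported (neg_words (if is_L a then Suc s else s))"
    by (rule cons_gen_supported[OF f(1)]) (use assms in \<open>auto simp: neg_words_def\<close>)
  from word_eval_spaceI[OF this, of z] f show ?thesis by simp
qed

lemma word_eval_space_L: "m > 0 \<Longrightarrow> x \<in> word_eval_space z s \<Longrightarrow> gen (L (- m)) x \<in> word_eval_space z (Suc s)"
  using word_eval_space_gen[of "L (- m)"] by simp

lemma word_eval_space_I: "m > 0 \<Longrightarrow> x \<in> word_eval_space z s \<Longrightarrow> gen (I (- m)) x \<in> word_eval_space z s"
  using word_eval_space_gen[of "I (- m)"] by simp

lemma gen_neg_commute:
  assumes "l > 0" "m > 0"
  shows "gen (L (- l)) (gen (L (- m)) x) = gen (L (- m)) (gen (L (- l)) x) + of_int (m - l) *\<^sub>C gen (L (- (l + m))) x"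
    and "gen (L (- l)) (gen (I (- m)) x) = gen (I (- m)) (gen (L (- l)) x) + of_int m *\<^sub>C gen (I (- (l + m))) x"
    and "gen (I (- l)) (gen (I (- m)) x) = gen (I (- m)) (gen (I (- l)) x)"
  using assms gen_commute[of "L (- l)" "L (- m)" x] gen_commute[of "L (- l)" "I (- m)" x]
    gen_commute[of "I (- l)" "I (- m)" x]
  by (simp_all add: act_rules)

end

context hv_module
begin

text \<open>Euler's identity for \<open>remove_L\<close>: moving a letter to the front costs only words with fewer letters \<open>L\<close>.\<close>

lemma euler_identity:
  assumes "list_all neg_gen w" "\<And>l. L (- l) \<in> set w \<Longrightarrow> l \<le> M"
  shows "of_nat (L_count w) *\<^sub>C foldr gen w z
    - (\<Sum>l\<in>{1..M}. gen (L (- l)) (word_eval z (remove_L l w))) \<in> word_eval_space z (L_count w)"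
    (is "?E w \<in> _")
  using assms
proof (induction w)
  case Nil
  then show ?case by (simp add: word_eval_rules act_rules)
next
  case (Cons a w)
  let ?W = "foldr gen w z" and ?Y = "\<lambda>l. word_eval z (remove_L l w)"
  have w: "list_all neg_gen w" and IH: "?E w \<in> word_eval_space z (L_count w)"
    using Cons by auto
  have Y: "?Y l \<in> word_eval_space z (L_count w)" for l
    by (rule word_eval_spaceI[OF remove_L_supported[OF w]])
  from Cons.prems(1) have "neg_gen a" by simp
  then show ?case
  proof (cases rule: neg_genE)
    case (1 m)
    have m: "m \<in> {1..M}" using Cons.prems(2)[of m] 1 by simp
    have rem: "word_eval z (remove_L l (a # w)) = (if l = m then ?W else 0) + gen a (?Y l)" for l
      using 1 by (auto simp: word_eval_rules)
    have comm: "gen (L (- l)) (gen a y) = gen a (gen (L (- l)) y) + of_int (m - l) *\<^sub>C gen (L (- (l + m))) y"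
      if "l > 0" for l y
      using gen_neg_commute(1)[OF that 1(2)] 1 by simp
    have "(\<Sum>l\<in>{1..M}. gen (L (- l)) (word_eval z (remove_L l (a # w)))) =
        (\<Sum>l\<in>{1..M}. (if l = m then gen a ?W else 0) + gen a (gen (L (- l)) (?Y l))
          + of_int (m - l) *\<^sub>C gen (L (- (l + m))) (?Y l))"
      by (intro sum.cong refl) (simp add: rem comm act_rules del: remove_L.simps, simp add: 1)
    also have "\<dots> = gen a ?W + gen a (\<Sum>l\<in>{1..M}. gen (L (- l)) (?Y l))
        + (\<Sum>l\<in>{1..M}. of_int (m - l) *\<^sub>C gen (L (- (l + m))) (?Y l))"
      using m by (simp add: sum.distrib clinear_sum[OF clinear_act])
    \<comment> \<open>The summand l = m supplies the additional copy of the word. What remains are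
      brackets of L(-l) with L(-m), which merge two letters \<open>L\<close> into one.\<close>
    finally have "?E (a # w) =
        gen a (?E w) - (\<Sum>l\<in>{1..M}. of_int (m - l) *\<^sub>C gen (L (- (l + m))) (?Y l))"
      using 1 by (simp add: act_rules scaleC_add_left scaleC_one)
    also have "\<dots> \<in> word_eval_space z (L_count (a # w))"
    proof (intro word_eval_space_diff word_eval_space_sum word_eval_space_scale)
      show "gen a (?E w) \<in> word_eval_space z (L_count (a # w))"
        using word_eval_space_L[OF 1(2) IH] 1 by simp
      show "gen (L (- (l + m))) (?Y l) \<in> word_eval_space z (L_count (a # w))" if "l \<in> {1..M}" for l
        using word_eval_space_L[OF _ Y, of "l + m" l] 1 that by simp
    qed
    finally show ?thesis .
  next
    case (2 m)
    have rem: "word_eval z (remove_L l (a # w)) = gen a (?Y l)" for l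
      using 2 by (auto simp: word_eval_rules)
    have comm: "gen (L (- l)) (gen a y) = gen a (gen (L (- l)) y) + of_int m *\<^sub>C gen (I (- (l + m))) y"
      if "l > 0" for l y
      using gen_neg_commute(2)[OF that 2(2)] 2 by simp
    have "(\<Sum>l\<in>{1..M}. gen (L (- l)) (word_eval z (remove_L l (a # w)))) =
        (\<Sum>l\<in>{1..M}. gen a (gen (L (- l)) (?Y l)) + of_int m *\<^sub>C gen (I (- (l + m))) (?Y l))"
      by (intro sum.cong refl) (simp add: rem comm del: remove_L.simps)
    then have "?E (a # w) =
        gen a (?E w) - (\<Sum>l\<in>{1..M}. of_int m *\<^sub>C gen (I (- (l + m))) (?Y l))"
      using 2 by (simp add: sum.distrib clinear_sum[OF clinear_act] act_rules)
    also have "\<dots> \<in> word_eval_space z (L_count (a # w))"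
    proof (intro word_eval_space_diff word_eval_space_sum word_eval_space_scale)
      show "gen a (?E w) \<in> word_eval_space z (L_count (a # w))"
        using word_eval_space_I[OF 2(2) IH] 2 by simp
      show "gen (I (- (l + m))) (?Y l) \<in> word_eval_space z (L_count (a # w))" if "l \<in> {1..M}" for l
        using word_eval_space_I[OF _ Y, of "l + m" l] 2 that by simp
    qed
    finally show ?thesis .
  qed
qed

end

locale hv_words = hv_module act + hv_vacuum \<chi> c p
  for act :: "hv \<Rightarrow> 'v::complex_vector \<Rightarrow> 'v" and \<chi> c p
begin

text \<open>The leading part of \<open>I k\<close> is a triangular combination of the derivatives \<open>remove_L\<close>; its diagonal
  entry \<open>k * (p + k) * c\<close> is nonzero because \<open>p > 0\<close>.\<close>

lemma I_symbol:
  assumes "list_all neg_gen w" "\<And>l. L (- l) \<in> set w \<Longrightarrow> l \<le> M" and k: "k > 0"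
  shows "word_eval z (wop w (I k)) - ((of_int (k * (p + k)) * c) *\<^sub>C word_eval z (remove_L k w)
    + (\<Sum>l\<in>{k+1..M}. of_int k *\<^sub>C gen (I (k - l)) (word_eval z (remove_L l w)))) \<in> word_eval_space z (L_count w - 1)"
    (is "?E w \<in> _")
  using assms(1,2)
proof (induction w)
  case Nil
  then show ?case using k by (simp add: word_eval_rules act_rules \<chi>_pos)
next
  case (Cons a w)
  let ?W = "foldr gen w z" and ?Y = "\<lambda>l. word_eval z (remove_L l w)"
  let ?\<kappa> = "of_int (k * (p + k)) * c"
  have w: "list_all neg_gen w" and IH: "?E w \<in> word_eval_space z (L_count w - 1)"
    using Cons by auto
  have Y: "?Y l \<in> word_eval_space z (L_count w)" for l
    by (rule word_eval_spaceI[OF remove_L_supported[OF w]])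
  from Cons.prems(1) have "neg_gen a" by simp
  then show ?case
  proof (cases rule: neg_genE)
    case (1 m)
    have m: "m \<in> {1..M}" using Cons.prems(2)[of m] 1 by simp
    have comm: "gen (I (k - l)) (gen a y) = gen a (gen (I (k - l)) y)
        - of_int (l - k) *\<^sub>C gen (I (k - l - m)) y" if "l > k" for l y
      using gen_neg_commute(2)[of m "l - k" y] that 1 by (simp add: diff_diff_eq add.commute)
    have rem: "word_eval z (remove_L l (a # w)) = (if l = m then ?W else 0) + gen a (?Y l)" for l
      using 1 by (auto simp: word_eval_rules)
    \<comment> \<open>A letter L(-m) with m < k leaves the positive operator I(k - m), which
      consumes a second letter \<open>L\<close>. The term is of lower order and does not enter the
      symbol.\<close>
    let ?D = "if m < k then of_int k *\<^sub>C word_eval z (wop w (I (k - m))) else 0"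
    have D: "?D \<in> word_eval_space z (L_count w)"
      using wop_I_supported[OF w, of "k - m"] by (auto intro!: word_eval_space_scale word_eval_spaceI word_eval_space_zero)
    have "(\<Sum>l\<in>{k+1..M}. of_int k *\<^sub>C gen (I (k - l)) (word_eval z (remove_L l (a # w)))) =
        (\<Sum>l\<in>{k+1..M}. (if l = m then of_int k *\<^sub>C gen (I (k - m)) ?W else 0)
          + gen a (of_int k *\<^sub>C gen (I (k - l)) (?Y l))
          - of_int k *\<^sub>C of_int (l - k) *\<^sub>C gen (I (k - l - m)) (?Y l))"
      by (intro sum.cong refl)
        (simp add: rem comm act_rules complex_vector.scale_right_diff_distrib scaleC_add_right del: remove_L.simps)
    also have "\<dots> = (if k < m then of_int k *\<^sub>C gen (I (k - m)) ?W else 0)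
          + gen a (\<Sum>l\<in>{k+1..M}. of_int k *\<^sub>C gen (I (k - l)) (?Y l))
          - (\<Sum>l\<in>{k+1..M}. of_int k *\<^sub>C of_int (l - k) *\<^sub>C gen (I (k - l - m)) (?Y l))"
      using m by (auto simp: sum.distrib sum_subtractf clinear_sum[OF clinear_act])
    finally have sum_eq: "(\<Sum>l\<in>{k+1..M}. of_int k *\<^sub>C gen (I (k - l)) (word_eval z (remove_L l (a # w)))) = \<dots>" .
    have op_eq: "word_eval z (wop (a # w) (I k)) = gen a (word_eval z (wop w (I k))) +
        (if k = m then ?\<kappa> *\<^sub>C ?W else if k < m then of_int k *\<^sub>C gen (I (k - m)) ?W else ?D)"
      unfolding 1(1) wop_I_L[OF k 1(2)] using k by (auto simp: word_eval_rules wop_neg)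
    have "?E (a # w) = gen a (?E w) + ?D
        + (\<Sum>l\<in>{k+1..M}. of_int k *\<^sub>C of_int (l - k) *\<^sub>C gen (I (k - l - m)) (?Y l))"
      unfolding sum_eq op_eq rem[of k] using k by (auto simp: act_rules scaleC_add_right)
    also have "\<dots> \<in> word_eval_space z (L_count w)"
    proof (intro word_eval_space_add D word_eval_space_sum word_eval_space_scale)
      show "gen a (?E w) \<in> word_eval_space z (L_count w)"
      \<comment> \<open>Subtraction is truncated: without letters \<open>L\<close> the induction
        hypothesis concerns index 0, whose space is zero; otherwise prefixing L(-m) raises the index
        from \<open>L_count w - 1\<close> to \<open>L_count w\<close>.\<close>
      proof (cases "L_count w")
        case 0
        then have "?E w = 0" using IH by simp
        then show ?thesis using 0 by (simp add: act_rules)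
      next
        case (Suc n)
        then show ?thesis using word_eval_space_L[OF 1(2) IH] 1 by simp
      qed
      show "gen (I (k - l - m)) (?Y l) \<in> word_eval_space z (L_count w)" if "l \<in> {k+1..M}" for l
        using word_eval_space_I[OF _ Y, of "l + m - k" l] that 1 by (simp add: algebra_simps)
    qed
    finally show ?thesis using 1 by simp
  next
    case (2 m)
    have rem: "word_eval z (remove_L l (a # w)) = gen a (?Y l)" for l
      using 2 by (auto simp: word_eval_rules)
    have comm: "gen (I (k - l)) (gen a y) = gen a (gen (I (k - l)) y)" if "l > k" for l y
      using gen_neg_commute(3)[of m "l - k" y] that 2 by simp
    have "(\<Sum>l\<in>{k+1..M}. of_int k *\<^sub>C gen (I (k - l)) (word_eval z (remove_L l (a # w)))) =
        gen a (\<Sum>l\<in>{k+1..M}. of_int k *\<^sub>C gen (I (k - l)) (?Y l))"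
      unfolding clinear_sum[OF clinear_act] by (intro sum.cong refl) (simp add: rem comm act_rules del: remove_L.simps)
    moreover have "word_eval z (wop (a # w) (I k)) = gen a (word_eval z (wop w (I k)))"
      unfolding 2(1) wop_I_I[OF k 2(2)] by simp
    ultimately have "?E (a # w) = gen a (?E w)"
      by (simp add: act_rules rem del: remove_L.simps word_op.simps)
    also have "\<dots> \<in> word_eval_space z (L_count w - 1)"
      using word_eval_space_I[OF 2(2) IH] 2 by simp
    finally show ?thesis using 2 by simp
  qed
qed

end

section \<open>The kernel of the word_evaluation map\<close>

text \<open>The weights of the combination of the \<open>L n\<close> that agrees with the Euler field at the point \<open>(1 - z)^q\<close>
  (see \<open>I_char_zero\<close>). With \<open>t\<close> as below they solve \<open>(p - j) t j = (p - q - j) t (j - 1)\<close>; at \<open>j = p\<close> this is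
  consistent only because \<open>t (p - 1) = 0\<close> unless \<open>q = 0\<close>, and there \<open>x / 0 = 0\<close> makes \<open>t p = 0\<close>.\<close>

lemma telescoping_weights:
  fixes p q :: int
  assumes "0 \<le> q" "q < p"
  obtains d :: "int \<Rightarrow> complex" where
    "\<And>j. 1 \<le> j \<Longrightarrow> j \<le> p \<Longrightarrow> of_int q * (\<Sum>n\<in>{1..<j}. d n) + of_int (p - j) * d j = of_int q"
    "of_int q * (\<Sum>n\<in>{1..p}. d n) = of_int q"
proof
  define t :: "int \<Rightarrow> complex" where "t n = (\<Prod>i\<in>{1..n}. of_int (p - q - i) / of_int (p - i))" for n
  define d where "d n = t (n - 1) - t n" for n
  have t_step: "t (n + 1) = t n * (of_int (p - q - (n + 1)) / of_int (p - (n + 1)))" if "n \<ge> 0" for n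
  proof -
    have "{1..n + 1} = insert (n + 1) {1..n}" using that by auto
    then show ?thesis by (simp add: t_def mult.commute)
  qed
  have t_zero: "t n = 0" if "q > 0" "p - q \<le> n" for n
    unfolding t_def by (rule prod_zero) (use that assms in \<open>auto intro!: bexI[of _ "p - q"]\<close>)
  have sum: "(\<Sum>n\<in>{1..j}. d n) = 1 - t j" if "j \<ge> 0" for j
    using that
  proof (induction rule: int_ge_induct)
    case base
    show ?case by (simp add: t_def)
  next
    case (step j)
    have "{1..j + 1} = insert (j + 1) {1..j}" using step by auto
    then show ?case using step by (simp add: d_def)
  qed
  show "of_int q * (\<Sum>n\<in>{1..<j}. d n) + of_int (p - j) * d j = of_int q" if "1 \<le> j" "j \<le> p" for j
  proof -
    have "{1..<j} = {1..j - 1}" by auto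
    then have s: "(\<Sum>n\<in>{1..<j}. d n) = 1 - t (j - 1)" using sum[of "j - 1"] that by simp
    have "of_int (p - j) * t j = of_int (p - q - j) * t (j - 1)"
    proof (cases "j = p")
      case True
      then show ?thesis using t_zero[of "p - 1"] assms by (cases "q = 0") auto
    next
      case False
      then have "of_int (p - j) \<noteq> (0 :: complex)" by (metis eq_iff_diff_eq_0 of_int_0_eq_iff)
      then show ?thesis using t_step[of "j - 1"] that by simp
    qed
    then show ?thesis unfolding s by (simp add: d_def algebra_simps)
  qed
  show "of_int q * (\<Sum>n\<in>{1..p}. d n) = of_int q"
    using sum[of p] t_zero[of p] assms by (cases "q = 0") auto
qed

definition I_words :: "int \<Rightarrow> hv_gen list set"
  where "I_words k = {w. list_all neg_gen w \<and> L_count w = 0 \<and> word_degree w = k}"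

lemma word_degree_nonneg: "list_all neg_gen w \<Longrightarrow> word_degree w \<ge> 0"
proof (induction w)
  case (Cons a w)
  then show ?case by (cases a) auto
qed simp

lemma I_words_neg: "k < 0 \<Longrightarrow> I_words k = {}"
  using word_degree_nonneg by (force simp: I_words_def)

lemma I_words_0: "I_words 0 = {[]}"
proof -
  have "w = []" if "w \<in> I_words 0" for w
  proof (cases w)
    case (Cons a u)
    then have "neg_gen a" "list_all neg_gen u" using that by (auto simp: I_words_def)
    then show ?thesis
      using that Cons word_degree_nonneg[of u] by (auto simp: I_words_def elim: neg_genE)
  qed
  then show ?thesis by (auto simp: I_words_def)
qed

context hv_vacuum
begin

lemma wop_I_zero: "list_all neg_gen w \<Longrightarrow> L_count w = 0 \<Longrightarrow> k > 0 \<Longrightarrow> wop w (I k) = 0"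
  using wop_I_supported[of w k] by simp

text \<open>For n > m the bracket leaves a positive I(n - m), which is 0 on words without
  \<open>L\<close>. For n = m the terms m (p + 1) c and (m^2 + m) c subtract to m (p - m) c, which
  vanishes at m = p, unlike the coefficient in \<open>wop_I_L\<close>; hence the degenerate equation
  j = p in \<open>telescoping_weights\<close>.\<close>

lemma wop_L_I:
  assumes "list_all neg_gen w" "L_count w = 0" "n > 0" "m > 0"
  shows "wop (I (- m) # w) (L n) = cons_gen (I (- m)) (wop w (L n)) +
    (if n = m then (of_int (m * (p - m)) * c) *\<^sub>C fbasis w
     else if n < m then of_int m *\<^sub>C fbasis (I (n - m) # w) else 0)"
proof -
  have "of_int m * (of_int (p + 1) * c) - of_int (m ^ 2 + m) * c = of_int (m * (p - m)) * c"
    by (simp add: algebra_simps power2_eq_square)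
  then show ?thesis
    using assms by (auto simp: lin_ext_rules wop_central wop_I0 \<chi>_I0 scaleC_scaleC wop_I_zero wop_neg
        simp flip: complex_vector.scale_left_diff_distrib)
qed

lemma wop_L_supported: "w \<in> I_words k \<Longrightarrow> n > 0 \<Longrightarrow> wop w (L n) \<in> supported (I_words (k - n))"
proof (induction w arbitrary: k)
  case Nil
  then show ?case by (simp add: \<chi>_pos complex_vector.subspace_0[OF subspace_supported])
next
  case (Cons a w)
  then obtain m where a: "a = I (- m)" "m > 0"
    by (auto simp: I_words_def elim: neg_genE)
  have w: "w \<in> I_words (k - m)" using Cons.prems a by (auto simp: I_words_def)
  note add = complex_vector.subspace_add[OF subspace_supported]
    and scale = complex_vector.subspace_scale[OF subspace_supported]
    and zero = complex_vector.subspace_0[OF subspace_supported]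
  have "cons_gen a (wop w (L n)) \<in> supported (I_words (k - n))"
    by (rule cons_gen_supported[OF Cons.IH[OF w Cons.prems(2)]]) (use a in \<open>auto simp: I_words_def\<close>)
  moreover have "wop (a # w) (L n) = cons_gen a (wop w (L n)) +
      (if n = m then (of_int (m * (p - m)) * c) *\<^sub>C fbasis w
       else if n < m then of_int m *\<^sub>C fbasis (I (n - m) # w) else 0)"
    unfolding a(1) by (rule wop_L_I) (use w a Cons.prems in \<open>auto simp: I_words_def\<close>)
  moreover have "n = m \<Longrightarrow> w \<in> I_words (k - n)" "n < m \<Longrightarrow> I (n - m) # w \<in> I_words (k - n)"
    using w by (auto simp: I_words_def)
  ultimately show ?case
    by (simp only:) (auto intro!: add scale zero)
qed

end

locale hv_cyclic = hv_words act \<chi> c p for act :: "hv \<Rightarrow> 'v::complex_vector \<Rightarrow> 'v" and \<chi> c p +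
  fixes v :: 'v
  assumes vac: "\<not> neg_gen g \<Longrightarrow> gen g v = \<chi> g *\<^sub>C v" and v_nz: "v \<noteq> 0"
    and cyclic: "lie_submodule act N \<Longrightarrow> v \<in> N \<Longrightarrow> N = UNIV"
begin

lemma word_eval_wop: "word_eval v (wop w g) = gen g (foldr gen w v)"
  by (rule word_eval_word_op) (rule vac)

lemma word_eval_lin_ext_wop: "word_eval v (lin_ext (\<lambda>w. wop w g) f) = gen g (word_eval v f)"
  by (simp add: lin_ext_clinear[OF clinear_eval] word_eval_wop)
    (simp add: word_eval_def lin_ext_clinear[OF clinear_act])

lemma bracket_L0: "hv_gen_bracket (L 0) a = of_int (gen_degree a) *\<^sub>C fbasis a"
  by (cases a) auto

lemma gen_L0_word: "gen (L 0) (foldr gen w v) = (\<chi> (L 0) + of_int (word_degree w)) *\<^sub>C foldr gen w v"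
proof (induction w)
  case (Cons a w)
  then show ?case
    by (simp add: gen_commute[of "L 0" a] bracket_L0 act_rules flip: scaleC_add_left)
qed (simp add: vac)

text \<open>The formal counterpart of L(0) minus its eigenvalue on \<open>v\<close>. It preserves
  the kernel of \<open>word_eval v\<close>, so that relations split into homogeneous ones.\<close>

definition degree_op :: "(hv_gen list \<Rightarrow>\<^sub>0 complex) \<Rightarrow> (hv_gen list \<Rightarrow>\<^sub>0 complex)"
  where "degree_op = lin_ext (\<lambda>w. of_int (word_degree w) *\<^sub>C fbasis w)"

lemma word_eval_degree_op: "word_eval v (degree_op f) = gen (L 0) (word_eval v f) - \<chi> (L 0) *\<^sub>C word_eval v f"
proof -
  have "word_eval v (degree_op f) = lin_ext (\<lambda>w. of_int (word_degree w) *\<^sub>C foldr gen w v) f"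
    by (simp add: degree_op_def lin_ext_clinear[OF clinear_eval] word_eval_rules)
  moreover have "gen (L 0) (word_eval v f) - \<chi> (L 0) *\<^sub>C word_eval v f =
      lin_ext (\<lambda>w. gen (L 0) (foldr gen w v) - \<chi> (L 0) *\<^sub>C foldr gen w v) f"
    by (simp add: lin_ext_fun_diff lin_ext_fun_scale word_eval_def lin_ext_clinear[OF clinear_act])
  ultimately show ?thesis
    by (simp add: gen_L0_word scaleC_add_left)
qed

text \<open>The evaluated words are stable under every generator because \<open>word_op\<close>
  expresses its action by negative words again; they include \<open>v\<close>, so cyclicity
  applies.\<close>

lemma word_eval_surj: "\<exists>f\<in>supported {w. list_all neg_gen w}. word_eval v f = x"
proof -
  let ?N = "word_eval v ` supported {w. list_all neg_gen w}"
  have sub: "complex_vector.subspace ?N"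
    using module_hom.subspace_image[OF _ subspace_supported] clinear_eval
      Vector_Spaces.linear_iff_module_hom by blast
  have "gen g y \<in> ?N" if y: "y \<in> ?N" for g y
  proof -
    obtain f where f: "f \<in> supported {w. list_all neg_gen w}" "y = word_eval v f"
      using y by auto
    have "lin_ext (\<lambda>w. wop w g) f \<in> supported {w. list_all neg_gen w}"
      by (rule lin_ext_mem[OF subspace_supported f(1)]) (simp add: wop_supported_neg)
    then show ?thesis
      unfolding f(2) word_eval_lin_ext_wop[symmetric] by (rule imageI)
  qed
  then have "lie_submodule act ?N"
    by (rule lie_submodule_genI[OF sub])
  moreover have "word_eval v (fbasis []) \<in> ?N"
    by (rule imageI) simp
  then have "v \<in> ?N" by simp
  ultimately have "?N = UNIV" by (rule cyclic)
  then have "x \<in> ?N" by simp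
  then show ?thesis by blast
qed

end

locale hv_pairing = hv_cyclic act \<chi> c p v
  for act :: "hv \<Rightarrow> 'v::complex_vector \<Rightarrow> 'v" and \<chi> c p v +
  fixes \<alpha> \<beta> :: complex and q :: int
  assumes q: "0 \<le> q" "q < p"
begin

sublocale Y: hv_module "intermediate_act \<alpha> \<beta> (of_int q * c)"
  by (simp add: hv_module_def lie_module_intermediate)

text \<open>No vacuum vector is required here, and (\<open>v\<close>, \<open>y0\<close>) is not one
  when q > 0. \<open>euler_identity\<close> and \<open>I_symbol\<close> hold for any base vector,
  because \<open>word_op\<close> is formal and only negative letters are evaluated.\<close>

sublocale Z: hv_words "prod_act act (intermediate_act \<alpha> \<beta> (of_int q * c))" \<chi> c p
  using lie_module_prod[OF lie_module_axioms Y.lie_module_axioms] hv_vacuum_axioms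
  by (simp add: hv_words_def hv_module_def)

abbreviation y0 :: "int \<Rightarrow>\<^sub>0 complex"
  where "y0 \<equiv> fbasis 0"

lemma Y_gen_fbasis: "Y.gen g (fbasis n) = intermediate_gen_act \<alpha> \<beta> (of_int q * c) g n"
  by (simp add: intermediate_act_def)

lemma Z_eval: "Z.word_eval (v, y0) f = (word_eval v f, Y.word_eval y0 f)"
proof (rule clinear_eq_on_fbasis[OF Z.clinear_eval])
  show "clinear (\<lambda>f. (word_eval v f, Y.word_eval y0 f))"
    by (rule clinearI) (simp_all add: word_eval_rules Y.word_eval_rules scaleC_prod_def)
  have "foldr Z.gen w (v, y0) = (foldr gen w v, foldr Y.gen w y0)" for w
    by (induction w) (simp_all add: prod_act_def)
  then show "Z.word_eval (v, y0) (fbasis w) = (word_eval v (fbasis w), Y.word_eval y0 (fbasis w))" for w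
    by simp
qed

text \<open>On words without \<open>L\<close> this is the character of the commuting letters I(-j)
  through which they act on \<open>y0\<close>, up to the change of index; see
  \<open>Y_eval_I_words\<close>.\<close>

definition I_char :: "(hv_gen list \<Rightarrow>\<^sub>0 complex) \<Rightarrow> complex"
  where "I_char = lin_ext (\<lambda>w. (of_int q * c) ^ length w)"

lemma clinear_I_char: "clinear I_char"
  unfolding I_char_def by (rule clinear_lin_ext)

lemma I_char_fbasis [simp]: "I_char (fbasis w) = (of_int q * c) ^ length w"
  by (simp add: I_char_def)

lemmas I_char_rules = clinear_add[OF clinear_I_char] clinear_0[OF clinear_I_char]
  clinear_scale[OF clinear_I_char, unfolded scaleC_complex_def]

lemma I_char_cons_gen [simp]: "I_char (cons_gen a f) = of_int q * c * I_char f"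
proof -
  have "I_char (cons_gen a f) = (of_int q * c) *\<^sub>C I_char f"
    unfolding cons_gen_def
    using lin_ext_fun_scale[of "of_int q * c" "\<lambda>w. (of_int q * c) ^ length w" f]
    by (subst lin_ext_clinear[OF clinear_I_char]) (simp add: I_char_def scaleC_complex_def)
  then show ?thesis by (simp add: scaleC_complex_def)
qed

lemma Y_eval_I_words:
  assumes "f \<in> supported (I_words k)"
  shows "Y.word_eval y0 f = I_char f *\<^sub>C fbasis (- k)"
proof -
  have "foldr Y.gen w y0 = ((of_int q * c) ^ length w) *\<^sub>C fbasis (- word_degree w)"
    if "list_all neg_gen w" "L_count w = 0" for w
    using that
  proof (induction w)
    case (Cons a w)
    then obtain m where "a = I (- m)" "m > 0" by (auto elim: neg_genE)
    moreover have "fbasis (- word_degree w - m) = (fbasis (- m - word_degree w) :: int \<Rightarrow>\<^sub>0 complex)"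
      by (rule arg_cong[where f = fbasis]) simp
    ultimately show ?case
      using Cons by (simp add: Y.act_rules Y_gen_fbasis scaleC_scaleC)
  qed (simp add: scaleC_one)
  then have "Y.word_eval y0 f = lin_ext (\<lambda>w. ((of_int q * c) ^ length w) *\<^sub>C fbasis (- k)) f"
    unfolding Y.word_eval_def by (intro lin_ext_cong[OF assms]) (auto simp: I_words_def)
  also have "\<dots> = I_char f *\<^sub>C fbasis (- k)"
    using lin_ext_clinear[of "\<lambda>x. x *\<^sub>C (fbasis (- k) :: int \<Rightarrow>\<^sub>0 complex)"
        "\<lambda>w. (of_int q * c) ^ length w" f]
    by (simp add: I_char_def clinearI scaleC_add_left scaleC_scaleC scaleC_complex_def)
  finally show ?thesis .
qed

text \<open>L(n) with n > 0 sends a relation of degree k to one of degree k - n, where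
  \<open>I_char\<close> vanishes by induction. The combination of the L(n) with weights
  \<open>d\<close>, followed by \<open>I_char\<close>, equals multiplication by the degree followed
  by \<open>I_char\<close>; hence k times \<open>I_char f\<close> is 0. The start k = 0 rests on
  \<open>v\<close> being nonzero.\<close>

lemma I_char_zero:
  assumes "f \<in> supported (I_words (int k))" "word_eval v f = 0"
  shows "I_char f = 0"
  using assms
proof (induction k arbitrary: f rule: less_induct)
  case (less k)
  obtain d :: "int \<Rightarrow> complex" where d:
    "\<And>j. 1 \<le> j \<Longrightarrow> j \<le> p \<Longrightarrow> of_int q * (\<Sum>n\<in>{1..<j}. d n) + of_int (p - j) * d j = of_int q"
    "of_int q * (\<Sum>n\<in>{1..p}. d n) = of_int q"
    using telescoping_weights[OF q] by blast
  show ?case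
  proof (cases "k = 0")
    case True
    then have "f \<in> supported {[]}" using less.prems by (simp add: I_words_0)
    then have "f = lin_ext (\<lambda>w. fbasis []) f"
      by (subst lin_ext_fbasis_self[symmetric], intro lin_ext_cong) auto
    then obtain r where r: "f = r *\<^sub>C fbasis []"
      unfolding lin_ext_def by (metis complex_vector.scale_sum_left)
    then have "r *\<^sub>C v = 0" using less.prems by (simp add: word_eval_rules)
    then have "r = 0" using v_nz by simp
    then show ?thesis using r by (simp add: I_char_rules)
  next
    case False
    \<comment> \<open>Up to the factor j c, this is what a letter I(-j) contributes under the
      weighted sum of the L(n): p - j when n = j, and q from the new letter I(n - j) when n < j. The
      weights make it q for every j; for j > p this is the second property of
      \<open>d\<close>.\<close>
    define dd where "dd j = (\<Sum>n\<in>{1..p}. d n * (if n = j then of_int (p - j) else if n < j then of_int q else 0))" for j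
    have dd: "dd j = of_int q" if "j \<ge> 1" for j
    proof (cases "j \<le> p")
      case True
      have "dd j = (\<Sum>n\<in>{1..<j}. d n * of_int q) + (\<Sum>n\<in>{j}. d n * of_int (p - j))"
      proof -
        have s: "{1..p} = {1..<j} \<union> ({j} \<union> {j+1..p})" using True that by auto
        have "(\<Sum>n\<in>{j+1..p}. d n * (if n = j then of_int (p - j) else if n < j then of_int q else 0)) = 0"
          by (rule sum.neutral) auto
        moreover have "(\<Sum>n\<in>{1..<j}. d n * (if n = j then of_int (p - j) else if n < j then of_int q else 0))
            = (\<Sum>n\<in>{1..<j}. d n * of_int q)"
          by (rule sum.cong) auto
        ultimately show ?thesis
          unfolding dd_def s by (subst sum.union_disjoint; auto)+
      qed
      also have "\<dots> = of_int q * (\<Sum>n\<in>{1..<j}. d n) + of_int (p - j) * d j"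
        by (simp add: sum_distrib_left mult.commute)
      also have "\<dots> = of_int q" using d(1)[OF that True] .
      finally show ?thesis .
    next
      case False
      then have "dd j = (\<Sum>n\<in>{1..p}. d n * of_int q)"
        unfolding dd_def by (intro sum.cong) auto
      also have "\<dots> = of_int q * (\<Sum>n\<in>{1..p}. d n)"
        by (simp add: sum_distrib_left mult.commute)
      finally show ?thesis using d(2) by simp
    qed
    have word: "(\<Sum>n\<in>{1..p}. d n * I_char (wop w (L n))) = of_int (word_degree w) * (of_int q * c) ^ length w"
      if "list_all neg_gen w" "L_count w = 0" for w
      using that
    proof (induction w)
      case Nil
      show ?case by (auto simp: \<chi>_pos I_char_rules intro!: sum.neutral)
    next
      case (Cons a w)
      then obtain m where a: "a = I (- m)" "m > 0" by (auto elim: neg_genE)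
      have w: "list_all neg_gen w" "L_count w = 0" using Cons.prems by (auto split: if_splits)
      let ?x = "(of_int q * c) ^ length w"
      have "I_char (wop (a # w) (L n)) = of_int q * c * I_char (wop w (L n))
          + of_int m * c * ?x * (if n = m then of_int (p - m) else if n < m then of_int q else 0)"
        if "n \<in> {1..p}" for n
        using that unfolding a(1) by (subst wop_L_I[OF w _ a(2)]) (auto simp: I_char_rules)
      then have "(\<Sum>n\<in>{1..p}. d n * I_char (wop (a # w) (L n))) =
          (\<Sum>n\<in>{1..p}. of_int q * c * (d n * I_char (wop w (L n))) + of_int m * c * ?x *
            (d n * (if n = m then of_int (p - m) else if n < m then of_int q else 0)))"
        by (intro sum.cong refl) (simp add: algebra_simps)
      also have "\<dots> = of_int q * c * (of_int (word_degree w) * ?x) + of_int m * c * ?x * dd m"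
        unfolding sum.distrib sum_distrib_left[symmetric] Cons.IH[OF w] dd_def ..
      also have "\<dots> = of_int (word_degree (a # w)) * (of_int q * c) ^ length (a # w)"
        using a by (simp add: dd algebra_simps)
      finally show ?case .
    qed
    have zero: "I_char (lin_ext (\<lambda>w. wop w (L n)) f) = 0" if "n \<in> {1..p}" for n
    proof -
      let ?g = "lin_ext (\<lambda>w. wop w (L n)) f"
      have g: "?g \<in> supported (I_words (int k - n))"
        by (rule lin_ext_mem[OF subspace_supported less.prems(1)]) (use that in \<open>auto intro: wop_L_supported\<close>)
      have e: "word_eval v ?g = 0" using less.prems(2) by (simp add: word_eval_lin_ext_wop act_rules)
      show ?thesis
      proof (cases "n \<le> int k")
        case True
        then have "nat (int k - n) < k" "int (nat (int k - n)) = int k - n"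
          using that by auto
        then show ?thesis
          using less.IH[of "nat (int k - n)" ?g] g e by simp
      next
        case False
        then have "?g = 0" using g by (simp add: I_words_neg)
        then show ?thesis by (simp add: I_char_rules)
      qed
    qed
    have "of_int (int k) * I_char f = lin_ext (\<lambda>w. of_int (int k) *\<^sub>C (of_int q * c) ^ length w) f"
      using lin_ext_fun_scale[of "of_int (int k)" "\<lambda>w. (of_int q * c) ^ length w" f]
      by (simp add: I_char_def scaleC_complex_def)
    also have "\<dots> = lin_ext (\<lambda>w. \<Sum>n\<in>{1..p}. d n *\<^sub>C I_char (wop w (L n))) f"
      by (intro lin_ext_cong[OF less.prems(1)]) (auto simp: I_words_def scaleC_complex_def word)
    also have "\<dots> = (\<Sum>n\<in>{1..p}. d n *\<^sub>C I_char (lin_ext (\<lambda>w. wop w (L n)) f))"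
      by (simp only: lin_ext_fun_sum lin_ext_fun_scale lin_ext_clinear[OF clinear_I_char])
    also have "\<dots> = 0"
      by (simp add: zero scaleC_complex_def)
    finally show ?thesis using False by simp
  qed
qed

text \<open>\<open>I_char_zero\<close> speaks of homogeneous relations, so the relation is first
  split by degree, the eigenvalue of \<open>degree_op\<close>.\<close>

lemma word_eval_zero_imp_I:
  assumes f: "f \<in> supported (neg_words 1)" and ev: "word_eval v f = 0"
  shows "Y.word_eval y0 f = 0"
proof -
  let ?K = "Poly_Mapping.keys f"
  define part where "part k = (\<Sum>w\<in>{w \<in> ?K. word_degree w = k}. Poly_Mapping.lookup f w *\<^sub>C fbasis w)" for k
  have "f = lin_ext fbasis f" by (simp add: lin_ext_fbasis_self)
  also have "\<dots> = (\<Sum>k\<in>word_degree ` ?K. part k)"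
    unfolding lin_ext_def part_def by (rule sum.image_gen) simp
  finally have f_sum: "f = (\<Sum>k\<in>word_degree ` ?K. part k)" .
  have part_supp: "part k \<in> supported (I_words k)" for k
    unfolding part_def
    by (intro complex_vector.subspace_sum[OF subspace_supported] complex_vector.subspace_scale[OF subspace_supported])
      (use f in \<open>auto simp: supported_def neg_words_def I_words_def\<close>)
  have part_ev: "word_eval v (part k) = 0" if "k \<in> word_degree ` ?K" for k
  proof -
    have "part k \<in> {f. word_eval v f = 0}"
    proof (rule eigen_components_mem[where T = degree_op and f = part and e = of_int])
      show "clinear degree_op" unfolding degree_op_def by (rule clinear_lin_ext)
      show "complex_vector.subspace {f. word_eval v f = 0}"
        by (auto simp: complex_vector.subspace_def word_eval_rules)
      show "degree_op (part k) = of_int k *\<^sub>C part k" for k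
      proof -
        have "degree_op (part k) = lin_ext (\<lambda>w. of_int k *\<^sub>C fbasis w) (part k)"
          unfolding degree_op_def by (rule lin_ext_cong[OF part_supp]) (simp add: I_words_def)
        then show ?thesis by (simp add: lin_ext_fun_scale lin_ext_fbasis_self)
      qed
      show "degree_op x \<in> {f. word_eval v f = 0}" if "x \<in> {f. word_eval v f = 0}" for x
        using that by (simp add: word_eval_degree_op act_rules)
      show "(\<Sum>k\<in>word_degree ` ?K. part k) \<in> {f. word_eval v f = 0}"
        using ev f_sum by simp
    qed (use that in \<open>auto simp: inj_on_def\<close>)
    then show ?thesis by simp
  qed
  have "Y.word_eval y0 (part k) = 0" if "k \<in> word_degree ` ?K" for k
  proof -
    have "k \<ge> 0"
      using that f word_degree_nonneg by (auto simp: supported_def neg_words_def)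
    then have "I_char (part k) = 0"
      using I_char_zero[of "part k" "nat k"] part_supp[of k] part_ev[OF that] by simp
    then show ?thesis
      using Y_eval_I_words[OF part_supp] by simp
  qed
  then have "Y.word_eval y0 (\<Sum>k\<in>word_degree ` ?K. part k) = 0"
    by (simp add: clinear_sum[OF Y.clinear_eval])
  then show ?thesis using f_sum by simp
qed

end

section \<open>Elimination of the letters \<open>L\<close> from relations, and the map to
  \<open>Y\<close>\<close>

context hv_pairing
begin

lemma Z_eval_word_sum:
  assumes "f \<in> supported (neg_words (Suc s))"
  obtains M where
    "\<And>l. l > M \<Longrightarrow> lin_ext (remove_L l) f = 0"
    "of_nat s *\<^sub>C Z.word_eval (v, y0) f
      - (\<Sum>l\<in>{1..M}. Z.gen (L (- l)) (Z.word_eval (v, y0) (lin_ext (remove_L l) f))) \<in> Z.word_eval_space (v, y0) s"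
    "\<And>k. k > 0 \<Longrightarrow> Z.word_eval (v, y0) (lin_ext (\<lambda>w. wop w (I k)) f)
      - ((of_int (k * (p + k)) * c) *\<^sub>C Z.word_eval (v, y0) (lin_ext (remove_L k) f)
        + (\<Sum>l\<in>{k+1..M}. of_int k *\<^sub>C Z.gen (I (k - l)) (Z.word_eval (v, y0) (lin_ext (remove_L l) f))))
      \<in> Z.word_eval_space (v, y0) (s - 1)"
proof -
  let ?z = "(v, y0)"
  let ?ls = "{l. \<exists>w\<in>Poly_Mapping.keys f. L (- l) \<in> set w}"
  have "?ls \<subseteq> uminus ` (\<Union>w\<in>Poly_Mapping.keys f. L -` set w)"
  proof
    show "l \<in> uminus ` (\<Union>w\<in>Poly_Mapping.keys f. L -` set w)" if "l \<in> ?ls" for l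
      by (rule image_eqI[of _ _ "- l"]) (use that in auto)
  qed
  moreover have "finite (\<Union>w\<in>Poly_Mapping.keys f. L -` set w)"
    by (auto intro!: finite_vimageI injI)
  ultimately have fin: "finite ?ls" using finite_surj by blast
  \<comment> \<open>If no letter \<open>L\<close> occurs, this is the maximum of an empty set and
    thus an unspecified integer; that is harmless, since all formal derivatives of \<open>f\<close>
    are then 0.\<close>
  define M where "M = Max ?ls"
  have M: "l \<le> M" if "w \<in> Poly_Mapping.keys f" "L (- l) \<in> set w" for w l
    unfolding M_def by (rule Max_ge[OF fin]) (use that in blast)
  have keys: "list_all neg_gen w" "L_count w \<le> s" if "w \<in> Poly_Mapping.keys f" for w
    using that assms by (auto simp: supported_def neg_words_def)
  have f_keys: "f \<in> supported (Poly_Mapping.keys f)" by (simp add: supported_def)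
  show thesis
  proof
    show "lin_ext (remove_L l) f = 0" if "l > M" for l
    proof -
      have "lin_ext (remove_L l) f = lin_ext (\<lambda>w. 0) f"
        by (rule lin_ext_cong[OF f_keys]) (use M that in \<open>force intro: remove_L_eq_0\<close>)
      then show ?thesis by (simp add: lin_ext_def)
    qed
    have word_eval_f: "Z.word_eval ?z f = lin_ext (\<lambda>w. foldr Z.gen w ?z) f"
      by (simp add: Z.word_eval_def)
    have "lin_ext (\<lambda>w. of_nat s *\<^sub>C foldr Z.gen w ?z
      - (\<Sum>l\<in>{1..M}. Z.gen (L (- l)) (Z.word_eval ?z (remove_L l w)))) f \<in> Z.word_eval_space ?z s"
    proof (rule lin_ext_mem[OF Z.subspace_eval_space f_keys])
      fix w assume w: "w \<in> Poly_Mapping.keys f"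
      let ?E = "\<lambda>n. of_nat n *\<^sub>C foldr Z.gen w ?z
        - (\<Sum>l\<in>{1..M}. Z.gen (L (- l)) (Z.word_eval ?z (remove_L l w)))"
      have "?E (L_count w) \<in> Z.word_eval_space ?z s"
        using Z.euler_identity[OF keys(1)[OF w] M[OF w]] keys(2)[OF w] Z.word_eval_space_mono by blast
      \<comment> \<open>Words with fewer than \<open>s\<close> letters \<open>L\<close> already lie
        in the target space, so the factor \<open>L_count w\<close> may be replaced by the uniform
        factor \<open>s\<close>.\<close>
      moreover have "of_nat (s - L_count w) *\<^sub>C foldr Z.gen w ?z \<in> Z.word_eval_space ?z s"
      proof (cases "L_count w = s")
        case True
        then show ?thesis by (simp add: Z.word_eval_space_zero)
      next
        case False
        then have "fbasis w \<in> supported (neg_words s)" using keys[OF w] by (simp add: neg_words_def)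
        from Z.word_eval_spaceI[OF this] show ?thesis by (simp add: Z.word_eval_space_scale)
      qed
      ultimately have "?E (L_count w) + of_nat (s - L_count w) *\<^sub>C foldr Z.gen w ?z \<in> Z.word_eval_space ?z s"
        by (rule Z.word_eval_space_add)
      also have "?E (L_count w) + of_nat (s - L_count w) *\<^sub>C foldr Z.gen w ?z = ?E s"
        using keys(2)[OF w] by (simp add: of_nat_diff complex_vector.scale_left_diff_distrib)
      finally show "?E s \<in> Z.word_eval_space ?z s" .
    qed
    then show "of_nat s *\<^sub>C Z.word_eval ?z f
      - (\<Sum>l\<in>{1..M}. Z.gen (L (- l)) (Z.word_eval ?z (lin_ext (remove_L l) f))) \<in> Z.word_eval_space ?z s"
      by (simp only: lin_ext_fun_diff lin_ext_fun_scale lin_ext_fun_sum lin_ext_clinear[OF Z.clinear_eval]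
          lin_ext_clinear[OF Z.clinear_act] word_eval_f)
    fix k :: int
    assume k: "k > 0"
    have "lin_ext (\<lambda>w. Z.word_eval ?z (wop w (I k))
      - ((of_int (k * (p + k)) * c) *\<^sub>C Z.word_eval ?z (remove_L k w)
        + (\<Sum>l\<in>{k+1..M}. of_int k *\<^sub>C Z.gen (I (k - l)) (Z.word_eval ?z (remove_L l w))))) f
      \<in> Z.word_eval_space ?z (s - 1)"
    proof (rule lin_ext_mem[OF Z.subspace_eval_space f_keys])
      fix w assume w: "w \<in> Poly_Mapping.keys f"
      show "Z.word_eval ?z (wop w (I k))
        - ((of_int (k * (p + k)) * c) *\<^sub>C Z.word_eval ?z (remove_L k w)
        + (\<Sum>l\<in>{k+1..M}. of_int k *\<^sub>C Z.gen (I (k - l)) (Z.word_eval ?z (remove_L l w))))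
        \<in> Z.word_eval_space ?z (s - 1)"
        using Z.I_symbol[OF keys(1)[OF w] M[OF w] k] keys(2)[OF w]
        by (rule Z.word_eval_space_mono[OF _ diff_le_mono])
    qed
    then show "Z.word_eval ?z (lin_ext (\<lambda>w. wop w (I k)) f)
      - ((of_int (k * (p + k)) * c) *\<^sub>C Z.word_eval ?z (lin_ext (remove_L k) f)
        + (\<Sum>l\<in>{k+1..M}. of_int k *\<^sub>C Z.gen (I (k - l)) (Z.word_eval ?z (lin_ext (remove_L l) f))))
      \<in> Z.word_eval_space ?z (s - 1)"
      by (simp only: lin_ext_fun_diff lin_ext_fun_add lin_ext_fun_scale lin_ext_fun_sum
          lin_ext_clinear[OF Z.clinear_eval] lin_ext_clinear[OF Z.clinear_act])
  qed
qed

text \<open>Let a relation have at most s > 0 letters \<open>L\<close>. Its images under I(k) are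
  relations with fewer, so they vanish in \<open>Y\<close> by induction, and the triangular system
  of \<open>I_symbol\<close> lowers the filtration index of every derivative from s to s - 1.
  Euler's identity then replaces the relation, in L and \<open>Y\<close> simultaneously, by one with
  fewer than s letters, and the induction hypothesis is used a second time.\<close>

lemma word_eval_zero_imp:
  assumes "f \<in> supported (neg_words s)" "word_eval v f = 0"
  shows "Y.word_eval y0 f = 0"
  using assms
proof (induction s arbitrary: f)
  case 0
  then show ?case by (simp add: Y.word_eval_rules)
next
  case (Suc s)
  show ?case
  proof (cases "s = 0")
    case True
    then show ?thesis using word_eval_zero_imp_I Suc.prems by simp
  next
    case False
    let ?z = "(v, y0)"
    let ?R = "\<lambda>l. Z.word_eval ?z (lin_ext (remove_L l) f)"
    obtain M where
      large: "\<And>l. l > M \<Longrightarrow> lin_ext (remove_L l) f = 0" and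
      euler: "of_nat s *\<^sub>C Z.word_eval ?z f - (\<Sum>l\<in>{1..M}. Z.gen (L (- l)) (?R l)) \<in> Z.word_eval_space ?z s" and
      symbol: "\<And>k. k > 0 \<Longrightarrow> Z.word_eval ?z (lin_ext (\<lambda>w. wop w (I k)) f)
        - ((of_int (k * (p + k)) * c) *\<^sub>C ?R k + (\<Sum>l\<in>{k+1..M}. of_int k *\<^sub>C Z.gen (I (k - l)) (?R l)))
        \<in> Z.word_eval_space ?z (s - 1)"
      using Z_eval_word_sum[OF Suc.prems(1)] by blast
    have zero: "Z.word_eval ?z (lin_ext (\<lambda>w. wop w (I k)) f) = 0" if "k > 0" for k
    proof -
      let ?g = "lin_ext (\<lambda>w. wop w (I k)) f"
      have "?g \<in> supported (neg_words s)"
      proof (rule lin_ext_mem[OF subspace_supported Suc.prems(1)])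
        fix w assume "w \<in> neg_words (Suc s)"
        then have "list_all neg_gen w" "neg_words (L_count w) \<subseteq> neg_words s"
          by (auto simp: neg_words_def)
        then show "wop w (I k) \<in> supported (neg_words s)"
          using wop_I_supported[OF _ that] supported_mono by blast
      qed
      moreover have "word_eval v ?g = 0"
        using Suc.prems(2) by (simp add: word_eval_lin_ext_wop act_rules)
      ultimately show ?thesis
        using Suc.IH by (simp add: Z_eval zero_prod_def)
    qed
    \<comment> \<open>Descending induction on \<open>k\<close>, starting above \<open>M\<close>: the
      sum in \<open>symbol\<close> involves only derivatives with l > k, and the diagonal
      coefficient can be divided out.\<close>
    have R: "?R k \<in> Z.word_eval_space ?z (s - 1)" if "k > 0" for k
      using that
    proof (induction "nat (M - k)" arbitrary: k rule: less_induct)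
      case less
      show ?case
      proof (cases "k > M")
        case True
        then show ?thesis by (simp add: large Z.word_eval_rules Z.word_eval_space_zero)
      next
        case False
        let ?S = "\<Sum>l\<in>{k+1..M}. of_int k *\<^sub>C Z.gen (I (k - l)) (?R l)"
        let ?a = "of_int (k * (p + k)) * c"
        have "k * (p + k) \<noteq> 0" using less.prems p_pos by simp
        then have a_nz: "?a \<noteq> 0"
          using c_nz by (simp only: mult_eq_0_iff[of "of_int _" c] of_int_eq_0_iff simp_thms)
        have S: "?S \<in> Z.word_eval_space ?z (s - 1)"
        proof (intro Z.word_eval_space_sum Z.word_eval_space_scale)
          fix l assume l: "l \<in> {k+1..M}"
          then have "?R l \<in> Z.word_eval_space ?z (s - 1)"
            using less by simp
          then show "Z.gen (I (k - l)) (?R l) \<in> Z.word_eval_space ?z (s - 1)"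
            using Z.word_eval_space_I[of "l - k" "?R l"] l by simp
        qed
        have "- (?a *\<^sub>C ?R k + ?S) \<in> Z.word_eval_space ?z (s - 1)"
          using symbol[OF less.prems] zero[OF less.prems] by simp
        from Z.word_eval_space_diff[OF Z.word_eval_space_neg[OF this] S]
        have "?a *\<^sub>C ?R k \<in> Z.word_eval_space ?z (s - 1)" by simp
        from Z.word_eval_space_scale[OF this, of "1 / ?a"] show ?thesis
          using a_nz by (simp add: scaleC_scaleC scaleC_one del: of_int_mult of_int_add)
      qed
    qed
    have "(\<Sum>l\<in>{1..M}. Z.gen (L (- l)) (?R l)) \<in> Z.word_eval_space ?z s"
    proof (rule Z.word_eval_space_sum)
      fix l assume "l \<in> {1..M}"
      then show "Z.gen (L (- l)) (?R l) \<in> Z.word_eval_space ?z s"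
        using Z.word_eval_space_L[OF _ R, of l l] False by simp
    qed
    from Z.word_eval_space_add[OF euler this] have "of_nat s *\<^sub>C Z.word_eval ?z f \<in> Z.word_eval_space ?z s"
      by simp
    from Z.word_eval_space_scale[OF this, of "1 / of_nat s"] have "Z.word_eval ?z f \<in> Z.word_eval_space ?z s"
      using False by (simp add: scaleC_scaleC scaleC_one)
    then obtain g where g: "g \<in> supported (neg_words s)" "Z.word_eval ?z f = Z.word_eval ?z g"
      by (auto simp: Z.word_eval_space_def)
    then have "word_eval v g = 0" "Y.word_eval y0 g = Y.word_eval y0 f"
      using Suc.prems(2) by (auto simp: Z_eval)
    then show ?thesis using Suc.IH[OF g(1)] by simp
  qed
qed

lemma word_eval_zero_imp_neg:
  assumes f: "f \<in> supported {w. list_all neg_gen w}" and "word_eval v f = 0"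
  shows "Y.word_eval y0 f = 0"
proof (rule word_eval_zero_imp)
  show "f \<in> supported (neg_words (Suc (Max (L_count ` Poly_Mapping.keys f))))"
    using f by (auto simp: supported_def neg_words_def less_Suc_eq_le)
qed fact

text \<open>A representative exists by \<open>word_eval_surj\<close>; the choice does not matter by
  \<open>word_eval_zero_imp_neg\<close>, applied to the difference of two of them.\<close>

definition to_Y :: "'v \<Rightarrow> (int \<Rightarrow>\<^sub>0 complex)"
  where "to_Y x = Y.word_eval y0 (SOME f. f \<in> supported {w. list_all neg_gen w} \<and> word_eval v f = x)"

lemma to_Y_eval:
  assumes "f \<in> supported {w. list_all neg_gen w}"
  shows "to_Y (word_eval v f) = Y.word_eval y0 f"
proof -
  let ?P = "\<lambda>g. g \<in> supported {w. list_all neg_gen w} \<and> word_eval v g = word_eval v f"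
  have "?P (SOME g. ?P g)" by (rule someI[of ?P f]) (use assms in simp)
  then have "Y.word_eval y0 ((SOME g. ?P g) - f) = 0"
    using assms by (intro word_eval_zero_imp_neg complex_vector.subspace_diff[OF subspace_supported])
      (auto simp: word_eval_rules)
  then show ?thesis by (simp add: to_Y_def Y.word_eval_rules)
qed

lemma clinear_to_Y: "clinear to_Y"
proof (rule clinearI)
  fix x y a
  obtain f where f: "f \<in> supported {w. list_all neg_gen w}" "word_eval v f = x" using word_eval_surj by blast
  obtain g where g: "g \<in> supported {w. list_all neg_gen w}" "word_eval v g = y" using word_eval_surj by blast
  show "to_Y (x + y) = to_Y x + to_Y y"
    using to_Y_eval[OF complex_vector.subspace_add[OF subspace_supported f(1) g(1)]]
      to_Y_eval[OF f(1)] to_Y_eval[OF g(1)] f g by (simp add: word_eval_rules Y.word_eval_rules)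
  show "to_Y (a *\<^sub>C x) = a *\<^sub>C to_Y x"
    using to_Y_eval[OF complex_vector.subspace_scale[OF subspace_supported f(1)], of a]
      to_Y_eval[OF f(1)] f by (simp add: word_eval_rules Y.word_eval_rules)
qed

lemma to_Y_gen:
  assumes "neg_gen g"
  shows "to_Y (gen g x) = Y.gen g (to_Y x)"
proof -
  obtain f where f: "f \<in> supported {w. list_all neg_gen w}" "word_eval v f = x" using word_eval_surj by blast
  have "cons_gen g f \<in> supported {w. list_all neg_gen w}"
    by (rule cons_gen_supported[OF f(1)]) (use assms in auto)
  from to_Y_eval[OF this] to_Y_eval[OF f(1)] f show ?thesis by simp
qed

lemma to_Y_v: "to_Y v = y0"
  using to_Y_eval[of "fbasis []"] by simp

end

section \<open>Tensor products with the intermediate series\<close>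

lemma tensor_mem_subspace:
  fixes t :: "('k \<Rightarrow>\<^sub>0 complex, 'v::complex_vector) tensor"
  assumes S: "complex_vector.subspace S" and base: "\<And>k w. fbasis k \<otimes>\<^sub>C w \<in> S"
  shows "t \<in> S"
proof -
  note pt = cbilinear_pure_tensor[unfolded cbilinear_def]
  have pure: "f \<otimes>\<^sub>C w \<in> S" for f :: "'k \<Rightarrow>\<^sub>0 complex" and w :: 'v
  proof -
    have "lin_ext fbasis f \<otimes>\<^sub>C w = lin_ext (\<lambda>k. fbasis k \<otimes>\<^sub>C w) f"
      using pt lin_ext_clinear[of "\<lambda>f. f \<otimes>\<^sub>C w"] by blast
    also have "\<dots> \<in> S"
      by (rule lin_ext_mem[OF S, of _ UNIV]) (simp_all add: supported_def base)
    finally show ?thesis by (simp add: lin_ext_fbasis_self)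
  qed
  obtain p where p: "t = abs_tensor p"
    by (metis Quotient3_tensor Quotient3_abs_rep)
  have "abs_tensor (lin_ext fbasis p) = lin_ext (\<lambda>k. abs_tensor (fbasis k)) p"
    by (rule lin_ext_clinear[OF clinear_abs_tensor])
  also have "\<dots> \<in> S"
  proof (rule lin_ext_mem[OF S, of _ UNIV])
    show "abs_tensor (fbasis k) \<in> S" for k
      using pure[of "fst k" "snd k"] by (simp add: pure_tensor.abs_eq)
  qed (simp add: supported_def)
  finally show ?thesis by (simp add: p lin_ext_fbasis_self)
qed

lemma subspace_clinear_eq:
  assumes "clinear f" "clinear g"
  shows "complex_vector.subspace {x. f x = g x}"
  by (auto simp: complex_vector.subspace_def clinear_0 clinear_add clinear_scale assms)

text \<open>Taking the coefficient at \<open>k\<close> in the first factor is bilinear, and the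
  induced map on the tensor product recovers \<open>w\<close>.\<close>

lemma pure_tensor_nonzero:
  assumes "(w :: 'v::complex_vector) \<noteq> 0"
  shows "fbasis k \<otimes>\<^sub>C w \<noteq> (0 :: ('k \<Rightarrow>\<^sub>0 complex, 'v) tensor)"
proof
  let ?g = "\<lambda>f x. Poly_Mapping.lookup f k *\<^sub>C (x :: 'v)"
  assume z: "fbasis k \<otimes>\<^sub>C w = (0 :: ('k \<Rightarrow>\<^sub>0 complex, 'v) tensor)"
  have "cbilinear ?g"
    by (rule cbilinearI) (simp_all add: lookup_add lookup_scaleC scaleC_complex_def scaleC_scaleC
        scaleC_add_left scaleC_add_right mult.commute)
  then have "tensor_lift ?g (fbasis k \<otimes>\<^sub>C w) = w" "tensor_lift ?g 0 = 0"
    by (simp_all add: lookup_fbasis scaleC_one clinear_0[OF clinear_tensor_lift])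
  then show False using z assms by simp
qed

locale hv_tensor = hv_module act for act :: "hv \<Rightarrow> 'v::complex_vector \<Rightarrow> 'v" +
  fixes \<alpha> \<beta> F :: complex
begin

sublocale T: hv_module "tensor_act (intermediate_act \<alpha> \<beta> F) act"
  unfolding hv_module_def
  by (rule lie_module_tensor[OF lie_module_intermediate lie_module_axioms])

lemmas pure_rules = cbilinearD[OF cbilinear_pure_tensor] cbilinear_minus_diff[OF cbilinear_pure_tensor]

lemma T_gen_pure:
  "T.gen g (fbasis m \<otimes>\<^sub>C w) = intermediate_gen_act \<alpha> \<beta> F g m \<otimes>\<^sub>C w + fbasis m \<otimes>\<^sub>C gen g w"
proof -
  have "cbilinear (intermediate_act \<alpha> \<beta> F)"
    unfolding intermediate_act_def by (rule cbilinear_bilin_ext)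
  from tensor_act_aux[OF this act_bilinear] show ?thesis
    unfolding tensor_act_def by (simp add: intermediate_act_def)
qed

lemma T_gen_L: "T.gen (L k) (fbasis m \<otimes>\<^sub>C w) =
    - ((of_int m + \<alpha> + \<beta> + of_int k * \<beta>) *\<^sub>C (fbasis (m + k) \<otimes>\<^sub>C w)) + fbasis m \<otimes>\<^sub>C gen (L k) w"
  and T_gen_I: "T.gen (I k) (fbasis m \<otimes>\<^sub>C w) =
    F *\<^sub>C (fbasis (m + k) \<otimes>\<^sub>C w) + fbasis m \<otimes>\<^sub>C gen (I k) w"
  by (simp_all add: T_gen_pure pure_rules)

lemma T_gen_central:
  assumes "g \<in> {C_L, C_LI, C_I}"
  shows "T.gen g (fbasis m \<otimes>\<^sub>C w) = fbasis m \<otimes>\<^sub>C gen g w"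
  using assms by (auto simp: T_gen_pure pure_rules)

end

section \<open>The invariant functional and the proper submodule\<close>

context hv_pairing
begin

lemma lookup_Y_gen:
  "Poly_Mapping.lookup (Y.gen (L k) y) n = - (of_int (n - k) + \<alpha> + \<beta> + of_int k * \<beta>) * Poly_Mapping.lookup y (n - k)"
  "Poly_Mapping.lookup (Y.gen (I k) y) n = of_int q * c * Poly_Mapping.lookup y (n - k)"
proof -
  have lin: "clinear (\<lambda>y. Poly_Mapping.lookup (Y.gen g y) n)"
    "clinear (\<lambda>y. a * Poly_Mapping.lookup y (n - k))" for g and a :: complex
    by (rule clinearI; simp add: Y.act_rules lookup_add lookup_scaleC)
      (rule clinearI; simp add: lookup_add lookup_scaleC scaleC_complex_def algebra_simps)
  show "Poly_Mapping.lookup (Y.gen (L k) y) n = - (of_int (n - k) + \<alpha> + \<beta> + of_int k * \<beta>) * Poly_Mapping.lookup y (n - k)"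
    by (rule clinear_eq_on_fbasis[OF lin(1) lin(2)])
      (auto simp: Y_gen_fbasis lookup_fbasis lookup_scaleC scaleC_complex_def)
  show "Poly_Mapping.lookup (Y.gen (I k) y) n = of_int q * c * Poly_Mapping.lookup y (n - k)"
    by (rule clinear_eq_on_fbasis[OF lin(1) lin(2)])
      (auto simp: Y_gen_fbasis lookup_fbasis lookup_scaleC scaleC_complex_def)
qed

text \<open>The parameters are those of the module dual to \<open>intermediate_act \<alpha> \<beta> (q c)\<close> under the pairing of
  \<open>v\<^sub>m\<close> with \<open>v\<^sub>-\<^sub>m\<close>.\<close>

lemma tensor_not_irreducible:
  "\<not> irreducible_lie_module hv_bracket
    (tensor_act (intermediate_act (- \<alpha> - 1) (1 - \<beta>) (- (of_int q * c))) act)"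
proof
  interpret W: hv_tensor act "- \<alpha> - 1" "1 - \<beta>" "- (of_int q * c)" ..
  let ?T = "tensor_act (intermediate_act (- \<alpha> - 1) (1 - \<beta>) (- (of_int q * c))) act"
  define pair where "pair f x = lin_ext (\<lambda>m. Poly_Mapping.lookup (to_Y x) (- m)) f" for f x
  have bil: "cbilinear pair"
    by (rule cbilinearI) (simp_all add: pair_def lin_ext_rules clinear_add[OF clinear_to_Y]
        clinear_scale[OF clinear_to_Y] lookup_add lookup_scaleC lin_ext_fun_add lin_ext_fun_scale)
  define \<theta> where "\<theta> = tensor_lift pair"
  have lin: "clinear \<theta>" unfolding \<theta>_def by (rule clinear_tensor_lift[OF bil])
  note \<theta>_rules = clinear_add[OF lin] clinear_scale[OF lin] clinear_0[OF lin] clinear_minus[OF lin]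
    clinear_diff[OF lin]
  have \<theta>_pure: "\<theta> (fbasis m \<otimes>\<^sub>C x) = Poly_Mapping.lookup (to_Y x) (- m)" for m x
    by (simp add: \<theta>_def bil pair_def)
  \<comment> \<open>\<open>to_Y\<close> commutes with negative generators, so the action on the
    second factor becomes the action on \<open>Y\<close>, and the dual parameters make it cancel the
    action on the first factor.\<close>
  have \<theta>_neg: "\<theta> (W.T.gen g t) = 0" if "neg_gen g" for g t
  proof -
    have "t \<in> {t. \<theta> (W.T.gen g t) = (\<lambda>_. 0) t}"
    proof (rule tensor_mem_subspace[OF subspace_clinear_eq])
      show "clinear (\<lambda>t. \<theta> (W.T.gen g t))" "clinear (\<lambda>_ :: (int \<Rightarrow>\<^sub>0 complex, 'v) tensor. 0 :: complex)"
        by (rule clinearI; simp add: \<theta>_rules W.T.act_rules)+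
      fix m x
      from that show "fbasis m \<otimes>\<^sub>C x \<in> {t. \<theta> (W.T.gen g t) = 0}"
      proof (cases rule: neg_genE)
        case (1 j)
        then show ?thesis
          using to_Y_gen[OF that, of x]
          by (simp add: W.T_gen_L \<theta>_rules \<theta>_pure lookup_Y_gen scaleC_complex_def)
            (simp add: algebra_simps)?
      next
        case (2 j)
        then show ?thesis
          using to_Y_gen[OF that, of x]
          by (simp add: W.T_gen_I \<theta>_rules \<theta>_pure lookup_Y_gen scaleC_complex_def)
            (simp add: algebra_simps)?
      qed
    qed
    then show ?thesis by simp
  qed
  \<comment> \<open>Generators that are not negative act on \<open>v\<close> by scalars and never
    lower the index, so the span of these vectors is stable under them. Index 0 is left out because
    the functional is 1 there.\<close>
  let ?Z = "{fbasis m \<otimes>\<^sub>C v | m :: int. m > 0}"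
  let ?N = "neg_span ?T ?Z"
  have sub: "lie_submodule ?T ?N"
  proof (rule W.T.lie_submodule_neg_span)
    fix g z assume "z \<in> ?Z" and g: "\<not> neg_gen g"
    then obtain m where m: "z = fbasis m \<otimes>\<^sub>C v" "m > 0" by auto
    have mem: "fbasis n \<otimes>\<^sub>C v \<in> complex_vector.span ?Z" if "n > 0" for n
      using that by (intro complex_vector.span_base) auto
    note span = complex_vector.span_add complex_vector.span_scale complex_vector.span_neg
      complex_vector.span_diff
    show "W.T.gen g z \<in> complex_vector.span ?Z"
      using g m by (cases g) (auto simp: m(1) W.T_gen_L W.T_gen_I W.T_gen_central vac W.pure_rules intro!: span mem)
  qed
  have "\<theta> t = 0" if "t \<in> ?N" for t
    using that
  proof induction
    case (base z)
    then show ?case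
      by (induction rule: complex_vector.span_induct_alt)
        (auto simp: \<theta>_rules \<theta>_pure to_Y_v lookup_fbasis)
  qed (simp_all add: \<theta>_rules \<theta>_neg)
  moreover have "\<theta> (fbasis 0 \<otimes>\<^sub>C v) = 1"
    by (simp add: \<theta>_pure to_Y_v lookup_fbasis)
  ultimately have "?N \<noteq> UNIV" by (metis UNIV_I zero_neq_one)
  moreover have "fbasis 1 \<otimes>\<^sub>C v \<noteq> (0 :: (int \<Rightarrow>\<^sub>0 complex, 'v) tensor)"
    using v_nz by (rule pure_tensor_nonzero)
  then have "?N \<noteq> {0}"
    using neg_span.base[OF complex_vector.span_base, of "fbasis 1 \<otimes>\<^sub>C v" ?Z ?T] by force
  moreover assume "irreducible_lie_module hv_bracket ?T"
  ultimately show False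
    using sub by (auto simp: irreducible_lie_module_def)
qed

end

section \<open>The vanishing singular vector\<close>

context hv_cyclic
begin

text \<open>The eigenspace of a central element is a submodule; it contains \<open>v\<close>, hence
  is everything.\<close>

lemma gen_central: "gen C_I x = 0" "gen C_LI x = c *\<^sub>C x" "gen C_L x = \<chi> C_L *\<^sub>C x"
proof -
  have central: "gen g x = \<chi> g *\<^sub>C x" if g: "g \<in> {C_L, C_LI, C_I}" for g
  proof -
    have "lie_submodule act {x. gen g x = \<chi> g *\<^sub>C x}"
    proof (rule lie_submodule_genI)
      show "complex_vector.subspace {x. gen g x = \<chi> g *\<^sub>C x}"
        by (rule subspace_clinear_eq[OF clinear_act clinearI]) (simp_all add: scaleC_add_right scaleC_scaleC mult.commute)
      show "gen a x \<in> {x. gen g x = \<chi> g *\<^sub>C x}" if "x \<in> {x. gen g x = \<chi> g *\<^sub>C x}" for a x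
        using that g bracket_central[of a] by (auto simp: gen_commute[of _ a] act_rules)
    qed
    moreover have "v \<in> {x. gen g x = \<chi> g *\<^sub>C x}" using g by (auto intro!: vac)
    ultimately have "{x. gen g x = \<chi> g *\<^sub>C x} = UNIV" by (rule cyclic)
    then show ?thesis by auto
  qed
  show "gen C_I x = 0" "gen C_LI x = c *\<^sub>C x" "gen C_L x = \<chi> C_L *\<^sub>C x"
    using central by (simp_all add: \<chi>_central)
qed

lemma gen_I_I: "gen (I k) (gen (I m) x) = gen (I m) (gen (I k) x)"
  using gen_commute[of "I k" "I m" x] by (simp add: act_rules gen_central)

lemma gen_L_I: "gen (L k) (gen (I m) x) = gen (I m) (gen (L k) x)
    - of_int m *\<^sub>C gen (I (k + m)) x - (if k = - m then (of_int (k ^ 2 + k) * c) *\<^sub>C x else 0)"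
  using gen_commute[of "L k" "I m" x] by (simp add: act_rules gen_central scaleC_scaleC)

lemma locally_nilpotent: "\<exists>J. \<forall>j\<ge>J. gen (L j) w = 0 \<and> gen (I j) w = 0"
proof -
  let ?D = "{w. \<exists>J. \<forall>j\<ge>J. gen (L j) w = 0 \<and> gen (I j) w = 0}"
  have "lie_submodule act ?D"
  proof (rule lie_submodule_genI)
    show "complex_vector.subspace ?D"
      unfolding complex_vector.subspace_def
    proof (intro conjI ballI allI)
      fix x y assume "x \<in> ?D" "y \<in> ?D"
      then obtain J J' where "\<forall>j\<ge>J. gen (L j) x = 0 \<and> gen (I j) x = 0"
        "\<forall>j\<ge>J'. gen (L j) y = 0 \<and> gen (I j) y = 0" by auto
      then show "x + y \<in> ?D"
        by (auto simp: act_rules intro!: exI[of _ "max J J'"])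
    qed (auto simp: act_rules)
    fix g w assume "w \<in> ?D"
    then obtain J where J: "\<And>j. j \<ge> J \<Longrightarrow> gen (L j) w = 0" "\<And>j. j \<ge> J \<Longrightarrow> gen (I j) w = 0" by auto
    let ?d = "gen_degree g"
    \<comment> \<open>The first bound avoids the central term of the bracket, the second keeps the
      shifted index of the remaining generator at least \<open>J\<close>.\<close>
    have "gen (L j) (gen g w) = 0 \<and> gen (I j) (gen g w) = 0" if "j \<ge> max (\<bar>?d\<bar> + 1) (J + \<bar>?d\<bar>)" for j
    proof -
      have "act (hv_gen_bracket (L j) g) w = 0" "act (hv_gen_bracket (I j) g) w = 0"
        using that J by (cases g; auto simp: act_rules)+
      moreover have "j \<ge> J" using that by linarith
      ultimately show ?thesis
        using J gen_commute[of "L j" g w] gen_commute[of "I j" g w] by (simp add: act_rules)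
    qed
    then show "gen g w \<in> ?D" by blast
  qed
  moreover have "v \<in> ?D"
    by (auto simp: vac \<chi>_pos intro!: exI[of _ 1])
  ultimately have "?D = UNIV" by (rule cyclic)
  then show ?thesis by auto
qed

text \<open>Newton's recursion for the coefficients of exp(-(1/c) sum_j I(-j) z^j / j) applied to
  \<open>v\<close>.\<close>

fun schur :: "nat \<Rightarrow> 'v" where
  "schur 0 = v"
| "schur (Suc k) = (- 1 / (of_nat (Suc k) * c)) *\<^sub>C
    (\<Sum>j\<in>{..k}. gen (I (- int (Suc j))) (schur (k - j)))"

lemma schur_rec: "(of_nat k * c) *\<^sub>C schur k = - (\<Sum>j\<in>{1..k}. gen (I (- int j)) (schur (k - j)))"
proof (cases k)
  case (Suc n)
  have "(\<Sum>j\<in>{1..k}. gen (I (- int j)) (schur (k - j))) = (\<Sum>j\<in>{..n}. gen (I (- int (Suc j))) (schur (n - j)))"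
    unfolding Suc One_nat_def sum.atLeast_Suc_atMost_Suc_shift atMost_atLeast0
    by (simp del: schur.simps of_nat_Suc)
  moreover have "of_nat (Suc n) * c * (- 1 / (of_nat (Suc n) * c)) = - 1"
    using c_nz by (simp del: of_nat_Suc)
  ultimately show ?thesis
    unfolding Suc schur.simps scaleC_scaleC by (simp add: scaleC_one)
qed simp

lemma schur_cancel:
  fixes x y :: 'v
  assumes "k > 0" "(of_nat k * c) *\<^sub>C x = (of_nat k * c) *\<^sub>C y"
  shows "x = y"
  by (rule complex_vector.scale_left_imp_eq[OF _ assms(2)]) (use assms c_nz in simp)

lemma gen_I_schur: "n > 0 \<Longrightarrow> gen (I n) (schur k) = 0"
proof (induction k rule: less_induct)
  case (less k)
  show ?case
  proof (cases "k = 0")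
    case True
    then show ?thesis using less by (simp add: vac \<chi>_pos)
  next
    case False
    have "(of_nat k * c) *\<^sub>C gen (I n) (schur k) = gen (I n) ((of_nat k * c) *\<^sub>C schur k)"
      by (simp add: act_rules)
    also have "\<dots> = - (\<Sum>j\<in>{1..k}. gen (I (- int j)) (gen (I n) (schur (k - j))))"
      unfolding schur_rec by (simp add: act_rules clinear_sum[OF clinear_act] gen_I_I[of n])
    also have "\<dots> = 0"
      using less by (simp add: act_rules)
    finally show ?thesis using False c_nz by simp
  qed
qed

lemma gen_I0: "gen (I 0) x = \<chi> (I 0) *\<^sub>C x"
proof -
  have "lie_submodule act {x. gen (I 0) x = \<chi> (I 0) *\<^sub>C x}"
  proof (rule lie_submodule_genI)
    show "complex_vector.subspace {x. gen (I 0) x = \<chi> (I 0) *\<^sub>C x}"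
      by (rule subspace_clinear_eq[OF clinear_act clinearI]) (simp_all add: scaleC_add_right scaleC_scaleC mult.commute)
    show "gen a x \<in> {x. gen (I 0) x = \<chi> (I 0) *\<^sub>C x}" if "x \<in> {x. gen (I 0) x = \<chi> (I 0) *\<^sub>C x}" for a x
      using that by (cases a) (auto simp: gen_commute[of "I 0"] act_rules gen_central)
  qed
  moreover have "v \<in> {x. gen (I 0) x = \<chi> (I 0) *\<^sub>C x}" by (simp add: vac)
  ultimately have "{x. gen (I 0) x = \<chi> (I 0) *\<^sub>C x} = UNIV" by (rule cyclic)
  then show ?thesis by auto
qed

lemma gen_L0_gen: "gen (L 0) (gen g x) = gen g (gen (L 0) x) + of_int (gen_degree g) *\<^sub>C gen g x"
  using gen_commute[of "L 0" g x] by (simp add: bracket_L0 act_rules)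

lemma gen_L0_schur: "gen (L 0) (schur k) = (\<chi> (L 0) + of_nat k) *\<^sub>C schur k"
proof (induction k rule: less_induct)
  case (less k)
  show ?case
  proof (cases "k = 0")
    case True
    then show ?thesis by (simp add: vac)
  next
    case False
    have "(of_nat k * c) *\<^sub>C gen (L 0) (schur k) = gen (L 0) ((of_nat k * c) *\<^sub>C schur k)"
      by (simp add: act_rules)
    also have "\<dots> = - (\<Sum>j\<in>{1..k}. gen (I (- int j)) (gen (L 0) (schur (k - j))) + of_nat j *\<^sub>C gen (I (- int j)) (schur (k - j)))"
      unfolding schur_rec by (simp add: act_rules clinear_sum[OF clinear_act] gen_L0_gen)
    also have "\<dots> = - (\<Sum>j\<in>{1..k}. (\<chi> (L 0) + of_nat k) *\<^sub>C gen (I (- int j)) (schur (k - j)))"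
      using less by (intro arg_cong[where f = uminus] sum.cong)
        (auto simp: act_rules of_nat_diff simp flip: scaleC_add_left)
    also have "\<dots> = (\<chi> (L 0) + of_nat k) *\<^sub>C ((of_nat k * c) *\<^sub>C schur k)"
      unfolding schur_rec by (simp add: complex_vector.scale_sum_right)
    also have "\<dots> = (of_nat k * c) *\<^sub>C ((\<chi> (L 0) + of_nat k) *\<^sub>C schur k)"
      by (rule complex_vector.scale_left_commute)
    finally show ?thesis
      using schur_cancel False by blast
  qed
qed

lemma gen_L_schur:
  assumes "n > 0"
  shows "gen (L (int n)) (schur k) = (if n \<le> k then (of_nat k - of_int p) *\<^sub>C schur (k - n) else 0)"
proof (induction k rule: less_induct)
  case (less k)
  show ?case
  proof (cases "k = 0")
    case True
    then show ?thesis using assms by (simp add: vac \<chi>_pos)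
  next
    case False
    let ?I = "\<lambda>j. gen (I (- int j))"
    \<comment> \<open>Three contributions when L(n) meets I(-j): \<open>?A\<close> is L(n) moved on
      to the remaining factor, evaluated by induction; \<open>?B\<close> is the negative operator
      I(n - j) from the bracket; \<open>?C\<close> is the scalar from I(0) and the central term. For
      j < n the bracket leaves a positive I(n - j), which kills \<open>schur\<close>.\<close>
    let ?A = "\<lambda>j. if j + n \<le> k then (of_nat k - of_nat j - of_int p) *\<^sub>C ?I j (schur (k - n - j)) else 0"
    let ?B = "\<lambda>j. if n < j then of_nat j *\<^sub>C gen (I (int n - int j)) (schur (k - j)) else 0"
    let ?C = "\<lambda>j. if j = n then (of_nat n * (of_int p - of_nat n) * c) *\<^sub>C schur (k - n) else 0"
    have coef: "of_nat n * \<chi> (I 0) - ((of_nat n) ^ 2 + of_nat n) * c = of_nat n * (of_int p - of_nat n) * c"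
      by (simp add: \<chi>_I0 algebra_simps power2_eq_square)
    have summand: "gen (L (int n)) (?I j (schur (k - j))) = ?A j + ?B j + ?C j" if "j \<in> {1..k}" for j
    proof -
      have "?I j (gen (L (int n)) (schur (k - j))) = ?A j"
        using that less.IH[of "k - j"] by (auto simp: act_rules of_nat_diff diff_right_commute add.commute)
      moreover have "of_int (- int j) *\<^sub>C gen (I (int n + - int j)) (schur (k - j)) =
          (if j = n then - ((of_nat n * \<chi> (I 0)) *\<^sub>C schur (k - n)) else - ?B j)"
        using gen_I_schur[of "int n - int j"] by (auto simp: gen_I0 scaleC_scaleC)
      ultimately show ?thesis
        by (auto simp: gen_L_I coef simp flip: complex_vector.scale_left_diff_distrib)
    qed
    have "(of_nat k * c) *\<^sub>C gen (L (int n)) (schur k) = gen (L (int n)) ((of_nat k * c) *\<^sub>C schur k)"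
      by (simp add: act_rules)
    also have "\<dots> = - (\<Sum>j\<in>{1..k}. ?A j + ?B j + ?C j)"
      unfolding schur_rec using summand by (simp add: act_rules clinear_sum[OF clinear_act])
    finally have eq: "(of_nat k * c) *\<^sub>C gen (L (int n)) (schur k) =
        - ((\<Sum>j\<in>{1..k}. ?A j) + (\<Sum>j\<in>{1..k}. ?B j) + (\<Sum>j\<in>{1..k}. ?C j))"
      by (simp only: sum.distrib)
    show ?thesis
    proof (cases "n \<le> k")
      case False
      then have "(\<Sum>j\<in>{1..k}. ?A j) = 0" "(\<Sum>j\<in>{1..k}. ?B j) = 0" "(\<Sum>j\<in>{1..k}. ?C j) = 0"
        by (intro sum.neutral; auto)+
      then show ?thesis
        using eq False \<open>k \<noteq> 0\<close> c_nz by simp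
    next
      case True
      let ?s = "\<lambda>j. ?I j (schur (k - n - j))"
      have A: "(\<Sum>j\<in>{1..k}. ?A j) = (\<Sum>j\<in>{1..k - n}. (of_nat k - of_nat j - of_int p) *\<^sub>C ?s j)"
        by (rule sum.mono_neutral_cong_right) auto
      have "(\<Sum>j\<in>{1..k}. ?B j) = (\<Sum>j\<in>{1 + n..(k - n) + n}. of_nat j *\<^sub>C gen (I (int n - int j)) (schur (k - j)))"
        by (rule sum.mono_neutral_cong_right) (use True in auto)
      also have "\<dots> = (\<Sum>j\<in>{1..k - n}. of_nat (j + n) *\<^sub>C ?s j)"
        unfolding sum.shift_bounds_cl_nat_ivl by (intro sum.cong refl) (simp add: diff_diff_eq add.commute)
      finally have B: "(\<Sum>j\<in>{1..k}. ?B j) = (\<Sum>j\<in>{1..k - n}. of_nat (j + n) *\<^sub>C ?s j)" .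
      have C: "(\<Sum>j\<in>{1..k}. ?C j) = (of_nat n * (of_int p - of_nat n) * c) *\<^sub>C schur (k - n)"
        using True assms by simp
      \<comment> \<open>After the index shift by \<open>n\<close> the coefficients k - j - p and j +
        n add up to k + n - p, independently of \<open>j\<close>, so the recursion for
        \<open>schur (k - n)\<close> sums the series.\<close>
      have "(\<Sum>j\<in>{1..k}. ?A j) + (\<Sum>j\<in>{1..k}. ?B j) = (of_nat k + of_nat n - of_int p) *\<^sub>C (\<Sum>j\<in>{1..k - n}. ?s j)"
        unfolding A B complex_vector.scale_sum_right sum.distrib[symmetric]
        by (intro sum.cong refl) (simp flip: scaleC_add_left)
      also have "(\<Sum>j\<in>{1..k - n}. ?s j) = - ((of_nat (k - n) * c) *\<^sub>C schur (k - n))"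
        by (simp add: schur_rec)
      finally have AB: "(\<Sum>j\<in>{1..k}. ?A j) + (\<Sum>j\<in>{1..k}. ?B j) =
        - (((of_nat k + of_nat n - of_int p) * (of_nat (k - n) * c)) *\<^sub>C schur (k - n))"
        by (simp add: scaleC_scaleC)
      have "(of_nat k * c) *\<^sub>C gen (L (int n)) (schur k) =
        ((of_nat k + of_nat n - of_int p) * (of_nat (k - n) * c) - of_nat n * (of_int p - of_nat n) * c) *\<^sub>C schur (k - n)"
        unfolding eq AB C by (simp add: complex_vector.scale_left_diff_distrib)
      also have "(of_nat k + of_nat n - of_int p) * (of_nat (k - n) * c) - of_nat n * (of_int p - of_nat n) * c
        = of_nat k * c * (of_nat k - of_int p)"
        using True by (simp add: of_nat_diff algebra_simps)
      finally have "(of_nat k * c) *\<^sub>C gen (L (int n)) (schur k) =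
          (of_nat k * c) *\<^sub>C ((of_nat k - of_int p) *\<^sub>C schur (k - n))"
        unfolding scaleC_scaleC .
      then have "gen (L (int n)) (schur k) = (of_nat k - of_int p) *\<^sub>C schur (k - n)"
        using schur_cancel \<open>k \<noteq> 0\<close> by blast
      then show ?thesis using True by simp
    qed
  qed
qed

end

section \<open>Positive weights and the vanishing of the singular vector\<close>

context hv_cyclic
begin

primrec weight_kill :: "nat \<Rightarrow> 'v \<Rightarrow> 'v" where
  "weight_kill 0 x = x"
| "weight_kill (Suc n) x = gen (L 0) (weight_kill n x) - (\<chi> (L 0) + of_nat (Suc n)) *\<^sub>C weight_kill n x"

lemma clinear_weight_kill: "clinear (weight_kill n)"
proof (induction n)
  case 0
  show ?case by (rule clinearI) simp_all
next
  case (Suc n)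
  show ?case
    by (rule clinearI)
      (simp_all add: clinear_add[OF Suc] clinear_scale[OF Suc] act_rules scaleC_add_right
        complex_vector.scale_right_diff_distrib complex_vector.scale_left_commute[of "\<chi> (L 0) + _"])
qed

lemma weight_kill_eigen:
  assumes "gen (L 0) x = (\<chi> (L 0) + a) *\<^sub>C x"
  shows "weight_kill n x = (\<Prod>i\<in>{1..n}. a - of_nat i) *\<^sub>C x"
proof (induction n)
  case (Suc n)
  then show ?case
    by (simp add: act_rules assms scaleC_scaleC flip: complex_vector.scale_left_diff_distrib)
      (simp add: algebra_simps)
qed (simp add: scaleC_one)

lemma weight_kill_mono: "weight_kill n x = 0 \<Longrightarrow> n \<le> m \<Longrightarrow> weight_kill m x = 0"
proof (induction m)
  case (Suc m)
  then show ?case by (cases "n = Suc m") (simp_all add: act_rules)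
qed simp

text \<open>A finite product of factors L(0) - \<open>\<chi> (L 0)\<close> - i with i >= 1
  annihilates any finite sum of vectors of positive weight, but multiplies \<open>v\<close> by a
  product of the nonzero numbers -i.\<close>

lemma v_not_in_positive_weights:
  assumes "x \<in> complex_vector.span (\<Union>i\<in>{1..}. {x. gen (L 0) x = (\<chi> (L 0) + of_nat i) *\<^sub>C x})"
  shows "x \<noteq> v"
proof -
  have "\<exists>n. weight_kill n x = 0"
    using assms
  proof (induction rule: complex_vector.span_induct_alt)
    case base
    show ?case using clinear_0[OF clinear_weight_kill] by blast
  next
    case (step r x y)
    then obtain i where i: "i \<ge> 1" "gen (L 0) x = (\<chi> (L 0) + of_nat i) *\<^sub>C x" by auto
    have "(\<Prod>j\<in>{1..i}. of_nat i - of_nat j) = (0 :: complex)"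
      by (rule prod_zero) (use i in auto)
    then have "weight_kill i x = 0" using weight_kill_eigen[OF i(2), of i] by simp
    moreover obtain n where "weight_kill n y = 0" using step by auto
    ultimately have "weight_kill (max i n) x = 0" "weight_kill (max i n) y = 0"
      using weight_kill_mono by (meson max.cobounded1, meson max.cobounded2)
    then have "weight_kill (max i n) (r *\<^sub>C x + y) = 0"
      by (simp add: clinear_add[OF clinear_weight_kill] clinear_scale[OF clinear_weight_kill])
    then show ?case by blast
  qed
  moreover have "weight_kill n v \<noteq> 0" for n
  proof -
    have "weight_kill n v = (\<Prod>i\<in>{1..n}. 0 - of_nat i) *\<^sub>C v"
      by (rule weight_kill_eigen) (simp add: vac)
    then show ?thesis using v_nz by simp
  qed
  ultimately show ?thesis by auto
qed

end

locale hv_simple = hv_cyclic act \<chi> c p v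
  for act :: "hv \<Rightarrow> 'v::complex_vector \<Rightarrow> 'v" and \<chi> c p v +
  assumes simple: "lie_submodule act N \<Longrightarrow> N = {0} \<or> N = UNIV"
begin

text \<open>By \<open>gen_L_schur\<close> the vector has the factor p - p under every L(n), n > 0,
  so it is singular. If nonzero it would generate the whole module, yet negative generators only
  increase its weight p > 0, and \<open>v\<close> would never be reached.\<close>

lemma schur_singular_eq_0: "schur (nat p) = 0"
proof (rule ccontr)
  let ?u = "schur (nat p)"
  let ?W = "\<lambda>i. {x. gen (L 0) x = (\<chi> (L 0) + of_nat i) *\<^sub>C x}"
  let ?S = "complex_vector.span (\<Union>i\<in>{1..}. ?W i)"
  assume u: "?u \<noteq> 0"
  have "lie_submodule act (neg_span act {?u})"
  proof (rule lie_submodule_neg_span)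
    fix g z assume "z \<in> {?u}" "\<not> neg_gen g"
    then have z: "z = ?u" and g: "\<not> neg_gen g" by auto
    have pos: "gen (L n) ?u = 0" if "n > 0" for n
      using gen_L_schur[of "nat n" "nat p"] that p_pos by simp
    have "\<exists>a. gen g ?u = a *\<^sub>C ?u"
    proof (cases g)
      case (L n)
      then show ?thesis
        using g pos[of n] gen_L0_schur[of "nat p"] by (cases "n = 0") (auto intro: exI[of _ 0])
    next
      case (I n)
      then show ?thesis
        using g gen_I_schur[of n "nat p"] gen_I0[of ?u] by (cases "n = 0") (auto intro: exI[of _ 0])
    next
      case C_I
      then show ?thesis by (auto simp: gen_central intro: exI[of _ 0])
    qed (auto simp: gen_central)
    then show "gen g z \<in> complex_vector.span {?u}"
      unfolding z using complex_vector.span_scale[OF complex_vector.span_base[of ?u "{?u}"]] by auto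
  qed
  then have "neg_span act {?u} = UNIV"
    using simple neg_span.base[OF complex_vector.span_base, of ?u "{?u}" act] u by blast
  then have "v \<in> neg_span act {?u}" by simp
  then have "v \<in> ?S"
  proof (induction rule: neg_span.induct)
    case (base z)
    have "?u \<in> ?S"
      by (rule complex_vector.span_base) (use gen_L0_schur[of "nat p"] p_pos in \<open>auto intro!: bexI[of _ "nat p"]\<close>)
    then have "complex_vector.span {?u} \<subseteq> ?S"
      by (intro complex_vector.span_minimal complex_vector.subspace_span) auto
    then show ?case using base by blast
  next
    case (gen x g)
    from gen.IH show ?case
    proof (induction rule: complex_vector.span_induct_alt)
      case base
      show ?case by (simp add: act_rules complex_vector.span_zero)
    next
      case (step r x y)
      then obtain i where i: "i \<ge> 1" "gen (L 0) x = (\<chi> (L 0) + of_nat i) *\<^sub>C x" by auto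
      have "gen_degree g > 0" using gen.hyps by (cases g) auto
      then have "gen g x \<in> ?W (i + nat (gen_degree g))"
        using i by (simp add: gen_L0_gen act_rules flip: scaleC_add_left)
      then have "gen g x \<in> ?S"
        using i by (intro complex_vector.span_base UN_I[of "i + nat (gen_degree g)"]) auto
      then show ?case
        using step by (simp add: act_rules complex_vector.span_add complex_vector.span_scale)
    qed
  qed (auto intro: complex_vector.span_add complex_vector.span_scale)
  then show False using v_not_in_positive_weights by blast
qed

end

section \<open>Operators on the first tensor factor\<close>

locale hv_simple_tensor = hv_simple act \<chi> c p v + hv_tensor act \<alpha> \<beta> F
  for act :: "hv \<Rightarrow> 'v::complex_vector \<Rightarrow> 'v" and \<chi> c p v \<alpha> \<beta> F
begin

definition tmap :: "(int \<Rightarrow> (int \<Rightarrow>\<^sub>0 complex)) \<Rightarrow> (int \<Rightarrow>\<^sub>0 complex, 'v) tensor \<Rightarrow> (int \<Rightarrow>\<^sub>0 complex, 'v) tensor"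
  where "tmap a = tensor_lift (\<lambda>f w. lin_ext a f \<otimes>\<^sub>C w)"

lemma tmap_bilinear: "cbilinear (\<lambda>f w. lin_ext a f \<otimes>\<^sub>C (w :: 'v))"
  by (rule cbilinearI) (simp_all add: lin_ext_rules pure_rules)

lemma clinear_tmap: "clinear (tmap a)"
  unfolding tmap_def by (rule clinear_tensor_lift[OF tmap_bilinear])

lemma tmap_pure [simp]: "tmap a (fbasis m \<otimes>\<^sub>C w) = a m \<otimes>\<^sub>C w"
  unfolding tmap_def by (simp add: tmap_bilinear)

lemmas tmap_rules = clinear_add[OF clinear_tmap] clinear_scale[OF clinear_tmap] clinear_0[OF clinear_tmap]

definition shift :: "int \<Rightarrow> (int \<Rightarrow>\<^sub>0 complex, 'v) tensor \<Rightarrow> (int \<Rightarrow>\<^sub>0 complex, 'v) tensor"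
  where "shift k = tmap (\<lambda>m. fbasis (m + k))"

definition index_op :: "(int \<Rightarrow>\<^sub>0 complex, 'v) tensor \<Rightarrow> (int \<Rightarrow>\<^sub>0 complex, 'v) tensor"
  where "index_op = tmap (\<lambda>m. of_int m *\<^sub>C fbasis m)"

lemma shift_pure [simp]: "shift k (fbasis m \<otimes>\<^sub>C w) = fbasis (m + k) \<otimes>\<^sub>C w"
  by (simp add: shift_def)

lemma index_op_pure [simp]: "index_op (fbasis m \<otimes>\<^sub>C w) = of_int m *\<^sub>C (fbasis m \<otimes>\<^sub>C w)"
  by (simp add: index_op_def pure_rules)

lemmas shift_rules = tmap_rules[of "\<lambda>m. fbasis (m + _)", folded shift_def]
lemmas index_op_rules = tmap_rules[of "\<lambda>m. of_int m *\<^sub>C fbasis m", folded index_op_def]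

lemma shift_0: "shift 0 t = t"
proof -
  have "t \<in> {t. shift 0 t = (\<lambda>t. t) t}"
    by (rule tensor_mem_subspace[OF subspace_clinear_eq]) (auto intro!: clinearI simp: shift_rules)
  then show ?thesis by simp
qed

text \<open>For large \<open>j\<close> only the first factor feels the generator. The threshold
  depends on the second components alone, which \<open>shift\<close> leaves unchanged, so a single
  \<open>J\<close> serves all \<open>k\<close>.\<close>

lemma gen_shift:
  "\<exists>J. \<forall>j\<ge>J. \<forall>k. T.gen (I j) (shift k t) = F *\<^sub>C shift (k + j) t \<and>
    T.gen (L j) (shift k t) =
      - (shift (k + j) (index_op t) + (of_int k + \<alpha> + \<beta> + of_int j * \<beta>) *\<^sub>C shift (k + j) t)"
proof -
  let ?P = "\<lambda>t j k. T.gen (I j) (shift k t) = F *\<^sub>C shift (k + j) t \<and>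
    T.gen (L j) (shift k t) =
      - (shift (k + j) (index_op t) + (of_int k + \<alpha> + \<beta> + of_int j * \<beta>) *\<^sub>C shift (k + j) t)"
  have "t \<in> {t. \<exists>J. \<forall>j\<ge>J. \<forall>k. ?P t j k}"
  proof (rule tensor_mem_subspace)
    show "complex_vector.subspace {t. \<exists>J. \<forall>j\<ge>J. \<forall>k. ?P t j k}"
      unfolding complex_vector.subspace_def
    proof (intro conjI ballI allI)
      show "0 \<in> {t. \<exists>J. \<forall>j\<ge>J. \<forall>k. ?P t j k}"
        by (simp add: shift_rules index_op_rules T.act_rules)
      fix x y assume "x \<in> {t. \<exists>J. \<forall>j\<ge>J. \<forall>k. ?P t j k}" "y \<in> {t. \<exists>J. \<forall>j\<ge>J. \<forall>k. ?P t j k}"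
      then obtain J J' where J: "\<And>j k. j \<ge> J \<Longrightarrow> ?P x j k" "\<And>j k. j \<ge> J' \<Longrightarrow> ?P y j k" by blast
      have "?P (x + y) j k" if "j \<ge> max J J'" for j k
      proof -
        have "?P x j k" "?P y j k" using that J by auto
        then show ?thesis
          by (simp add: shift_rules index_op_rules T.act_rules scaleC_add_right)
      qed
      then show "x + y \<in> {t. \<exists>J. \<forall>j\<ge>J. \<forall>k. ?P t j k}" by blast
    next
      fix r x assume "x \<in> {t. \<exists>J. \<forall>j\<ge>J. \<forall>k. ?P t j k}"
      then obtain J where J: "\<And>j k. j \<ge> J \<Longrightarrow> ?P x j k" by blast
      have "?P (r *\<^sub>C x) j k" if "j \<ge> J" for j k
        using J[OF that, of k]
        by (simp add: shift_rules index_op_rules T.act_rules scaleC_add_right scaleC_scaleC mult.commute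
            complex_vector.scale_right_diff_distrib)
      then show "r *\<^sub>C x \<in> {t. \<exists>J. \<forall>j\<ge>J. \<forall>k. ?P t j k}" by blast
    qed
    fix m w
    obtain J where J: "\<And>j. j \<ge> J \<Longrightarrow> gen (L j) w = 0 \<and> gen (I j) w = 0"
      using locally_nilpotent by blast
    have "?P (fbasis m \<otimes>\<^sub>C w) j k" if "j \<ge> J" for j k
      using J[OF that]
      by (simp add: T_gen_I T_gen_L pure_rules shift_rules add.assoc scaleC_scaleC flip: scaleC_add_left)
    then show "fbasis m \<otimes>\<^sub>C w \<in> {t. \<exists>J. \<forall>j\<ge>J. \<forall>k. ?P t j k}" by blast
  qed
  then show ?thesis by blast
qed

text \<open>The clause that \<open>w\<close> vanishes outside \<open>A\<close> allows two
  decompositions to be extended to a common index set and added.\<close>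

lemma tensor_decompose:
  fixes t :: "(int \<Rightarrow>\<^sub>0 complex, 'v) tensor"
  shows "\<exists>A w. finite A \<and> (\<forall>m. m \<notin> A \<longrightarrow> w m = 0) \<and> t = (\<Sum>m\<in>A. fbasis m \<otimes>\<^sub>C (w m :: 'v))"
proof -
  let ?P = "\<lambda>(t :: (int \<Rightarrow>\<^sub>0 complex, 'v) tensor) A w. finite A \<and> (\<forall>m. m \<notin> A \<longrightarrow> w m = 0) \<and> t = (\<Sum>m\<in>A. fbasis m \<otimes>\<^sub>C (w m :: 'v))"
  have "t \<in> {t. \<exists>A w. ?P t A w}"
  proof (rule tensor_mem_subspace)
    show "complex_vector.subspace {t. \<exists>A w. ?P t A w}"
      unfolding complex_vector.subspace_def
    proof (intro conjI ballI allI)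
      show "0 \<in> {t. \<exists>A w. ?P t A w}"
        by (auto intro!: exI[of _ "{}"] exI[of _ "\<lambda>_. 0"])
      fix x y assume "x \<in> {t. \<exists>A w. ?P t A w}" "y \<in> {t. \<exists>A w. ?P t A w}"
      then obtain A w A' w' where 1: "?P x A w" and 2: "?P y A' w'" by blast
      have xy: "x = (\<Sum>m\<in>A \<union> A'. fbasis m \<otimes>\<^sub>C w m)" "y = (\<Sum>m\<in>A \<union> A'. fbasis m \<otimes>\<^sub>C w' m)"
        using 1 2 by (auto intro!: sum.mono_neutral_left simp: pure_rules)
      have "x + y = (\<Sum>m\<in>A \<union> A'. fbasis m \<otimes>\<^sub>C (w m + w' m))"
        by (subst xy(1), subst xy(2)) (simp add: pure_rules sum.distrib)
      moreover have "finite (A \<union> A')" "\<forall>m. m \<notin> A \<union> A' \<longrightarrow> w m + w' m = 0"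
        using 1 2 by (blast, metis UnCI add_0)
      ultimately show "x + y \<in> {t. \<exists>A w. ?P t A w}"
        by (intro CollectI exI[of _ "A \<union> A'"] exI[of _ "\<lambda>m. w m + w' m"] conjI)
    next
      fix r x assume "x \<in> {t. \<exists>A w. ?P t A w}"
      then obtain A and w :: "int \<Rightarrow> 'v" where 1: "finite A" "\<forall>m. m \<notin> A \<longrightarrow> w m = 0"
        and x: "x = (\<Sum>m\<in>A. fbasis m \<otimes>\<^sub>C w m)" by blast
      have "r *\<^sub>C x = (\<Sum>m\<in>A. fbasis m \<otimes>\<^sub>C (r *\<^sub>C w m))"
        unfolding x by (simp only: pure_rules complex_vector.scale_sum_right)
      moreover have "\<forall>m. m \<notin> A \<longrightarrow> r *\<^sub>C w m = 0"
        using 1(2) by simp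
      ultimately show "r *\<^sub>C x \<in> {t. \<exists>A w. ?P t A w}"
        using 1(1) by (intro CollectI exI[of _ A] exI[of _ "\<lambda>m. r *\<^sub>C w m"] conjI)
    qed
    fix m w
    show "fbasis m \<otimes>\<^sub>C w \<in> {t. \<exists>A w. ?P t A w}"
      by (intro CollectI exI[of _ "{m}"] exI[of _ "\<lambda>n. if n = m then w else 0"]) simp
  qed
  then show ?thesis by simp
qed

end

section \<open>Submodules of the tensor product\<close>

context hv_simple_tensor
begin

lemma submodule_contains_pure:
  assumes F: "F \<noteq> 0" and N: "lie_submodule (tensor_act (intermediate_act \<alpha> \<beta> F) act) N" and "N \<noteq> {0}"
  shows "\<exists>K. \<forall>m\<ge>K. fbasis m \<otimes>\<^sub>C v \<in> N"
proof -
  have sub: "complex_vector.subspace N" and inv: "\<And>x t. t \<in> N \<Longrightarrow> tensor_act (intermediate_act \<alpha> \<beta> F) act x t \<in> N"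
    using N by (auto simp: lie_submodule_def)
  note add = complex_vector.subspace_add[OF sub] and scale = complex_vector.subspace_scale[OF sub]
    and neg = complex_vector.subspace_neg[OF sub] and diff = complex_vector.subspace_diff[OF sub]
  \<comment> \<open>For large \<open>j\<close> the operators \<open>L j\<close> and \<open>I j\<close> act on the first factor only, so \<open>P\<close> is stable under
    multiplication by the index and contains the components of its elements.\<close>
  define P where "P = {t. \<exists>K. \<forall>M\<ge>K. shift M t \<in> N}"
  have P: "complex_vector.subspace P"
    unfolding complex_vector.subspace_def
  proof (intro conjI ballI allI)
    show "0 \<in> P" by (simp add: P_def shift_rules complex_vector.subspace_0[OF sub])
    fix x y assume "x \<in> P" "y \<in> P"
    then obtain K K' where "\<And>M. M \<ge> K \<Longrightarrow> shift M x \<in> N" "\<And>M. M \<ge> K' \<Longrightarrow> shift M y \<in> N"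
      by (auto simp: P_def)
    then have "shift M (x + y) \<in> N" if "M \<ge> max K K'" for M
      using that by (simp add: shift_rules add)
    then show "x + y \<in> P" unfolding P_def by blast
  next
    fix r x assume "x \<in> P"
    then obtain K where "\<And>M. M \<ge> K \<Longrightarrow> shift M x \<in> N" by (auto simp: P_def)
    then have "shift M (r *\<^sub>C x) \<in> N" if "M \<ge> K" for M
      using that by (simp add: shift_rules scale)
    then show "r *\<^sub>C x \<in> P" unfolding P_def by blast
  qed
  have N_P: "t \<in> P" if "t \<in> N" for t
  proof -
    obtain J where J: "\<And>j k. j \<ge> J \<Longrightarrow> T.gen (I j) (shift k t) = F *\<^sub>C shift (k + j) t"
      using gen_shift[of t] by blast
    have "shift M t \<in> N" if "M \<ge> J" for M
    proof -
      have "F *\<^sub>C shift M t \<in> N"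
        using J[OF that, of 0] inv[OF \<open>t \<in> N\<close>] by (metis add_0 shift_0)
      from scale[OF this, of "1 / F"] show ?thesis using F by (simp add: scaleC_scaleC scaleC_one)
    qed
    then show ?thesis unfolding P_def by blast
  qed
  have E_P: "index_op t \<in> P" if "t \<in> P" for t
  proof -
    obtain J where J: "\<And>j k. j \<ge> J \<Longrightarrow> T.gen (L j) (shift k t) =
      - (shift (k + j) (index_op t) + (of_int k + \<alpha> + \<beta> + of_int j * \<beta>) *\<^sub>C shift (k + j) t)"
      using gen_shift[of t] by blast
    obtain K where K: "\<And>M. M \<ge> K \<Longrightarrow> shift M t \<in> N" using \<open>t \<in> P\<close> by (auto simp: P_def)
    have "shift M (index_op t) \<in> N" if "M \<ge> max K (K + J)" for M
    proof -
      let ?a = "of_int (M - J) + \<alpha> + \<beta> + of_int J * \<beta>"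
      have "T.gen (L J) (shift (M - J) t) \<in> N" by (intro inv K) (use that in simp)
      moreover have "shift M (index_op t) = - (T.gen (L J) (shift (M - J) t)) - ?a *\<^sub>C shift M t"
        using J[of J "M - J"] by simp
      ultimately show ?thesis
        using K[of M] that by (simp add: diff neg scale del: of_int_diff)
    qed
    then show ?thesis unfolding P_def by blast
  qed
  obtain t where t: "t \<in> N" "t \<noteq> 0"
    using \<open>N \<noteq> {0}\<close> complex_vector.subspace_0[OF sub] by blast
  obtain A and w :: "int \<Rightarrow> 'v" where A: "finite A" and t_sum: "t = (\<Sum>m\<in>A. fbasis m \<otimes>\<^sub>C w m)"
    using tensor_decompose[of t] by blast
  obtain m where m: "m \<in> A" "w m \<noteq> 0"
  proof (rule ccontr)
    assume "\<not> thesis"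
    then have "\<And>m. m \<in> A \<Longrightarrow> w m = 0" using that by blast
    then have "t = 0" unfolding t_sum by (intro sum.neutral) (simp add: pure_rules)
    then show False using t by simp
  qed
  have "(\<Sum>m\<in>A. fbasis m \<otimes>\<^sub>C w m) \<in> P" using N_P[OF t(1)] t_sum by simp
  then have wm: "fbasis m \<otimes>\<^sub>C w m \<in> P"
    by (intro eigen_components_mem[where T = index_op and S = P and A = A and e = of_int and f = "\<lambda>m. fbasis m \<otimes>\<^sub>C w m"] P E_P A m(1))
      (simp_all add: index_op_def clinear_tmap pure_rules inj_on_def)
  \<comment> \<open>Requiring membership only for large \<open>M\<close> absorbs the change of index
    caused by a generator. The set is therefore a submodule of L, and it is everything once it
    contains the nonzero \<open>w m\<close>.\<close>
  define Q where "Q = {x. \<exists>K. \<forall>M\<ge>K. fbasis M \<otimes>\<^sub>C (x :: 'v) \<in> N}"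
  have "w m \<in> Q"
  proof -
    obtain K where K: "\<And>M. M \<ge> K \<Longrightarrow> fbasis (m + M) \<otimes>\<^sub>C w m \<in> N"
      using wm by (auto simp: P_def)
    have "fbasis M \<otimes>\<^sub>C w m \<in> N" if "M \<ge> K + m" for M
      using K[of "M - m"] that by simp
    then show ?thesis unfolding Q_def by blast
  qed
  have "lie_submodule act Q"
  proof (rule lie_submodule_genI)
    show "complex_vector.subspace Q"
      unfolding complex_vector.subspace_def
    proof (intro conjI ballI allI)
      show "0 \<in> Q" by (simp add: Q_def pure_rules complex_vector.subspace_0[OF sub])
      fix x y assume "x \<in> Q" "y \<in> Q"
      then obtain K K' where "\<And>M. M \<ge> K \<Longrightarrow> fbasis M \<otimes>\<^sub>C x \<in> N" "\<And>M. M \<ge> K' \<Longrightarrow> fbasis M \<otimes>\<^sub>C y \<in> N"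
        by (auto simp: Q_def)
      then have "fbasis M \<otimes>\<^sub>C (x + y) \<in> N" if "M \<ge> max K K'" for M
        using that by (simp add: pure_rules add)
      then show "x + y \<in> Q" unfolding Q_def by blast
    next
      fix r x assume "x \<in> Q"
      then obtain K where "\<And>M. M \<ge> K \<Longrightarrow> fbasis M \<otimes>\<^sub>C x \<in> N" by (auto simp: Q_def)
      then have "fbasis M \<otimes>\<^sub>C (r *\<^sub>C x) \<in> N" if "M \<ge> K" for M
        using that by (simp add: pure_rules scale)
      then show "r *\<^sub>C x \<in> Q" unfolding Q_def by blast
    qed
    fix g x assume "x \<in> Q"
    then obtain K where K: "\<And>M. M \<ge> K \<Longrightarrow> fbasis M \<otimes>\<^sub>C x \<in> N" by (auto simp: Q_def)
    have "fbasis M \<otimes>\<^sub>C gen g x \<in> N" if "M \<ge> K + \<bar>gen_degree g\<bar>" for M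
    proof -
      have in_N: "T.gen g (fbasis M \<otimes>\<^sub>C x) \<in> N" "fbasis (M - gen_degree g) \<otimes>\<^sub>C x \<in> N"
        using that by (auto intro!: inv K)
      show ?thesis
      proof (cases g)
        case (L k)
        have "fbasis M \<otimes>\<^sub>C gen g x = T.gen g (fbasis M \<otimes>\<^sub>C x)
            + (of_int M + \<alpha> + \<beta> + of_int k * \<beta>) *\<^sub>C (fbasis (M + k) \<otimes>\<^sub>C x)"
          unfolding L T_gen_L by simp
        then show ?thesis using in_N L by (simp add: add scale)
      next
        case (I k)
        have "fbasis M \<otimes>\<^sub>C gen g x = T.gen g (fbasis M \<otimes>\<^sub>C x) - F *\<^sub>C (fbasis (M + k) \<otimes>\<^sub>C x)"
          unfolding I T_gen_I by simp
        then show ?thesis using in_N I by (simp add: diff scale)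
      qed (use in_N in \<open>auto simp: T_gen_central\<close>)
    qed
    then show "gen g x \<in> Q" unfolding Q_def by blast
  qed
  with \<open>w m \<in> Q\<close> have "Q = UNIV" using simple m(2) by blast
  then have "v \<in> Q" by simp
  then show ?thesis by (simp add: Q_def)
qed

text \<open>The recursion of \<open>schur\<close> is carried over to the tensor product: I(-j) on
  the second factor is its action on the product minus \<open>F\<close> times a shift of the first
  index. The descent from \<open>schur (nat p) = 0\<close> divides by k c + F for k < p, which are
  exactly the numbers assumed nonzero.\<close>

lemma submodule_descend:
  assumes F: "\<And>k. 0 \<le> k \<Longrightarrow> k < p \<Longrightarrow> F \<noteq> - (of_int k * c)"
    and N: "lie_submodule (tensor_act (intermediate_act \<alpha> \<beta> F) act) N"
    and above: "\<And>m. m > n \<Longrightarrow> fbasis m \<otimes>\<^sub>C v \<in> N"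
  shows "fbasis n \<otimes>\<^sub>C v \<in> N"
proof -
  have sub: "complex_vector.subspace N" and inv: "\<And>x t. t \<in> N \<Longrightarrow> tensor_act (intermediate_act \<alpha> \<beta> F) act x t \<in> N"
    using N by (auto simp: lie_submodule_def)
  note add = complex_vector.subspace_add[OF sub] and scale = complex_vector.subspace_scale[OF sub]
    and neg = complex_vector.subspace_neg[OF sub] and diff = complex_vector.subspace_diff[OF sub]
    and sum = complex_vector.subspace_sum[OF sub]
  have cancel: "t \<in> N" if "a \<noteq> 0" "a *\<^sub>C t \<in> N" for a t
    using scale[OF that(2), of "1 / a"] that(1) by (simp add: scaleC_scaleC scaleC_one)
  have pure_schur: "(of_nat k * c) *\<^sub>C (fbasis m \<otimes>\<^sub>C schur k) =
      - (\<Sum>j\<in>{1..k}. T.gen (I (- int j)) (fbasis m \<otimes>\<^sub>C schur (k - j)))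
      + F *\<^sub>C (\<Sum>j\<in>{1..k}. fbasis (m - int j) \<otimes>\<^sub>C schur (k - j))" for m k
  proof -
    have "clinear (\<lambda>w. fbasis m \<otimes>\<^sub>C (w :: 'v))"
      by (rule clinearI) (simp_all add: pure_rules)
    note pure_sum = clinear_sum[OF this]
    have "(of_nat k * c) *\<^sub>C (fbasis m \<otimes>\<^sub>C schur k) = fbasis m \<otimes>\<^sub>C ((of_nat k * c) *\<^sub>C schur k)"
      by (simp only: pure_rules)
    also have "\<dots> = - (\<Sum>j\<in>{1..k}. fbasis m \<otimes>\<^sub>C gen (I (- int j)) (schur (k - j)))"
      unfolding schur_rec by (simp only: pure_rules pure_sum)
    finally show ?thesis
      by (simp add: T_gen_I sum.distrib complex_vector.scale_sum_right)
  qed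
  \<comment> \<open>Induction on \<open>k\<close> is possible since the shifted terms keep the
    difference m - k and the terms under the action increase it by \<open>j\<close>.\<close>
  have high: "fbasis m \<otimes>\<^sub>C schur k \<in> N" if "m - int k > n" for m k
    using that
  proof (induction k arbitrary: m rule: less_induct)
    case (less k)
    show ?case
    proof (cases "k = 0")
      case True
      then show ?thesis using above less by simp
    next
      case False
      show ?thesis
      proof (rule cancel)
        show "of_nat k * c \<noteq> 0" using False c_nz by simp
        show "(of_nat k * c) *\<^sub>C (fbasis m \<otimes>\<^sub>C schur k) \<in> N"
          unfolding pure_schur
          by (intro add neg scale sum inv less.IH) (use less.prems in \<open>auto simp: of_nat_diff\<close>)
      qed
    qed
  qed
  define x where "x k = fbasis (n + int k) \<otimes>\<^sub>C schur k" for k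
  have rel: "(of_nat k * c) *\<^sub>C x k - F *\<^sub>C (\<Sum>j<k. x j) \<in> N" for k
  proof -
    have "(\<Sum>j\<in>{1..k}. fbasis (n + int k - int j) \<otimes>\<^sub>C schur (k - j)) = (\<Sum>j\<in>{1..k}. x (k - j))"
      by (intro sum.cong refl) (simp add: x_def of_nat_diff add_diff_eq)
    also have "\<dots> = (\<Sum>j<k. x j)"
      by (rule sum.reindex_bij_witness[where i = "\<lambda>j. k - j" and j = "\<lambda>j. k - j"]) auto
    finally have "(of_nat k * c) *\<^sub>C x k - F *\<^sub>C (\<Sum>j<k. x j) =
        - (\<Sum>j\<in>{1..k}. T.gen (I (- int j)) (fbasis (n + int k) \<otimes>\<^sub>C schur (k - j)))"
      by (simp add: x_def[of k] pure_schur)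
    also have "\<dots> \<in> N"
      by (intro neg sum inv high) (auto simp: of_nat_diff)
    finally show ?thesis .
  qed
  \<comment> \<open>Subtracting consecutive relations cancels the partial sums and leaves a two-term
    recursion.\<close>
  have step: "(of_nat (Suc k) * c) *\<^sub>C x (Suc k) - (of_nat k * c + F) *\<^sub>C x k \<in> N" for k
  proof -
    have "F *\<^sub>C (\<Sum>j<Suc k. x j) = F *\<^sub>C (\<Sum>j<k. x j) + F *\<^sub>C x k"
      by (simp only: sum.lessThan_Suc scaleC_add_right)
    moreover have "(of_nat k * c + F) *\<^sub>C x k = (of_nat k * c) *\<^sub>C x k + F *\<^sub>C x k"
      by (rule scaleC_add_left)
    moreover have "a - (b + d) - (e - b) = a - (e + d)" for a b d e :: "(int \<Rightarrow>\<^sub>0 complex, 'v) tensor"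
      by simp
    ultimately show ?thesis
      using diff[OF rel[of "Suc k"] rel[of k]] by (simp only:)
  qed
  have "x 0 \<in> N"
  proof (rule inc_induct[of 0 "nat p"])
    show "x (nat p) \<in> N"
      by (simp add: x_def schur_singular_eq_0 pure_rules complex_vector.subspace_0[OF sub])
    fix k assume k: "k < nat p" and "x (Suc k) \<in> N"
    then have "(of_nat (Suc k) * c) *\<^sub>C x (Suc k) -
        ((of_nat (Suc k) * c) *\<^sub>C x (Suc k) - (of_nat k * c + F) *\<^sub>C x k) \<in> N"
      by (intro diff[OF scale step])
    then have "(of_nat k * c + F) *\<^sub>C x k \<in> N" by simp
    moreover have "of_nat k * c + F \<noteq> 0"
      using F[of "int k"] k by (auto simp: add_eq_0_iff)
    ultimately show "x k \<in> N" by (rule cancel[rotated])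
  qed simp
  then show ?thesis by (simp add: x_def)
qed

lemma tensor_irreducible:
  assumes F: "\<And>k. 0 \<le> k \<Longrightarrow> k < p \<Longrightarrow> F \<noteq> - (of_int k * c)"
  shows "irreducible_lie_module hv_bracket (tensor_act (intermediate_act \<alpha> \<beta> F) act)"
  unfolding irreducible_lie_module_def
proof (intro conjI allI impI)
  let ?T = "tensor_act (intermediate_act \<alpha> \<beta> F) act"
  show "lie_module hv_bracket ?T" by (rule T.lie_module_axioms)
  show "\<exists>t :: (int \<Rightarrow>\<^sub>0 complex, 'v) tensor. t \<noteq> 0"
    by (rule exI, rule pure_tensor_nonzero[OF v_nz])
  fix N assume N: "lie_submodule ?T N"
  show "N = {0} \<or> N = UNIV"
  proof (cases "N = {0}")
    case False
    have sub: "complex_vector.subspace N" and inv: "\<And>x t. t \<in> N \<Longrightarrow> ?T x t \<in> N"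
      using N by (auto simp: lie_submodule_def)
    note add = complex_vector.subspace_add[OF sub] and scale = complex_vector.subspace_scale[OF sub]
      and diff = complex_vector.subspace_diff[OF sub]
    have "F \<noteq> 0" using F[of 0] p_pos by simp
    then obtain K where K: "\<And>m. m \<ge> K \<Longrightarrow> fbasis m \<otimes>\<^sub>C v \<in> N"
      using submodule_contains_pure[OF _ N False] by blast
    have v_mem: "fbasis m \<otimes>\<^sub>C v \<in> N" for m
    proof (cases "m \<ge> K")
      case False
      then have "m \<le> K" by simp
      then have "\<forall>l\<ge>m. fbasis l \<otimes>\<^sub>C v \<in> N"
      proof (induction rule: int_le_induct)
        case base
        show ?case using K by blast
      next
        case (step i)
        have "fbasis (i - 1) \<otimes>\<^sub>C v \<in> N"
          by (rule submodule_descend[OF F N]) (use step.IH in auto)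
        then show ?case
          using step.IH by (metis diff_add_cancel order_le_less zle_diff1_eq add1_zle_eq)
      qed
      then show ?thesis by simp
    qed (rule K)
    let ?Q = "{w. \<forall>m. fbasis m \<otimes>\<^sub>C (w :: 'v) \<in> N}"
    have "lie_submodule act ?Q"
    proof (rule lie_submodule_genI)
      show "complex_vector.subspace ?Q"
        unfolding complex_vector.subspace_def
        by (auto simp: pure_rules add scale complex_vector.subspace_0[OF sub])
      fix g w assume w: "w \<in> ?Q"
      have "fbasis m \<otimes>\<^sub>C gen g w \<in> N" for m
      proof -
        have "intermediate_gen_act \<alpha> \<beta> F g m \<otimes>\<^sub>C w \<in> N"
          using w by (cases g) (auto simp: pure_rules scale complex_vector.subspace_neg[OF sub]
              complex_vector.subspace_0[OF sub])
        moreover have "T.gen g (fbasis m \<otimes>\<^sub>C w) \<in> N"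
          using w by (intro inv) simp
        ultimately have "T.gen g (fbasis m \<otimes>\<^sub>C w) - intermediate_gen_act \<alpha> \<beta> F g m \<otimes>\<^sub>C w \<in> N"
          by (intro diff)
        then show ?thesis by (simp add: T_gen_pure)
      qed
      then show "gen g w \<in> ?Q" by simp
    qed
    then have Q: "?Q = UNIV" by (rule cyclic) (simp add: v_mem)
    have "w \<in> ?Q" for w
      unfolding Q by (rule UNIV_I)
    then have "fbasis m \<otimes>\<^sub>C w \<in> N" for m w
      by simp
    then have "t \<in> N" for t
      by (rule tensor_mem_subspace[OF sub])
    then show ?thesis by (intro disjI2 UNIV_eq_I[symmetric])
  qed simp
qed

end

theorem theorem5p2:
  fixes c\<^sub>L h c\<^sub>L\<^sub>I h\<^sub>I \<alpha> \<beta> F :: complex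
    and p :: int
    and act :: "hv \<Rightarrow> 'v::complex_vector \<Rightarrow> 'v"
  assumes "c\<^sub>L\<^sub>I \<noteq> 0"
    and "h\<^sub>I / c\<^sub>L\<^sub>I - 1 = of_int p" and "p > 0"
    and "irreducible_lie_module hv_bracket (intermediate_act \<alpha> \<beta> F)"
    and "irreducible_highest_weight_module c\<^sub>L 0 c\<^sub>L\<^sub>I h h\<^sub>I act"
  shows "irreducible_lie_module hv_bracket (tensor_act (intermediate_act \<alpha> \<beta> F) act) \<longleftrightarrow>
    (\<forall>i\<in>{1..p}. F \<noteq> of_int (i - p) * c\<^sub>L\<^sub>I)"
proof -
  define \<chi> where "\<chi> g = (case g of L n \<Rightarrow> (if n = 0 then h else 0) | I n \<Rightarrow> (if n = 0 then h\<^sub>I else 0)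
    | C_L \<Rightarrow> c\<^sub>L | C_LI \<Rightarrow> c\<^sub>L\<^sub>I | C_I \<Rightarrow> 0)" for g
  have irr: "irreducible_lie_module hv_bracket act"
    and cent: "act (fbasis C_L) x = c\<^sub>L *\<^sub>C x" "act (fbasis C_I) x = 0 *\<^sub>C x" "act (fbasis C_LI) x = c\<^sub>L\<^sub>I *\<^sub>C x" for x
    using assms(5) by (auto simp: irreducible_highest_weight_module_def)
  obtain v where hw: "highest_weight_vector act h h\<^sub>I v"
    and cyc: "\<And>N. lie_submodule act N \<Longrightarrow> v \<in> N \<Longrightarrow> N = UNIV"
    using assms(5) by (auto simp: irreducible_highest_weight_module_def)
  have h\<^sub>I: "h\<^sub>I = of_int (p + 1) * c\<^sub>L\<^sub>I"
    using assms(1,2) by (simp add: field_simps)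
  interpret hv_simple act \<chi> c\<^sub>L\<^sub>I p v
  proof unfold_locales
    show "cbilinear act" "\<And>x y w. act (hv_bracket x y) w = act x (act y w) - act y (act x w)"
      using irr by (auto simp: irreducible_lie_module_def lie_module_def lie_module_axioms_def)
    show "act (fbasis g) v = \<chi> g *\<^sub>C v" if "\<not> neg_gen g" for g
      using that hw cent by (cases g) (auto simp: highest_weight_vector_def \<chi>_def not_less le_less)
    show "N = {0} \<or> N = UNIV" if "lie_submodule act N" for N
      using that irr by (auto simp: irreducible_lie_module_def)
  qed (use assms hw cyc h\<^sub>I lie_algebra_hv in \<open>auto simp: \<chi>_def highest_weight_vector_def lie_algebra_def\<close>)
  interpret hv_simple_tensor act \<chi> c\<^sub>L\<^sub>I p v \<alpha> \<beta> F ..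
  show ?thesis
  proof
    assume irr: "irreducible_lie_module hv_bracket (tensor_act (intermediate_act \<alpha> \<beta> F) act)"
    show "\<forall>i\<in>{1..p}. F \<noteq> of_int (i - p) * c\<^sub>L\<^sub>I"
    proof (intro ballI notI)
      fix i assume i: "i \<in> {1..p}" and F: "F = of_int (i - p) * c\<^sub>L\<^sub>I"
      \<comment> \<open>The map from (\<open>\<alpha>\<close>, \<open>\<beta>\<close>) to
        (\<open>- \<alpha> - 1\<close>, \<open>1 - \<beta>\<close>) is an involution, so the
        intermediate factor in \<open>tensor_not_irreducible\<close> is the given one; q = p - i
        ranges over 0, ..., p - 1.\<close>
      interpret hv_pairing act \<chi> c\<^sub>L\<^sub>I p v "- \<alpha> - 1" "1 - \<beta>" "p - i"
        by unfold_locales (use i in auto)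
      have "F = - (of_int (p - i) * c\<^sub>L\<^sub>I)" by (simp add: F algebra_simps)
      then show False using tensor_not_irreducible irr by simp
    qed
  next
    assume F: "\<forall>i\<in>{1..p}. F \<noteq> of_int (i - p) * c\<^sub>L\<^sub>I"
    show "irreducible_lie_module hv_bracket (tensor_act (intermediate_act \<alpha> \<beta> F) act)"
    proof (rule tensor_irreducible)
      fix k assume "0 \<le> k" "k < p"
      then show "F \<noteq> - (of_int k * c\<^sub>L\<^sub>I)" using F[rule_format, of "p - k"] by simp
    qed
  qed
qed

end
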